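(* Let $p\in(1,\infty)$ and let $G$ and $H$ be discrete groups. If $G$ has the $p$-approximation property ($p$-AP), and $H$ has the $p$-invariant translation approximation property ($p$-ITAP), then $G\times H$ has the $p$-ITAP.
   Context: Convention: a discrete group $\Gamma$ is equipped with a proper right-invariant metric $d$ (i.e. $d(sg,tg)=d(s,t)$ and all balls are finite; in particular $\Gamma$ is countable), and $|\Gamma|$ denotes the resulting bounded geometry metric space. The product $G\times H$ carries the maximum of the metrics of $G$ and $H$. $p$-ITAP: for $T\in B(\ell^p(\Gamma))$ write $T_{s,t}=\langle T\delta_t,\delta_s\rangle$ and $\mathrm{prop}(T)=\sup\{d(s,t):T_{s,t}\neq0\}$. $B^p_u|\Gamma|$ is the operator norm closure in $B(\ell^p(\Gamma))$ of the algebra of operators with finite propagation (it does not depend on the choice of metric). The left and right regular representations on $\ell^p(\Gamma)$ are $(\lambda_sf)(t)=f(s^{-1}t)$, $(\rho_sf)(t)=f(ts)$. $F^p_\lambda(\Gamma)\subseteq B^p_u|\Gamma|$ is the norm-closed subalgebra of $B(\ell^p(\Gamma))$ generated by $\lambda(\Gamma)$. $B^p_u|\Gamma|^\Gamma$ is the set of fixed points of the action $\mathrm{Ad}(\rho_g)(T)=\rho_gT\rho_{g^{-1}}$ on $B^p_u|\Gamma|$. $\Gamma$ has the $p$-ITAP if $F^p_\lambda(\Gamma)=B^p_u|\Gamma|^\Gamma$. $p$-AP: let $1/p+1/p'=1$. $A_p(\Gamma)$ is the space of functions $f(s)=\sum_n\langle\xi_n,\lambda_s\eta_n\rangle$ with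 $\xi_n\in\ell^{p'}(\Gamma)$, $\eta_n\in\ell^p(\Gamma)$, $\sum_n\|\xi_n\|\|\eta_n\|<\infty$, with the infimum of these sums as norm; it is a Banach algebra under pointwise product, with a natural $p$-operator space structure (due to Daws). $M_{cb}A_p(\Gamma)$ is the space of $p$-completely bounded multipliers $u:\Gamma\to\mathbb{C}$ of $A_p(\Gamma)$, normed by the $p$-completely bounded norm of $f\mapsto uf$. Concretely (a known characterization), $u\in M_{cb}A_p(\Gamma)$ with norm $\le C$ iff there are a measure $\mu$ and maps $\alpha:\Gamma\to L^p(\mu)$, $\beta:\Gamma\to L^{p'}(\mu)$ with $u(st^{-1})=\langle\beta(s),\alpha(t)\rangle$ for all $s,t$ and $\sup_t\|\alpha(t)\|\sup_s\|\beta(s)\|\le C$. $Q_{pcb}(\Gamma)$ is the norm closure in $M_{cb}A_p(\Gamma)^*$ of the functionals $u\mapsto\sum_sf(s)u(s)$, $f\in\ell^1(\Gamma)$; it is a predual of $M_{cb}A_p(\Gamma)$. $\Gamma$ has the $p$-AP if there is a net $(u_\alpha)$ in $A_p(\Gamma)$ with $u_\alpha\to1$ in the $\sigma(M_{cb}A_p(\Gamma),Q_{pcb}(\Gamma))$ topology. *)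

theory Defs
  imports "HOL-Analysis.Analysis"
begin

text \<open>
  A discrete group is a type of class \<open>group_add\<close>, which is not assumed commutative: \<open>s + t\<close>, \<open>- s\<close> and
  \<open>0\<close> stand for $st$, $s^{-1}$ and $e$.  The direct product of two groups is the product type.
\<close>

section \<open>The spaces $\ell^p(I)$ and their bounded operators\<close>

definition lp :: "real \<Rightarrow> 'i set \<Rightarrow> ('i \<Rightarrow> complex) set" where
  "lp p I = {f. (\<forall>i. i \<notin> I \<longrightarrow> f i = 0) \<and> (\<lambda>i. norm (f i) powr p) summable_on UNIV}"

definition lp_norm :: "real \<Rightarrow> ('i \<Rightarrow> complex) \<Rightarrow> real" where
  "lp_norm p f = (\<Sum>\<^sub>\<infinity>i. norm (f i) powr p) powr (1 / p)"

definition conj_exponent :: "real \<Rightarrow> real" where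
  "conj_exponent p = p / (p - 1)"

text \<open>The pairing of $\ell^{p'}$ with $\ell^p$ is bilinear.\<close>

definition pairing :: "('i \<Rightarrow> complex) \<Rightarrow> ('i \<Rightarrow> complex) \<Rightarrow> complex" where
  "pairing \<xi> \<eta> = (\<Sum>\<^sub>\<infinity>i. \<xi> i * \<eta> i)"

text \<open>Elements of $B(\ell^p(I))$ are extensional functions on \<open>lp p I\<close>, so that they are equal as soon
  as they agree there.  \<open>op_norm\<close> only looks at the values on the unit ball of \<open>lp p I\<close>.\<close>

definition lp_ops :: "real \<Rightarrow> 'i set \<Rightarrow> (('i \<Rightarrow> complex) \<Rightarrow> ('i \<Rightarrow> complex)) set" where
  "lp_ops p I = {T \<in> lp p I \<rightarrow>\<^sub>E lp p I.
     (\<forall>f\<in>lp p I. \<forall>g\<in>lp p I. T (\<lambda>i. f i + g i) = (\<lambda>i. T f i + T g i)) \<and>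
     (\<forall>c. \<forall>f\<in>lp p I. T (\<lambda>i. c * f i) = (\<lambda>i. c * T f i)) \<and>
     (\<exists>C. \<forall>f\<in>lp p I. lp_norm p (T f) \<le> C * lp_norm p f)}"

definition op_norm :: "real \<Rightarrow> 'i set \<Rightarrow> (('i \<Rightarrow> complex) \<Rightarrow> ('i \<Rightarrow> complex)) \<Rightarrow> real" where
  "op_norm p I T = (SUP f\<in>{f \<in> lp p I. lp_norm p f \<le> 1}. lp_norm p (T f))"

definition op_closure ::
  "real \<Rightarrow> (('i \<Rightarrow> complex) \<Rightarrow> ('i \<Rightarrow> complex)) set \<Rightarrow> (('i \<Rightarrow> complex) \<Rightarrow> ('i \<Rightarrow> complex)) set" where
  "op_closure p A = {T \<in> lp_ops p UNIV.
     \<forall>\<epsilon>>0. \<exists>S\<in>A. op_norm p UNIV (\<lambda>f i. T f i - S f i) < \<epsilon>}"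

definition delta :: "'i \<Rightarrow> 'i \<Rightarrow> complex" where
  "delta t = (\<lambda>s. if s = t then 1 else 0)"

definition entry :: "(('i \<Rightarrow> complex) \<Rightarrow> ('i \<Rightarrow> complex)) \<Rightarrow> 'i \<Rightarrow> 'i \<Rightarrow> complex" where
  "entry T s t = T (delta t) s"

section \<open>The invariant translation approximation property\<close>

definition proper_right_invariant_metric :: "('g::group_add \<Rightarrow> 'g \<Rightarrow> real) \<Rightarrow> bool" where
  "proper_right_invariant_metric d \<longleftrightarrow>
     Metric_space UNIV d \<and>
     (\<forall>s t g. d (s + g) (t + g) = d s t) \<and>
     (\<forall>x r. finite {y. d x y \<le> r})"

definition max_metric ::
  "('g \<Rightarrow> 'g \<Rightarrow> real) \<Rightarrow> ('h \<Rightarrow> 'h \<Rightarrow> real) \<Rightarrow> 'g \<times> 'h \<Rightarrow> 'g \<times> 'h \<Rightarrow> real" where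
  "max_metric d1 d2 x y = max (d1 (fst x) (fst y)) (d2 (snd x) (snd y))"

definition finite_propagation ::
  "('g \<Rightarrow> 'g \<Rightarrow> real) \<Rightarrow> (('g \<Rightarrow> complex) \<Rightarrow> ('g \<Rightarrow> complex)) \<Rightarrow> bool" where
  "finite_propagation d T \<longleftrightarrow> bdd_above {d s t |s t. entry T s t \<noteq> 0}"

definition uniform_Roe ::
  "real \<Rightarrow> ('g \<Rightarrow> 'g \<Rightarrow> real) \<Rightarrow> (('g \<Rightarrow> complex) \<Rightarrow> ('g \<Rightarrow> complex)) set" where
  "uniform_Roe p d = op_closure p {T \<in> lp_ops p UNIV. finite_propagation d T}"

definition left_reg :: "real \<Rightarrow> 'g::group_add \<Rightarrow> ('g \<Rightarrow> complex) \<Rightarrow> ('g \<Rightarrow> complex)" where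
  "left_reg p s = (\<lambda>f\<in>lp p UNIV. \<lambda>t. f (- s + t))"

definition right_reg :: "real \<Rightarrow> 'g::group_add \<Rightarrow> ('g \<Rightarrow> complex) \<Rightarrow> ('g \<Rightarrow> complex)" where
  "right_reg p s = (\<lambda>f\<in>lp p UNIV. \<lambda>t. f (t + s))"

definition closed_subalgebra :: "real \<Rightarrow> (('g \<Rightarrow> complex) \<Rightarrow> ('g \<Rightarrow> complex)) set \<Rightarrow> bool" where
  "closed_subalgebra p A \<longleftrightarrow>
     A \<subseteq> lp_ops p UNIV \<and>
     (\<forall>S\<in>A. \<forall>T\<in>A. (\<lambda>f\<in>lp p UNIV. \<lambda>i. S f i + T f i) \<in> A) \<and>
     (\<forall>c. \<forall>T\<in>A. (\<lambda>f\<in>lp p UNIV. \<lambda>i. c * T f i) \<in> A) \<and>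
     (\<forall>S\<in>A. \<forall>T\<in>A. compose (lp p UNIV) S T \<in> A) \<and>
     op_closure p A \<subseteq> A"

definition F_lambda :: "real \<Rightarrow> (('g::group_add \<Rightarrow> complex) \<Rightarrow> ('g \<Rightarrow> complex)) set" where
  "F_lambda p = closed_subalgebra p hull range (left_reg p)"

definition uniform_Roe_fixed ::
  "real \<Rightarrow> ('g::group_add \<Rightarrow> 'g \<Rightarrow> real) \<Rightarrow> (('g \<Rightarrow> complex) \<Rightarrow> ('g \<Rightarrow> complex)) set" where
  "uniform_Roe_fixed p d = {T \<in> uniform_Roe p d.
     \<forall>g. compose (lp p UNIV) (right_reg p g) (compose (lp p UNIV) T (right_reg p (- g))) = T}"

definition p_ITAP :: "real \<Rightarrow> ('g::group_add \<Rightarrow> 'g \<Rightarrow> real) \<Rightarrow> bool" where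
  "p_ITAP p d \<longleftrightarrow> F_lambda p = uniform_Roe_fixed p d"

section \<open>The algebra $A_p(\Gamma)$ and its $p$-operator space structure\<close>

text \<open>The trace-class data $\sum_n \xi_n \otimes \eta_n \in \ell^{p'} \widehat\otimes \ell^p$, which
  acts on $B(\ell^p)$ by $T \mapsto \sum_n \langle\xi_n, T\eta_n\rangle$.\<close>

definition nuclear_data :: "real \<Rightarrow> (nat \<Rightarrow> 'g \<Rightarrow> complex) \<Rightarrow> (nat \<Rightarrow> 'g \<Rightarrow> complex) \<Rightarrow> bool" where
  "nuclear_data p \<xi> \<eta> \<longleftrightarrow>
     (\<forall>n. \<xi> n \<in> lp (conj_exponent p) UNIV) \<and> (\<forall>n. \<eta> n \<in> lp p UNIV) \<and>
     summable (\<lambda>n. lp_norm (conj_exponent p) (\<xi> n) * lp_norm p (\<eta> n))"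

definition nuclear_functional ::
  "(nat \<Rightarrow> 'g \<Rightarrow> complex) \<Rightarrow> (nat \<Rightarrow> 'g \<Rightarrow> complex) \<Rightarrow> (('g \<Rightarrow> complex) \<Rightarrow> ('g \<Rightarrow> complex)) \<Rightarrow> complex" where
  "nuclear_functional \<xi> \<eta> T = (\<Sum>n. pairing (\<xi> n) (T (\<eta> n)))"

definition coefficient ::
  "real \<Rightarrow> (nat \<Rightarrow> 'g::group_add \<Rightarrow> complex) \<Rightarrow> (nat \<Rightarrow> 'g \<Rightarrow> complex) \<Rightarrow> 'g \<Rightarrow> complex" where
  "coefficient p \<xi> \<eta> = (\<lambda>s. nuclear_functional \<xi> \<eta> (left_reg p s))"

definition Ap :: "real \<Rightarrow> ('g::group_add \<Rightarrow> complex) set" where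
  "Ap p = {coefficient p \<xi> \<eta> |\<xi> \<eta>. nuclear_data p \<xi> \<eta>}"

text \<open>$PM_p(\Gamma)$, the weak* closure of the span of $\lambda(\Gamma)$ in $B(\ell^p(\Gamma))$, the
  dual of $\ell^{p'} \widehat\otimes \ell^p$.  Here and in \<open>p_AP\<close> a net is given by its filter of tails.\<close>

definition lambda_span :: "real \<Rightarrow> (('g::group_add \<Rightarrow> complex) \<Rightarrow> ('g \<Rightarrow> complex)) set" where
  "lambda_span p = {(\<lambda>f\<in>lp p UNIV. \<lambda>t. \<Sum>s\<in>S. c s * left_reg p s f t) |S c. finite S}"

definition PM :: "real \<Rightarrow> (('g::group_add \<Rightarrow> complex) \<Rightarrow> ('g \<Rightarrow> complex)) set" where
  "PM p = {T \<in> lp_ops p UNIV.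
     \<exists>F. F \<noteq> bot \<and> (\<forall>\<^sub>F S in F. S \<in> lambda_span p) \<and>
       (\<forall>\<xi> \<eta>. nuclear_data p \<xi> \<eta> \<longrightarrow>
          (nuclear_functional \<xi> \<eta> \<longlongrightarrow> nuclear_functional \<xi> \<eta> T) F)}"

text \<open>The duality between $PM_p(\Gamma)$ and $A_p(\Gamma)$.  For $T \in PM_p(\Gamma)$ the value does not
  depend on the representation of $f$, because this holds for $T$ in the span of $\lambda(\Gamma)$.\<close>

definition PM_pairing ::
  "real \<Rightarrow> (('g::group_add \<Rightarrow> complex) \<Rightarrow> ('g \<Rightarrow> complex)) \<Rightarrow> ('g \<Rightarrow> complex) \<Rightarrow> complex" where
  "PM_pairing p T f = (THE z. \<exists>\<xi> \<eta>. nuclear_data p \<xi> \<eta> \<and> f = coefficient p \<xi> \<eta> \<and>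
     z = nuclear_functional \<xi> \<eta> T)"

text \<open>$M_m(B(\ell^p(\Gamma)))$ is normed as $B(\ell^p_m(\ell^p(\Gamma))) = B(\ell^p(\{0,\dots,m-1\} \times \Gamma))$,
  and scalar matrices indexed by a finite set $J$ are normed as $B(\ell^p(J))$.\<close>

definition block_op ::
  "nat \<Rightarrow> (nat \<Rightarrow> nat \<Rightarrow> ('g \<Rightarrow> complex) \<Rightarrow> ('g \<Rightarrow> complex)) \<Rightarrow> (nat \<times> 'g \<Rightarrow> complex) \<Rightarrow> (nat \<times> 'g \<Rightarrow> complex)" where
  "block_op m X f = (\<lambda>(k, s). if k < m then \<Sum>l<m. X k l (\<lambda>t. f (l, t)) s else 0)"

definition PM_mat_norm ::
  "real \<Rightarrow> nat \<Rightarrow> (nat \<Rightarrow> nat \<Rightarrow> ('g \<Rightarrow> complex) \<Rightarrow> ('g \<Rightarrow> complex)) \<Rightarrow> real" where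
  "PM_mat_norm p m X = op_norm p ({..<m} \<times> UNIV) (block_op m X)"

definition matrix_op :: "'j set \<Rightarrow> ('j \<Rightarrow> 'j \<Rightarrow> complex) \<Rightarrow> ('j \<Rightarrow> complex) \<Rightarrow> ('j \<Rightarrow> complex)" where
  "matrix_op J a f = (\<lambda>i. if i \<in> J then \<Sum>j\<in>J. a i j * f j else 0)"

text \<open>The $p$-operator space structure of $A_p(\Gamma)$ is the one of a predual of $PM_p(\Gamma)$:
  \[ M_n(A_p(\Gamma)) \subseteq M_n(PM_p(\Gamma)') = CB_p(PM_p(\Gamma), M_n), \]
  so the norm of $(f_{ij})$ is the supremum of $\| (\langle X_{kl}, f_{ij} \rangle)_{(k,i),(l,j)} \|_{M_{mn}}$ over
  all $m$ and all $X$ in the unit ball of $M_m(PM_p(\Gamma))$.\<close>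

definition Ap_mat_norm :: "real \<Rightarrow> nat \<Rightarrow> (nat \<Rightarrow> nat \<Rightarrow> 'g::group_add \<Rightarrow> complex) \<Rightarrow> real" where
  "Ap_mat_norm p n f = Sup {
     op_norm p ({..<m} \<times> {..<n})
       (matrix_op ({..<m} \<times> {..<n}) (\<lambda>(k, i) (l, j). PM_pairing p (X k l) (f i j))) |m X.
     (\<forall>k<m. \<forall>l<m. X k l \<in> PM p) \<and> PM_mat_norm p m X \<le> 1}"

section \<open>Completely bounded multipliers and the approximation property\<close>

text \<open>The norms of $(u f_{ij})$, for all $n$ and all $(f_{ij})$ in the unit ball of $M_n(A_p(\Gamma))$;
  their supremum is the $p$-completely bounded norm of $f \mapsto uf$.\<close>

definition amplified_norms :: "real \<Rightarrow> ('g::group_add \<Rightarrow> complex) \<Rightarrow> real set" where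
  "amplified_norms p u = {Ap_mat_norm p n (\<lambda>i j s. u s * f i j s) |n f.
     (\<forall>i<n. \<forall>j<n. f i j \<in> Ap p) \<and> Ap_mat_norm p n f \<le> 1}"

definition Mcb :: "real \<Rightarrow> ('g::group_add \<Rightarrow> complex) set" where
  "Mcb p = {u. (\<forall>f\<in>Ap p. (\<lambda>s. u s * f s) \<in> Ap p) \<and> bdd_above (amplified_norms p u)}"

definition Mcb_norm :: "real \<Rightarrow> ('g::group_add \<Rightarrow> complex) \<Rightarrow> real" where
  "Mcb_norm p u = Sup (amplified_norms p u)"

definition Mcb_dual :: "real \<Rightarrow> (('g::group_add \<Rightarrow> complex) \<Rightarrow> complex) set" where
  "Mcb_dual p = {\<phi> \<in> extensional (Mcb p).
     (\<forall>u\<in>Mcb p. \<forall>v\<in>Mcb p. \<phi> (\<lambda>s. u s + v s) = \<phi> u + \<phi> v) \<and>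
     (\<forall>c. \<forall>u\<in>Mcb p. \<phi> (\<lambda>s. c * u s) = c * \<phi> u) \<and>
     (\<exists>C. \<forall>u\<in>Mcb p. norm (\<phi> u) \<le> C * Mcb_norm p u)}"

definition Q_pcb :: "real \<Rightarrow> (('g::group_add \<Rightarrow> complex) \<Rightarrow> complex) set" where
  "Q_pcb p = {\<phi> \<in> Mcb_dual p. \<forall>\<epsilon>>0. \<exists>f\<in>lp 1 UNIV.
     \<forall>u\<in>Mcb p. norm (\<phi> u - (\<Sum>\<^sub>\<infinity>s. f s * u s)) \<le> \<epsilon> * Mcb_norm p u}"

definition p_AP :: "real \<Rightarrow> 'g::group_add itself \<Rightarrow> bool" where
  "p_AP p (G :: 'g itself) \<longleftrightarrow>
     (\<exists>F :: ('g \<Rightarrow> complex) filter. F \<noteq> bot \<and> (\<forall>\<^sub>F u in F. u \<in> Ap p) \<and>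
        (\<forall>\<phi>\<in>Q_pcb p. (\<phi> \<longlongrightarrow> \<phi> (\<lambda>_. 1)) F))"

end

theory Submission
  imports Defs
begin

text \<open>
  Let \<open>T\<close> be a translation invariant operator in the uniform Roe algebra of \<open>G \<times> H\<close>.  A multiplier \<open>u\<close>
  of \<open>A\<^sub>p(G)\<close> acts on it by \<open>(M\<^sub>u T)\<^sub>x\<^sub>,\<^sub>y = u(st\<^sup>-\<^sup>1) T\<^sub>x\<^sub>,\<^sub>y\<close>, where \<open>s\<close> and \<open>t\<close> are the \<open>G\<close>-components of \<open>x\<close>
  and \<open>y\<close>, and \<open>\<parallel>M\<^sub>u T\<parallel> \<le> \<parallel>u\<parallel>\<^sub>c\<^sub>b \<parallel>T\<parallel>\<close>: for a finite matrix \<open>x\<close>, conjugation by the isometries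
  \<open>diag(\<lambda>(s))\<close> identifies \<open>x \<otimes> 1\<close> with a matrix with entries \<open>x\<^sub>s\<^sub>,\<^sub>t \<lambda>(st\<^sup>-\<^sup>1)\<close> in \<open>PM\<^sub>p(G)\<close>, on which the
  multiplication by \<open>u\<close> is completely bounded.

  For \<open>u = \<delta>\<^sub>g\<close>, invariance gives \<open>M\<^sub>u T = \<lambda>(g, e) (1 \<otimes> T\<^sub>g)\<close> with \<open>T\<^sub>g\<close> invariant on \<open>H\<close>, so \<open>M\<^sub>u T\<close> lies in
  \<open>F\<^sub>\<lambda>(G \<times> H)\<close> by the ITAP of \<open>H\<close>, and by density this holds for all \<open>u\<close> in \<open>A\<^sub>p(G)\<close>.  If \<open>T\<close> itself were not in
  \<open>F\<^sub>\<lambda>(G \<times> H)\<close>, then Hahn-Banach would give a functional \<open>\<psi>\<close> vanishing on \<open>F\<^sub>\<lambda>(G \<times> H)\<close> with \<open>\<psi>(T) \<noteq> 0\<close>.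
  Approximating \<open>T\<close> by operators of finite propagation shows that \<open>u \<mapsto> \<psi>(M\<^sub>u T)\<close> is in \<open>Q\<^sub>p\<^sub>c\<^sub>b(G)\<close>; it
  vanishes on \<open>A\<^sub>p(G)\<close> but not at \<open>1\<close>, contradicting the AP of \<open>G\<close>.
\<close>

section \<open>The spaces lp: Hoelder's inequality and duality\<close>

text \<open>The net in the \<open>p\<close>-AP converges to 1 only in the weak* topology and carries
  no norm bound, so \<open>fst_mult p u T\<close> need not approach \<open>T\<close> in norm along
  it; hence the detour through a functional instead of a direct approximation. That functional has
  to lie in \<open>Q_pcb\<close>, and here properness matters: an operator of finite propagation has
  only finitely many differences of first coordinates, so it gives rise to a functional coming from
  l^1.

  The technical obstacle is that the multiplier norm is defined through matrices over
  \<open>Ap\<close> and their pairing with matrices over \<open>PM\<close>, while the argument needs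
  it as a Schur multiplier norm. The passage, \<open>mat_bound_Mcb\<close>, evaluates the definition
  on one test matrix for each side: multiples of translations in \<open>PM\<close>, and point masses
  at differences of distinct group elements in \<open>Ap\<close>. The latter matrix has norm at most
  1 because pairing it with a matrix \<open>X\<close> over \<open>PM\<close> merely reads off
  entries of \<open>X\<close>.

  Most norm estimates are made on matrices tested against finitely supported vectors and are then
  transferred to operators by density.\<close>

definition fin_norm :: "real \<Rightarrow> 'i set \<Rightarrow> ('i \<Rightarrow> complex) \<Rightarrow> real" where
  "fin_norm p J f = (\<Sum>i\<in>J. norm (f i) powr p) powr (1 / p)"

lemma conj_exponent_gt_1: "1 < p \<Longrightarrow> 1 < conj_exponent p"
  by (simp add: conj_exponent_def field_simps)

lemma conj_exponent_conj_exponent: "1 < p \<Longrightarrow> conj_exponent (conj_exponent p) = p"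
  by (simp add: conj_exponent_def field_simps)

lemma conj_exponent_inverse_sum: "1 < p \<Longrightarrow> 1 / conj_exponent p + 1 / p = 1"
  by (simp add: conj_exponent_def field_simps)

lemma fin_norm_nonneg [simp]: "0 \<le> fin_norm p J f"
  by (simp add: fin_norm_def)

lemma fin_norm_powr: "1 < p \<Longrightarrow> fin_norm p J f powr p = (\<Sum>i\<in>J. norm (f i) powr p)"
  by (simp add: fin_norm_def powr_powr sum_nonneg)

lemma fin_norm_cong: "(\<And>i. i \<in> J \<Longrightarrow> norm (f i) = norm (g i)) \<Longrightarrow> fin_norm p J f = fin_norm p J g"
  by (simp add: fin_norm_def)

lemma fin_norm_le_iff:
  assumes "1 < p" "0 \<le> B"
  shows "fin_norm p J f \<le> B \<longleftrightarrow> (\<Sum>i\<in>J. norm (f i) powr p) \<le> B powr p"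
proof -
  have "fin_norm p J f \<le> B \<longleftrightarrow> fin_norm p J f powr p \<le> B powr p"
    using assms by (smt (verit, best) fin_norm_nonneg powr_less_mono2 powr_mono2)
  then show ?thesis using assms by (simp add: fin_norm_powr)
qed

lemma fin_norm_mono:
  assumes "1 < p" "finite K" "J \<subseteq> K" "\<And>i. i \<in> J \<Longrightarrow> norm (f i) \<le> norm (g i)"
  shows "fin_norm p J f \<le> fin_norm p K g"
  unfolding fin_norm_def using assms
  by (intro powr_mono2 sum_nonneg)
     (auto intro!: order_trans[OF sum_mono sum_mono2] powr_mono2)

lemma fin_norm_eq_0D:
  assumes "1 < p" "finite J" "fin_norm p J f = 0" "i \<in> J"
  shows "f i = 0"
proof -
  have "(\<Sum>i\<in>J. norm (f i) powr p) = 0"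
    using assms fin_norm_powr[of p J f] by simp
  then show ?thesis using assms by (simp add: sum_nonneg_eq_0_iff)
qed

text \<open>Young's inequality is applied to the vectors divided by their norms; a vector of norm 0
  vanishes on \<open>J\<close>, which is why those two cases are split off.\<close>

lemma fin_norm_holder:
  assumes p: "1 < p" and J: "finite J"
  shows "(\<Sum>i\<in>J. norm (\<xi> i) * norm (\<eta> i)) \<le> fin_norm (conj_exponent p) J \<xi> * fin_norm p J \<eta>"
proof -
  define q where "q = conj_exponent p"
  have q: "1 < q" using p by (simp add: q_def conj_exponent_gt_1)
  have pq: "1/q + 1/p = 1" using p by (simp add: q_def conj_exponent_inverse_sum)
  define A where "A = fin_norm q J \<xi>"
  define B where "B = fin_norm p J \<eta>"
  consider "A = 0" | "B = 0" | "A > 0" "B > 0"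
    unfolding A_def B_def by (metis fin_norm_nonneg order_le_less)
  then have "(\<Sum>i\<in>J. norm (\<xi> i) * norm (\<eta> i)) \<le> A * B"
  proof cases
    case 1
    then have "\<And>i. i \<in> J \<Longrightarrow> \<xi> i = 0" using fin_norm_eq_0D[OF q J] by (simp add: A_def)
    then show ?thesis using 1 by simp
  next
    case 2
    then have "\<And>i. i \<in> J \<Longrightarrow> \<eta> i = 0" using fin_norm_eq_0D[OF p J] by (simp add: B_def)
    then show ?thesis using 2 by simp
  next
    case 3
    have "(\<Sum>i\<in>J. (norm (\<xi> i) / A) * (norm (\<eta> i) / B)) \<le>
        (\<Sum>i\<in>J. (norm (\<xi> i) / A) powr q / q + (norm (\<eta> i) / B) powr p / p)"
      using 3 p q pq by (intro sum_mono Youngs_inequality) auto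
    also have "\<dots> = (\<Sum>i\<in>J. norm (\<xi> i) powr q) / (A powr q) / q + (\<Sum>i\<in>J. norm (\<eta> i) powr p) / (B powr p) / p"
      using 3 by (simp add: sum.distrib powr_divide sum_divide_distrib)
    also have "\<dots> = 1/q + 1/p"
      using 3 p q by (simp add: A_def B_def fin_norm_powr[symmetric])
    finally have "(\<Sum>i\<in>J. norm (\<xi> i) * norm (\<eta> i)) / (A * B) \<le> 1"
      using pq by (simp add: sum_divide_distrib)
    then show ?thesis using 3 by (simp add: field_simps)
  qed
  then show ?thesis by (simp add: A_def B_def q_def)
qed

text \<open>Converse of Hoelder's inequality. Minkowski's inequality and the boundedness of
  \<open>mat_op\<close> are both derived by testing through it.\<close>

lemma fin_norm_dual:
  assumes p: "1 < p" and J: "finite J" and C: "0 \<le> C"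
    and le: "\<And>\<xi>. norm (\<Sum>i\<in>J. \<xi> i * g i) \<le> C * fin_norm (conj_exponent p) J \<xi>"
  shows "fin_norm p J g \<le> C"
proof -
  define q where "q = conj_exponent p"
  have q: "1 < q" using p by (simp add: q_def conj_exponent_gt_1)
  have qe: "(p - 1) * q = p" using p by (simp add: q_def conj_exponent_def)
  \<comment> \<open>The extremal vector for Hoelder's inequality: \<open>\<xi> i * g i\<close>
    equals \<open>norm (g i) powr p\<close>, and \<open>norm (\<xi> i) powr q\<close> has the same
    value because \<open>(p - 1) * q = p\<close>.\<close>
  define \<xi> where "\<xi> i = cnj (sgn (g i)) * of_real (norm (g i) powr (p - 1))" for i
  have n\<xi>: "norm (\<xi> i) = norm (g i) powr (p - 1)" for i
    by (cases "g i = 0") (auto simp: \<xi>_def norm_mult norm_sgn)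
  define S where "S = (\<Sum>i\<in>J. norm (g i) powr p)"
  have S0: "0 \<le> S" by (simp add: S_def sum_nonneg)
  have "\<xi> i * g i = of_real (norm (g i) powr p)" for i
  proof (cases "g i = 0")
    case False
    have "cnj (sgn (g i)) * g i = of_real (norm (g i))"
      using False by (simp add: sgn_eq complex_norm_square[symmetric] power2_eq_square mult.commute)
    then have "\<xi> i * g i = of_real (norm (g i) * norm (g i) powr (p - 1))"
      by (simp add: \<xi>_def mult.commute mult.left_commute)
    also have "norm (g i) * norm (g i) powr (p - 1) = norm (g i) powr p"
      using False by (simp add: powr_diff)
    finally show ?thesis .
  qed simp
  then have "(\<Sum>i\<in>J. \<xi> i * g i) = of_real S" by (simp add: S_def)
  then have "S \<le> C * fin_norm q J \<xi>" using le[of \<xi>] S0 by (simp add: q_def)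
  also have "fin_norm q J \<xi> = S powr (1/q)"
    by (simp add: fin_norm_def n\<xi> powr_powr qe S_def)
  finally have *: "S \<le> C * S powr (1/q)" .
  show ?thesis
  proof (cases "S = 0")
    case True then show ?thesis using C by (simp add: fin_norm_def S_def)
  next
    case False
    have pq: "1/q + 1/p = 1" using p by (simp add: q_def conj_exponent_inverse_sum)
    have "S powr (1/q) * S powr (1/p) = S" using False S0 pq by (simp add: powr_add[symmetric])
    then have "S powr (1/q) * S powr (1/p) \<le> S powr (1/q) * C" using * by (simp add: mult.commute)
    then have "S powr (1/p) \<le> C" using False S0 by simp
    then show ?thesis by (simp add: fin_norm_def S_def)
  qed
qed

lemma fin_norm_holder_norm:
  assumes "1 < p" "finite J"
  shows "norm (\<Sum>i\<in>J. \<xi> i * \<eta> i) \<le> fin_norm (conj_exponent p) J \<xi> * fin_norm p J \<eta>"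
  using fin_norm_holder[OF assms, of \<xi> \<eta>]
  by (intro order_trans[OF sum_norm_le[OF order_refl]]) (simp add: norm_mult)

lemma fin_norm_triangle:
  assumes p: "1 < p" and J: "finite J"
  shows "fin_norm p J (\<lambda>i. f i + g i) \<le> fin_norm p J f + fin_norm p J g"
proof (rule fin_norm_dual[OF p J])
  fix \<xi>
  have "norm (\<Sum>i\<in>J. \<xi> i * (f i + g i)) \<le> norm (\<Sum>i\<in>J. \<xi> i * f i) + norm (\<Sum>i\<in>J. \<xi> i * g i)"
    by (simp add: distrib_left sum.distrib norm_triangle_ineq)
  also have "\<dots> \<le> fin_norm (conj_exponent p) J \<xi> * fin_norm p J f + fin_norm (conj_exponent p) J \<xi> * fin_norm p J g"
    by (intro add_mono fin_norm_holder_norm p J)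
  finally show "norm (\<Sum>i\<in>J. \<xi> i * (f i + g i)) \<le> (fin_norm p J f + fin_norm p J g) * fin_norm (conj_exponent p) J \<xi>"
    by (simp add: algebra_simps)
qed simp

lemma lp_vanishes: "f \<in> lp p I \<Longrightarrow> i \<notin> I \<Longrightarrow> f i = 0"
  by (simp add: lp_def)

lemma lp_iff_UNIV: "f \<in> lp p I \<longleftrightarrow> f \<in> lp p UNIV \<and> (\<forall>i. i \<notin> I \<longrightarrow> f i = 0)"
  by (auto simp: lp_def)

lemma lp_norm_nonneg [simp]: "0 \<le> lp_norm p f"
  by (simp add: lp_norm_def)

lemma lp_norm_powr:
  assumes "1 < p" shows "lp_norm p f powr p = (\<Sum>\<^sub>\<infinity>i. norm (f i) powr p)"
  using assms by (simp add: lp_norm_def powr_powr infsum_nonneg)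

lemma fin_norm_le_lp_norm:
  assumes "1 < p" "f \<in> lp p I" "finite J"
  shows "fin_norm p J f \<le> lp_norm p f"
  using assms by (simp add: fin_norm_le_iff lp_norm_powr lp_def finite_sum_le_infsum)

text \<open>A uniform bound over all finite sets gives membership and the norm estimate together, so
  that statements on \<open>lp_norm\<close> reduce to \<open>fin_norm\<close>, where no summability
  has to be checked.\<close>

lemma lp_of_fin_norm_le:
  assumes p: "1 < p" and B: "0 \<le> B" and le: "\<And>J. finite J \<Longrightarrow> fin_norm p J f \<le> B"
  shows "f \<in> lp p UNIV" "lp_norm p f \<le> B"
proof -
  have s: "(\<Sum>i\<in>J. norm (f i) powr p) \<le> B powr p" if "finite J" for J
    using le[OF that] fin_norm_le_iff[OF p B] by blast
  have summ: "(\<lambda>i. norm (f i) powr p) summable_on UNIV"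
    by (rule nonneg_bdd_above_summable_on) (auto simp: bdd_above_def intro!: s)
  then show "f \<in> lp p UNIV" by (simp add: lp_def)
  have "(\<Sum>\<^sub>\<infinity>i. norm (f i) powr p) \<le> B powr p"
    by (intro infsum_le_finite_sums summ s)
  then have "(\<Sum>\<^sub>\<infinity>i. norm (f i) powr p) powr (1/p) \<le> (B powr p) powr (1/p)"
    using p by (intro powr_mono2) (auto simp: infsum_nonneg)
  then show "lp_norm p f \<le> B" using p B by (simp add: lp_norm_def powr_powr)
qed

lemma lp_of_fin_norm_le_on:
  assumes "1 < p" "0 \<le> B" "\<And>J. finite J \<Longrightarrow> J \<subseteq> I \<Longrightarrow> fin_norm p J f \<le> B" "\<And>i. i \<notin> I \<Longrightarrow> f i = 0"
  shows "f \<in> lp p I" "lp_norm p f \<le> B"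
proof -
  have *: "fin_norm p J f \<le> B" if "finite J" for J
  proof -
    have "fin_norm p J f = fin_norm p (J \<inter> I) f"
      unfolding fin_norm_def using assms(4) that
      by (intro arg_cong[where f = "\<lambda>x. x powr _"] sum.mono_neutral_right) auto
    then show ?thesis using assms(3)[of "J \<inter> I"] that by auto
  qed
  show "f \<in> lp p I" "lp_norm p f \<le> B"
    using lp_of_fin_norm_le[OF assms(1,2) *] assms(4) by (auto simp: lp_iff_UNIV[of f p I])
qed

lemma lp_finite_support:
  assumes p: "1 < p" and J: "finite J" and 0: "\<And>i. i \<notin> J \<Longrightarrow> f i = 0"
  shows "f \<in> lp p J" "lp_norm p f = fin_norm p J f"
proof -
  note * = lp_of_fin_norm_le_on[OF p fin_norm_nonneg[of p J f], where f=f and I=J]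
  show 1: "f \<in> lp p J" using 0 J p by (intro *) (auto intro!: fin_norm_mono)
  have "lp_norm p f \<le> fin_norm p J f" using 0 J p by (intro *) (auto intro!: fin_norm_mono)
  then show "lp_norm p f = fin_norm p J f"
    using fin_norm_le_lp_norm[OF p 1 J] by simp
qed

lemma lp_zero [simp]: "(\<lambda>_. 0) \<in> lp p I"
  by (simp add: lp_def)

lemma lp_norm_zero [simp]: "lp_norm p (\<lambda>_. 0) = 0"
  by (simp add: lp_norm_def)

lemma
  assumes "1 < p" "f \<in> lp p I" "g \<in> lp p I"
  shows lp_add: "(\<lambda>i. f i + g i) \<in> lp p I"
    and lp_norm_triangle: "lp_norm p (\<lambda>i. f i + g i) \<le> lp_norm p f + lp_norm p g"
proof -
  have "fin_norm p J (\<lambda>i. f i + g i) \<le> lp_norm p f + lp_norm p g" if "finite J" for J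
    using fin_norm_triangle[OF assms(1) that, of f g] fin_norm_le_lp_norm[OF assms(1) _ that] assms(2,3)
    by (meson add_mono order_trans)
  then show "(\<lambda>i. f i + g i) \<in> lp p I" "lp_norm p (\<lambda>i. f i + g i) \<le> lp_norm p f + lp_norm p g"
    using assms by (auto intro!: lp_of_fin_norm_le_on[where B = "lp_norm p f + lp_norm p g"] simp: lp_vanishes)
qed

lemma
  assumes p: "1 < p" and f: "f \<in> lp p I"
  shows lp_scale: "(\<lambda>i. c * f i) \<in> lp p I"
    and lp_norm_scale: "lp_norm p (\<lambda>i. c * f i) = norm c * lp_norm p f"
proof -
  have "(\<lambda>i. norm c powr p * norm (f i) powr p) summable_on UNIV"
    using f by (intro summable_on_cmult_right) (simp add: lp_def)
  then show "(\<lambda>i. c * f i) \<in> lp p I" using f by (auto simp: lp_def norm_mult powr_mult)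
  have "(\<Sum>\<^sub>\<infinity>i. norm (c * f i) powr p) = norm c powr p * (\<Sum>\<^sub>\<infinity>i. norm (f i) powr p)"
    using f by (simp add: norm_mult powr_mult lp_def infsum_cmult_right')
  then show "lp_norm p (\<lambda>i. c * f i) = norm c * lp_norm p f"
    using p by (simp add: lp_norm_def powr_mult infsum_nonneg powr_powr)
qed

lemma lp_norm_cong: "(\<And>i. norm (f i) = norm (g i)) \<Longrightarrow> lp_norm p f = lp_norm p g"
  by (simp add: lp_norm_def)

lemma lp_diff:
  assumes "1 < p" "f \<in> lp p I" "g \<in> lp p I"
  shows "(\<lambda>i. f i - g i) \<in> lp p I"
  using lp_add[OF assms(1,2) lp_scale[OF assms(1,3), of "-1"]] by simp

lemma lp_sum:
  assumes "1 < p" "finite A" "\<And>a. a \<in> A \<Longrightarrow> f a \<in> lp p I"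
  shows "(\<lambda>i. \<Sum>a\<in>A. f a i) \<in> lp p I"
  using assms(2,3) by (induction A rule: finite_induct) (auto intro!: lp_add assms(1))

lemma lp_norm_eq_0D:
  assumes "1 < p" "f \<in> lp p I" "lp_norm p f = 0"
  shows "f i = 0"
  using fin_norm_le_lp_norm[OF assms(1,2), of "{i}"] fin_norm_eq_0D[OF assms(1), of "{i}" f i] assms(3)
  by (metis antisym_conv fin_norm_nonneg finite.emptyI finite_insert insertI1)

lemma
  assumes p: "1 < p" and f: "f \<in> lp p I" and le: "\<And>i. norm (g i) \<le> norm (f i)"
  shows lp_dominated: "g \<in> lp p I"
    and lp_norm_dominated: "lp_norm p g \<le> lp_norm p f"
proof -
  have "fin_norm p J g \<le> lp_norm p f" if "finite J" for J
    by (rule order_trans[OF fin_norm_mono[OF p that order_refl le] fin_norm_le_lp_norm[OF p f that]])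
  moreover have "g i = 0" if "i \<notin> I" for i
    using le[of i] lp_vanishes[OF f that] by simp
  ultimately show "g \<in> lp p I" "lp_norm p g \<le> lp_norm p f"
    using p by (auto intro!: lp_of_fin_norm_le_on[where B = "lp_norm p f"])
qed

text \<open>Truncation: the tail of a convergent sum of p-th powers is small, so finitely supported
  vectors are dense. The density arguments for vectors below rest on this.\<close>

lemma lp_norm_restrict_complement:
  assumes p: "1 < p" and f: "f \<in> lp p I" and e: "0 < e"
  obtains J where "finite J" "J \<subseteq> I" "lp_norm p (\<lambda>i. if i \<in> J then 0 else f i) < e"
proof -
  define S where "S = (\<Sum>\<^sub>\<infinity>i. norm (f i) powr p)"
  \<comment> \<open>Aiming at \<open>e/2\<close> turns the non-strict estimate on finite sets into
    the strict one claimed.\<close>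
  define d where "d = (e/2) powr p"
  have d: "0 < d" using e by (simp add: d_def)
  have summ: "(\<lambda>i. norm (f i) powr p) summable_on UNIV" using f by (simp add: lp_def)
  obtain K where K: "finite K" "dist (sum (\<lambda>i. norm (f i) powr p) K) S \<le> d"
    using infsum_finite_approximation[OF summ d] by (auto simp: S_def)
  define J where "J = K \<inter> I"
  have sJ: "(\<Sum>i\<in>K. norm (f i) powr p) = (\<Sum>i\<in>J. norm (f i) powr p)"
    unfolding J_def using K(1) lp_vanishes[OF f] by (intro sum.mono_neutral_right) auto
  have J: "finite J" "J \<subseteq> I" using K by (auto simp: J_def)
  have "fin_norm p L (\<lambda>i. if i \<in> J then 0 else f i) \<le> e/2" if L: "finite L" for L
  proof -
    have "(\<Sum>i\<in>L. norm (if i \<in> J then 0 else f i) powr p) = (\<Sum>i\<in>L - J. norm (f i) powr p)"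
      using L by (intro sum.mono_neutral_cong_right) auto
    also have "\<dots> = (\<Sum>i\<in>L \<union> J. norm (f i) powr p) - (\<Sum>i\<in>J. norm (f i) powr p)"
      using L J by (metis Un_Diff Diff_cancel Un_empty_right sum_diff Un_upper2 finite_UnI)
    also have "\<dots> \<le> S - (\<Sum>i\<in>J. norm (f i) powr p)"
      unfolding S_def using L J summ by (intro diff_mono finite_sum_le_infsum) auto
    also have "\<dots> \<le> d" using K(2) sJ by (simp add: dist_real_def)
    finally show ?thesis using e by (intro iffD2[OF fin_norm_le_iff[OF p]]) (auto simp only: d_def)
  qed
  then have "lp_norm p (\<lambda>i. if i \<in> J then 0 else f i) \<le> e/2"
    using e by (intro lp_of_fin_norm_le(2)[OF p]) auto
  then show thesis using that[of J] J e by simp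
qed

lemma
  assumes p: "1 < p" and \<xi>: "\<xi> \<in> lp (conj_exponent p) I" and \<eta>: "\<eta> \<in> lp p I'"
  shows holder_abs_summable: "(\<lambda>i. norm (\<xi> i * \<eta> i)) summable_on A"
    and norm_infsum_holder: "norm (\<Sum>\<^sub>\<infinity>i\<in>A. \<xi> i * \<eta> i) \<le> lp_norm (conj_exponent p) \<xi> * lp_norm p \<eta>"
proof -
  have *: "(\<Sum>i\<in>J. norm (\<xi> i * \<eta> i)) \<le> lp_norm (conj_exponent p) \<xi> * lp_norm p \<eta>" if "finite J" for J
    using fin_norm_holder[OF p that, of \<xi> \<eta>]
      fin_norm_le_lp_norm[OF conj_exponent_gt_1[OF p] \<xi> that] fin_norm_le_lp_norm[OF p \<eta> that]
    by (simp add: norm_mult) (meson fin_norm_nonneg lp_norm_nonneg mult_mono order_trans)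
  show 1: "(\<lambda>i. norm (\<xi> i * \<eta> i)) summable_on A"
    by (rule nonneg_bdd_above_summable_on) (auto simp: bdd_above_def intro!: * exI[of _ "lp_norm (conj_exponent p) \<xi> * lp_norm p \<eta>"])
  have 2: "(\<Sum>\<^sub>\<infinity>i\<in>A. norm (\<xi> i * \<eta> i)) \<le> lp_norm (conj_exponent p) \<xi> * lp_norm p \<eta>"
    by (intro infsum_le_finite_sums 1 *)
  show "norm (\<Sum>\<^sub>\<infinity>i\<in>A. \<xi> i * \<eta> i) \<le> lp_norm (conj_exponent p) \<xi> * lp_norm p \<eta>"
    using norm_infsum_bound[OF 1] 2 by simp
qed

lemma norm_pairing_le:
  assumes "1 < p" "\<xi> \<in> lp (conj_exponent p) I" "\<eta> \<in> lp p I'"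
  shows "norm (pairing \<xi> \<eta>) \<le> lp_norm (conj_exponent p) \<xi> * lp_norm p \<eta>"
  unfolding pairing_def by (rule norm_infsum_holder[OF assms])

lemma delta_in_lp:
  assumes "1 < p" "i \<in> I"
  shows "delta i \<in> lp p I"
proof -
  have "delta i \<in> lp p {i}" using assms by (intro lp_finite_support) (simp_all add: delta_def)
  then show ?thesis using assms(2) by (auto simp: lp_def)
qed

section \<open>Operators and their matrices\<close>

text \<open>This is \<open>lp_ops\<close> without extensionality, so that pointwise expressions such
  as \<open>\<lambda>f i. S f i - T f i\<close> qualify without being restricted to
  \<open>lp p I\<close>.\<close>

definition bounded_op :: "real \<Rightarrow> 'i set \<Rightarrow> (('i \<Rightarrow> complex) \<Rightarrow> ('i \<Rightarrow> complex)) \<Rightarrow> bool" where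
  "bounded_op p I T \<longleftrightarrow>
     (\<forall>f\<in>lp p I. T f \<in> lp p I) \<and>
     (\<forall>f\<in>lp p I. \<forall>g\<in>lp p I. T (\<lambda>i. f i + g i) = (\<lambda>i. T f i + T g i)) \<and>
     (\<forall>c. \<forall>f\<in>lp p I. T (\<lambda>i. c * f i) = (\<lambda>i. c * T f i)) \<and>
     (\<exists>C. \<forall>f\<in>lp p I. lp_norm p (T f) \<le> C * lp_norm p f)"

lemma lp_ops_iff: "T \<in> lp_ops p I \<longleftrightarrow> T \<in> extensional (lp p I) \<and> bounded_op p I T"
  by (auto simp: lp_ops_def bounded_op_def PiE_def Pi_def)

lemma bounded_op_if_lp_ops: "T \<in> lp_ops p I \<Longrightarrow> bounded_op p I T"
  by (simp add: lp_ops_iff)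

text \<open>The operator norm of a matrix is tested on finitely supported vectors, where no convergence
  questions arise; see \<open>op_norm_le_iff\<close> below.\<close>

definition mat_bound :: "real \<Rightarrow> 'i set \<Rightarrow> ('i \<Rightarrow> 'i \<Rightarrow> complex) \<Rightarrow> real \<Rightarrow> bool" where
  "mat_bound p I a C \<longleftrightarrow> 0 \<le> C \<and>
     (\<forall>J \<xi> \<eta>. finite J \<longrightarrow> J \<subseteq> I \<longrightarrow>
        norm (\<Sum>s\<in>J. \<Sum>t\<in>J. \<xi> s * a s t * \<eta> t) \<le> C * fin_norm (conj_exponent p) J \<xi> * fin_norm p J \<eta>)"

text \<open>The sums need not converge for an arbitrary \<open>a\<close>; \<open>mat_bound\<close>
  supplies convergence and boundedness. Restricting to \<open>lp p I\<close> makes the result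
  extensional, as \<open>lp_ops\<close> demands.\<close>

definition mat_op :: "real \<Rightarrow> 'i set \<Rightarrow> ('i \<Rightarrow> 'i \<Rightarrow> complex) \<Rightarrow> ('i \<Rightarrow> complex) \<Rightarrow> ('i \<Rightarrow> complex)" where
  "mat_op p I a = (\<lambda>f\<in>lp p I. \<lambda>s. if s \<in> I then \<Sum>\<^sub>\<infinity>t\<in>I. a s t * f t else 0)"

lemma mat_boundI:
  assumes "0 \<le> C"
    "\<And>J \<xi> \<eta>. finite J \<Longrightarrow> J \<subseteq> I \<Longrightarrow>
       norm (\<Sum>s\<in>J. \<Sum>t\<in>J. \<xi> s * a s t * \<eta> t) \<le> C * fin_norm (conj_exponent p) J \<xi> * fin_norm p J \<eta>"
  shows "mat_bound p I a C"
  using assms by (simp add: mat_bound_def)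

lemma mat_bound_nonneg: "mat_bound p I a C \<Longrightarrow> 0 \<le> C"
  by (simp add: mat_bound_def)

lemma mat_boundD:
  "mat_bound p I a C \<Longrightarrow> finite J \<Longrightarrow> J \<subseteq> I \<Longrightarrow>
     norm (\<Sum>s\<in>J. \<Sum>t\<in>J. \<xi> s * a s t * \<eta> t) \<le> C * fin_norm (conj_exponent p) J \<xi> * fin_norm p J \<eta>"
  by (simp add: mat_bound_def)

lemma mat_bound_cong:
  assumes "\<And>s t. s \<in> I \<Longrightarrow> t \<in> I \<Longrightarrow> a s t = b s t"
  shows "mat_bound p I a C \<longleftrightarrow> mat_bound p I b C"
proof -
  have "(\<Sum>s\<in>J. \<Sum>t\<in>J. \<xi> s * a s t * \<eta> t) = (\<Sum>s\<in>J. \<Sum>t\<in>J. \<xi> s * b s t * \<eta> t)" if "J \<subseteq> I" for J \<xi> \<eta>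
    using assms that by (intro sum.cong refl) auto
  then show ?thesis by (auto simp: mat_bound_def)
qed

lemma mat_bound_mono:
  assumes "mat_bound p I a C" "C \<le> D"
  shows "mat_bound p I a D"
proof (rule mat_boundI)
  show "0 \<le> D" using assms by (auto simp: mat_bound_def)
  fix J \<xi> \<eta> assume J: "finite J" "J \<subseteq> I"
  show "norm (\<Sum>s\<in>J. \<Sum>t\<in>J. \<xi> s * a s t * \<eta> t) \<le> D * fin_norm (conj_exponent p) J \<xi> * fin_norm p J \<eta>"
    by (rule order_trans[OF mat_boundD[OF assms(1) J]]) (intro mult_right_mono assms fin_norm_nonneg)
qed

lemma mat_bound_zero: "mat_bound p I (\<lambda>_ _. 0) 0"
  by (simp add: mat_bound_def)

lemma mat_bound_add:
  assumes "mat_bound p I a C" "mat_bound p I b D"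
  shows "mat_bound p I (\<lambda>s t. a s t + b s t) (C + D)"
proof (rule mat_boundI)
  show "0 \<le> C + D" using assms by (auto simp: mat_bound_def)
  fix J \<xi> \<eta> assume J: "finite J" "J \<subseteq> I"
  have "norm (\<Sum>s\<in>J. \<Sum>t\<in>J. \<xi> s * (a s t + b s t) * \<eta> t) \<le>
      norm (\<Sum>s\<in>J. \<Sum>t\<in>J. \<xi> s * a s t * \<eta> t) + norm (\<Sum>s\<in>J. \<Sum>t\<in>J. \<xi> s * b s t * \<eta> t)"
    by (simp add: algebra_simps sum.distrib norm_triangle_ineq)
  also have "\<dots> \<le> C * fin_norm (conj_exponent p) J \<xi> * fin_norm p J \<eta> + D * fin_norm (conj_exponent p) J \<xi> * fin_norm p J \<eta>"
    by (intro add_mono mat_boundD[OF assms(1) J] mat_boundD[OF assms(2) J])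
  finally show "norm (\<Sum>s\<in>J. \<Sum>t\<in>J. \<xi> s * (a s t + b s t) * \<eta> t) \<le> (C + D) * fin_norm (conj_exponent p) J \<xi> * fin_norm p J \<eta>"
    by (simp add: algebra_simps)
qed

lemma mat_bound_scale:
  assumes "mat_bound p I a C"
  shows "mat_bound p I (\<lambda>s t. c * a s t) (norm c * C)"
proof (rule mat_boundI)
  show "0 \<le> norm c * C" using assms by (auto simp: mat_bound_def)
  fix J \<xi> \<eta> assume J: "finite J" "J \<subseteq> I"
  have "(\<Sum>s\<in>J. \<Sum>t\<in>J. \<xi> s * (c * a s t) * \<eta> t) = c * (\<Sum>s\<in>J. \<Sum>t\<in>J. \<xi> s * a s t * \<eta> t)"
    by (simp add: sum_distrib_left mult_ac)
  then show "norm (\<Sum>s\<in>J. \<Sum>t\<in>J. \<xi> s * (c * a s t) * \<eta> t) \<le> norm c * C * fin_norm (conj_exponent p) J \<xi> * fin_norm p J \<eta>"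
    using mult_left_mono[OF mat_boundD[OF assms J, of \<xi> \<eta>] norm_ge_zero[of c]]
    by (simp add: norm_mult mult_ac)
qed

lemma mat_bound_sum:
  assumes "finite A" "\<And>x. x \<in> A \<Longrightarrow> mat_bound p I (a x) (C x)"
  shows "mat_bound p I (\<lambda>s t. \<Sum>x\<in>A. a x s t) (\<Sum>x\<in>A. C x)"
  using assms by (induction A rule: finite_induct) (auto intro: mat_bound_zero mat_bound_add)

lemma op_norm_le:
  assumes "\<And>f. f \<in> lp p I \<Longrightarrow> lp_norm p (T f) \<le> C * lp_norm p f" "0 \<le> C"
  shows "op_norm p I T \<le> C"
proof -
  have "(\<lambda>_. 0) \<in> {f \<in> lp p I. lp_norm p f \<le> 1}" by simp
  then show ?thesis unfolding op_norm_def
  proof (intro cSUP_least)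
    show "{f \<in> lp p I. lp_norm p f \<le> 1} \<noteq> {}" by (auto intro!: exI[of _ "\<lambda>_. 0"])
    fix f assume "f \<in> {f \<in> lp p I. lp_norm p f \<le> 1}"
    then show "lp_norm p (T f) \<le> C"
      using assms(1)[of f] mult_left_mono[of "lp_norm p f" 1 C] assms(2) by simp
  qed
qed

lemma bounded_op_cong:
  assumes "\<And>f. f \<in> lp p I \<Longrightarrow> S f = T f" "1 < p"
  shows "bounded_op p I S \<longleftrightarrow> bounded_op p I T"
  using assms by (simp add: bounded_op_def lp_add lp_scale cong: ball_cong)

lemma op_norm_cong:
  assumes "\<And>f. f \<in> lp p I \<Longrightarrow> S f = T f"
  shows "op_norm p I S = op_norm p I T"
  unfolding op_norm_def using assms by (intro SUP_cong) auto

locale lp_exponent =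
  fixes p :: real
  assumes p_gt_1: "1 < p"
begin

abbreviation q :: real where "q \<equiv> conj_exponent p"

lemma q_gt_1: "1 < q"
  by (rule conj_exponent_gt_1[OF p_gt_1])

lemma bounded_opI:
  assumes "\<And>f. f \<in> lp p I \<Longrightarrow> T f \<in> lp p I"
    "\<And>f g. f \<in> lp p I \<Longrightarrow> g \<in> lp p I \<Longrightarrow> T (\<lambda>i. f i + g i) = (\<lambda>i. T f i + T g i)"
    "\<And>c f. f \<in> lp p I \<Longrightarrow> T (\<lambda>i. c * f i) = (\<lambda>i. c * T f i)"
    "\<And>f. f \<in> lp p I \<Longrightarrow> lp_norm p (T f) \<le> C * lp_norm p f"
  shows "bounded_op p I T"
  unfolding bounded_op_def using assms by blast

lemma
  assumes "bounded_op p I T"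
  shows bounded_op_lp: "f \<in> lp p I \<Longrightarrow> T f \<in> lp p I"
    and bounded_op_add: "f \<in> lp p I \<Longrightarrow> g \<in> lp p I \<Longrightarrow> T (\<lambda>i. f i + g i) = (\<lambda>i. T f i + T g i)"
    and bounded_op_scale: "f \<in> lp p I \<Longrightarrow> T (\<lambda>i. c * f i) = (\<lambda>i. c * T f i)"
  using assms unfolding bounded_op_def by blast+

lemma bounded_op_zero:
  assumes "bounded_op p I T" shows "T (\<lambda>_. 0) = (\<lambda>_. 0)"
  using bounded_op_scale[OF assms, of "\<lambda>_. 0" 0] by simp

lemma bounded_op_sum:
  assumes T: "bounded_op p I T" and A: "finite A" "\<And>x. x \<in> A \<Longrightarrow> f x \<in> lp p I"
  shows "T (\<lambda>i. \<Sum>x\<in>A. f x i) = (\<lambda>i. \<Sum>x\<in>A. T (f x) i)"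
  using A
proof (induction A rule: finite_induct)
  case empty then show ?case using bounded_op_zero[OF T] by simp
next
  case (insert x A)
  then have "(\<lambda>i. \<Sum>x\<in>A. f x i) \<in> lp p I" by (intro lp_sum p_gt_1) auto
  then show ?case using insert by (simp add: bounded_op_add[OF T])
qed

lemma bdd_above_op_norm:
  assumes "bounded_op p I T"
  shows "bdd_above ((\<lambda>f. lp_norm p (T f)) ` {f \<in> lp p I. lp_norm p f \<le> 1})"
proof -
  obtain C where C: "\<And>f. f \<in> lp p I \<Longrightarrow> lp_norm p (T f) \<le> C * lp_norm p f"
    using assms unfolding bounded_op_def by blast
  have "lp_norm p (T f) \<le> \<bar>C\<bar>" if "f \<in> lp p I" "lp_norm p f \<le> 1" for f
  proof -
    have "C * lp_norm p f \<le> \<bar>C\<bar> * 1" by (rule mult_mono) (use that in auto)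
    then show ?thesis using C[OF that(1)] by simp
  qed
  then show ?thesis by (auto simp: bdd_above_def)
qed

lemma bounded_op_le:
  assumes T: "bounded_op p I T" and f: "f \<in> lp p I"
  shows "lp_norm p (T f) \<le> op_norm p I T * lp_norm p f"
proof (cases "lp_norm p f = 0")
  case True
  then have "f = (\<lambda>_. 0)" using lp_norm_eq_0D[OF p_gt_1 f] by auto
  then show ?thesis using bounded_op_zero[OF T] by simp
next
  case False
  define n where "n = lp_norm p f"
  have n: "n > 0" using False lp_norm_nonneg[of p f] by (simp add: n_def del: lp_norm_nonneg)
  define g where "g = (\<lambda>i. complex_of_real (1/n) * f i)"
  have g: "g \<in> lp p I" "lp_norm p g = 1"
    using n lp_scale[OF p_gt_1 f, of "complex_of_real (1/n)"] lp_norm_scale[OF p_gt_1 f, of "complex_of_real (1/n)"]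
    by (simp_all add: g_def norm_divide n_def)
  have "lp_norm p (T g) \<le> op_norm p I T"
    unfolding op_norm_def using g bdd_above_op_norm[OF T] by (intro cSUP_upper) auto
  moreover have "lp_norm p (T g) = 1/n * lp_norm p (T f)"
    using n by (simp only: g_def bounded_op_scale[OF T f] lp_norm_scale[OF p_gt_1 bounded_op_lp[OF T f]]) (simp add: norm_divide)
  ultimately show ?thesis using n by (simp add: field_simps n_def)
qed

lemma op_norm_nonneg:
  assumes "bounded_op p I T" shows "0 \<le> op_norm p I T"
proof -
  have "lp_norm p (T (\<lambda>_. 0)) \<le> op_norm p I T"
    unfolding op_norm_def using bdd_above_op_norm[OF assms] by (intro cSUP_upper) auto
  then show ?thesis by (meson lp_norm_nonneg order_trans)
qed

text \<open>The definition of \<open>mat_bound\<close> uses one index set for rows and columns;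
  extending both test vectors by 0 to \<open>J \<union> K\<close> separates them.\<close>

lemma mat_bound_two_sets:
  assumes a: "mat_bound p I a C" and J: "finite J" "J \<subseteq> I" and K: "finite K" "K \<subseteq> I"
  shows "norm (\<Sum>s\<in>J. \<Sum>t\<in>K. \<xi> s * a s t * \<eta> t) \<le> C * fin_norm q J \<xi> * fin_norm p K \<eta>"
proof -
  define \<xi>' where "\<xi>' s = (if s \<in> J then \<xi> s else 0)" for s
  define \<eta>' where "\<eta>' s = (if s \<in> K then \<eta> s else 0)" for s
  have "(\<Sum>s\<in>J. \<Sum>t\<in>K. \<xi> s * a s t * \<eta> t) = (\<Sum>s\<in>J. \<Sum>t\<in>K. \<xi>' s * a s t * \<eta>' t)"
    by (intro sum.cong refl) (auto simp: \<xi>'_def \<eta>'_def)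
  also have "\<dots> = (\<Sum>s\<in>J. \<Sum>t\<in>J\<union>K. \<xi>' s * a s t * \<eta>' t)"
    using J K by (intro sum.cong refl sum.mono_neutral_left) (auto simp: \<xi>'_def \<eta>'_def)
  also have "\<dots> = (\<Sum>s\<in>J\<union>K. \<Sum>t\<in>J\<union>K. \<xi>' s * a s t * \<eta>' t)"
    using J K by (intro sum.mono_neutral_left) (auto simp: \<xi>'_def \<eta>'_def)
  finally have eq: "(\<Sum>s\<in>J. \<Sum>t\<in>K. \<xi> s * a s t * \<eta> t) = (\<Sum>s\<in>J\<union>K. \<Sum>t\<in>J\<union>K. \<xi>' s * a s t * \<eta>' t)" .
  have *: "fin_norm r (J \<union> K) f' = fin_norm r L f"
    if "L \<subseteq> J \<union> K" "1 < r" "\<And>s. f' s = (if s \<in> L then f s else 0)" for r L and f f' :: "'a \<Rightarrow> complex"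
    unfolding fin_norm_def using J K that
    by (intro arg_cong[where f = "\<lambda>x. x powr _"] sum.mono_neutral_cong_right) auto
  have "fin_norm q (J \<union> K) \<xi>' = fin_norm q J \<xi>" by (rule *) (auto simp: \<xi>'_def q_gt_1)
  moreover have "fin_norm p (J \<union> K) \<eta>' = fin_norm p K \<eta>" by (rule *) (auto simp: \<eta>'_def p_gt_1)
  ultimately show ?thesis
    using mat_boundD[OF a, of "J \<union> K" \<xi>' \<eta>'] J K eq by simp
qed

text \<open>Rows and columns may be relabelled by different injections. This gives access to
  off-diagonal blocks, such as the block of a matrix over a product group with first coordinate
  \<open>g\<close> in the rows and 0 in the columns.\<close>

lemma mat_bound_reindex:
  fixes f g :: "'b \<Rightarrow> 'a"
  assumes a: "mat_bound p I a C" and f: "inj_on f K" "f ` K \<subseteq> I" and g: "inj_on g K" "g ` K \<subseteq> I"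
  shows "mat_bound p K (\<lambda>s t. a (f s) (g t)) C"
proof (rule mat_boundI[OF mat_bound_nonneg[OF a]])
  fix J and \<xi> \<eta> :: "'b \<Rightarrow> complex" assume J: "finite J" "J \<subseteq> K"
  have fJ: "inj_on f J" "f ` J \<subseteq> I" and gJ: "inj_on g J" "g ` J \<subseteq> I"
    using f g J by (blast intro: inj_on_subset)+
  define \<xi>' where "\<xi>' = \<xi> \<circ> the_inv_into J f"
  define \<eta>' where "\<eta>' = \<eta> \<circ> the_inv_into J g"
  have 1: "\<xi>' (f s) = \<xi> s" "\<eta>' (g s) = \<eta> s" if "s \<in> J" for s
    using fJ gJ that by (auto simp: \<xi>'_def \<eta>'_def the_inv_into_f_f)
  have "(\<Sum>s\<in>J. \<Sum>t\<in>J. \<xi> s * a (f s) (g t) * \<eta> t) = (\<Sum>s\<in>f ` J. \<Sum>t\<in>g ` J. \<xi>' s * a s t * \<eta>' t)"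
    using fJ gJ by (simp add: sum.reindex 1)
  moreover have "fin_norm q (f ` J) \<xi>' = fin_norm q J \<xi>" "fin_norm p (g ` J) \<eta>' = fin_norm p J \<eta>"
    using fJ gJ by (simp_all add: fin_norm_def sum.reindex 1)
  ultimately show "norm (\<Sum>s\<in>J. \<Sum>t\<in>J. \<xi> s * a (f s) (g t) * \<eta> t) \<le> C * fin_norm q J \<xi> * fin_norm p J \<eta>"
    using mat_bound_two_sets[OF a _ fJ(2) _ gJ(2), of \<xi>' \<eta>'] J by simp
qed

text \<open>Testing with the single row \<open>s\<close> bounds that row as a functional on finitely
  supported vectors; \<open>fin_norm_dual\<close>, with the roles of \<open>p\<close> and
  \<open>q\<close> exchanged, makes this a norm bound. Hoelder's inequality then gives convergence
  of the sums in \<open>mat_op\<close>.\<close>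

lemma mat_bound_row_lp:
  assumes a: "mat_bound p I a C" and s: "s \<in> I"
  shows "(\<lambda>t. if t \<in> I then a s t else 0) \<in> lp q I"
proof (rule lp_of_fin_norm_le_on(1)[OF q_gt_1 mat_bound_nonneg[OF a]])
  fix K assume K: "finite K" "K \<subseteq> I"
  show "fin_norm q K (\<lambda>t. if t \<in> I then a s t else 0) \<le> C"
  proof (rule fin_norm_dual[OF q_gt_1 K(1) mat_bound_nonneg[OF a]])
    fix \<xi>
    have "norm (\<Sum>i\<in>K. \<xi> i * (if i \<in> I then a s i else 0)) = norm (\<Sum>r\<in>{s}. \<Sum>t\<in>K. 1 * a r t * \<xi> t)"
      using K by (simp add: mult.commute subset_iff cong: sum.cong)
    also have "\<dots> \<le> C * fin_norm q {s} (\<lambda>_. 1) * fin_norm p K \<xi>"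
      by (rule mat_bound_two_sets[OF a]) (use s K in auto)
    finally show "norm (\<Sum>i\<in>K. \<xi> i * (if i \<in> I then a s i else 0)) \<le> C * fin_norm (conj_exponent q) K \<xi>"
      by (simp add: conj_exponent_conj_exponent[OF p_gt_1] fin_norm_def[of q])
  qed
qed simp

lemma mat_bound_row_summable:
  assumes a: "mat_bound p I a C" and s: "s \<in> I" and f: "f \<in> lp p I"
  shows "(\<lambda>t. norm (a s t * f t)) summable_on I"
proof -
  have "(\<lambda>t. norm ((if t \<in> I then a s t else 0) * f t)) summable_on I"
    by (rule holder_abs_summable[OF p_gt_1 mat_bound_row_lp[OF a s] f])
  then show ?thesis by (rule summable_on_cong[THEN iffD1, rotated]) auto
qed

text \<open>The estimate for finitely many columns passes to the limit over finite column sets; the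
  rows stay finite, so the limit can be taken inside the outer sum.\<close>

lemma mat_bound_apply:
  assumes a: "mat_bound p I a C" and J: "finite J" "J \<subseteq> I" and f: "f \<in> lp p I"
  shows "norm (\<Sum>s\<in>J. \<xi> s * (\<Sum>\<^sub>\<infinity>t\<in>I. a s t * f t)) \<le> C * fin_norm q J \<xi> * lp_norm p f"
proof (rule tendsto_upperbound)
  have "((\<lambda>K. \<Sum>t\<in>K. a s t * f t) \<longlongrightarrow> (\<Sum>\<^sub>\<infinity>t\<in>I. a s t * f t)) (finite_subsets_at_top I)" if "s \<in> J" for s
    by (rule infsum_tendsto[OF abs_summable_summable[OF mat_bound_row_summable[OF a _ f]]]) (use that J in auto)
  then show "((\<lambda>K. norm (\<Sum>s\<in>J. \<xi> s * (\<Sum>t\<in>K. a s t * f t))) \<longlongrightarrow>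
      norm (\<Sum>s\<in>J. \<xi> s * (\<Sum>\<^sub>\<infinity>t\<in>I. a s t * f t))) (finite_subsets_at_top I)"
    by (intro tendsto_norm tendsto_sum tendsto_mult tendsto_const) auto
  have "norm (\<Sum>s\<in>J. \<xi> s * (\<Sum>t\<in>K. a s t * f t)) \<le> C * fin_norm q J \<xi> * lp_norm p f"
    if K: "finite K" "K \<subseteq> I" for K
  proof -
    have "norm (\<Sum>s\<in>J. \<xi> s * (\<Sum>t\<in>K. a s t * f t)) = norm (\<Sum>s\<in>J. \<Sum>t\<in>K. \<xi> s * a s t * f t)"
      by (simp add: sum_distrib_left mult.assoc)
    also have "\<dots> \<le> C * fin_norm q J \<xi> * fin_norm p K f"
      by (rule mat_bound_two_sets[OF a J K])
    also have "\<dots> \<le> C * fin_norm q J \<xi> * lp_norm p f"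
      using mat_bound_nonneg[OF a] by (intro mult_left_mono fin_norm_le_lp_norm[OF p_gt_1 f K(1)]) auto
    finally show ?thesis .
  qed
  then show "\<forall>\<^sub>F K in finite_subsets_at_top I. norm (\<Sum>s\<in>J. \<xi> s * (\<Sum>t\<in>K. a s t * f t)) \<le> C * fin_norm q J \<xi> * lp_norm p f"
    by (auto simp: eventually_finite_subsets_at_top intro!: exI[of _ "{}"])
qed simp

lemma
  assumes a: "mat_bound p I a C"
  shows mat_op_in_lp_ops: "mat_op p I a \<in> lp_ops p I"
    and mat_op_norm_le: "f \<in> lp p I \<Longrightarrow> lp_norm p (mat_op p I a f) \<le> C * lp_norm p f"
proof -
  have *: "mat_op p I a f \<in> lp p I \<and> lp_norm p (mat_op p I a f) \<le> C * lp_norm p f" if f: "f \<in> lp p I" for f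
  proof -
    have C: "0 \<le> C * lp_norm p f" using mat_bound_nonneg[OF a] by simp
    have "fin_norm p J (mat_op p I a f) \<le> C * lp_norm p f" if J: "finite J" "J \<subseteq> I" for J
    proof (rule fin_norm_dual[OF p_gt_1 J(1) C])
      fix \<xi>
      have "(\<Sum>i\<in>J. \<xi> i * mat_op p I a f i) = (\<Sum>i\<in>J. \<xi> i * (\<Sum>\<^sub>\<infinity>t\<in>I. a i t * f t))"
        using J f by (intro sum.cong) (auto simp: mat_op_def)
      then show "norm (\<Sum>i\<in>J. \<xi> i * mat_op p I a f i) \<le> C * lp_norm p f * fin_norm q J \<xi>"
        using mat_bound_apply[OF a J f, of \<xi>] by (simp add: mult_ac)
    qed
    moreover have "mat_op p I a f i = 0" if "i \<notin> I" for i using that f by (simp add: mat_op_def)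
    ultimately show ?thesis using lp_of_fin_norm_le_on[OF p_gt_1 C, of I "mat_op p I a f"] by simp
  qed
  then show "f \<in> lp p I \<Longrightarrow> lp_norm p (mat_op p I a f) \<le> C * lp_norm p f" by blast
  have summ: "(\<lambda>t. a s t * f t) summable_on I" if "s \<in> I" "f \<in> lp p I" for s f
    by (rule abs_summable_summable[OF mat_bound_row_summable[OF a that]])
  have "bounded_op p I (mat_op p I a)"
  proof (rule bounded_opI)
    fix f g assume "f \<in> lp p I" "g \<in> lp p I"
    then show "mat_op p I a (\<lambda>i. f i + g i) = (\<lambda>i. mat_op p I a f i + mat_op p I a g i)"
      by (auto simp: mat_op_def lp_add[OF p_gt_1] distrib_left infsum_add summ fun_eq_iff)
  next
    fix c f assume "f \<in> lp p I"
    then show "mat_op p I a (\<lambda>i. c * f i) = (\<lambda>i. c * mat_op p I a f i)"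
      by (auto simp: mat_op_def lp_scale[OF p_gt_1] mult.left_commute[of _ c] infsum_cmult_right summ fun_eq_iff)
  qed (use * in auto)
  then show "mat_op p I a \<in> lp_ops p I" by (simp add: lp_ops_iff mat_op_def)
qed

lemma entry_mat_op:
  assumes "s \<in> I" "t \<in> I"
  shows "entry (mat_op p I a) s t = a s t"
proof -
  have "(\<Sum>\<^sub>\<infinity>r\<in>I. a s r * delta t r) = (\<Sum>\<^sub>\<infinity>r\<in>{t}. a s r * delta t r)"
    by (rule infsum_cong_neutral) (use assms in \<open>auto simp: delta_def\<close>)
  also have "\<dots> = a s t" by (simp add: delta_def)
  finally show ?thesis using assms delta_in_lp[OF p_gt_1 assms(2)] by (simp add: entry_def mat_op_def)
qed

lemma mat_bound_entryI:
  assumes T: "bounded_op p I T" and C: "0 \<le> C"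
    and le: "\<And>f. f \<in> lp p I \<Longrightarrow> lp_norm p (T f) \<le> C * lp_norm p f"
  shows "mat_bound p I (entry T) C"
proof (rule mat_boundI[OF C])
  fix J \<xi> \<eta> assume J: "finite J" "J \<subseteq> I"
  have d: "delta t \<in> lp p I" if "t \<in> J" for t
    using that J delta_in_lp[OF p_gt_1, of t I] by auto
  define f where "f i = (\<Sum>t\<in>J. \<eta> t * delta t i)" for i
  have fe: "f i = (if i \<in> J then \<eta> i else 0)" for i
    using J by (simp add: f_def delta_def if_distrib sum.delta cong: if_cong)
  have f: "f \<in> lp p I" unfolding f_def[abs_def] using d by (intro lp_sum lp_scale p_gt_1 J)
  have nf: "lp_norm p f = fin_norm p J \<eta>"
    using lp_finite_support(2)[OF p_gt_1 J(1), of f] by (simp add: fe cong: fin_norm_cong)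
  have "T f = (\<lambda>s. \<Sum>t\<in>J. T (\<lambda>i. \<eta> t * delta t i) s)"
    unfolding f_def[abs_def] using d by (intro bounded_op_sum[OF T J(1)] lp_scale p_gt_1)
  then have Tf: "T f s = (\<Sum>t\<in>J. \<eta> t * entry T s t)" for s
    using d by (simp add: bounded_op_scale[OF T] entry_def)
  have "(\<Sum>s\<in>J. \<Sum>t\<in>J. \<xi> s * entry T s t * \<eta> t) = (\<Sum>s\<in>J. \<xi> s * T f s)"
    by (simp add: Tf sum_distrib_left mult_ac)
  also have "norm \<dots> \<le> fin_norm q J \<xi> * fin_norm p J (T f)"
    by (rule fin_norm_holder_norm[OF p_gt_1 J(1)])
  also have "\<dots> \<le> fin_norm q J \<xi> * (C * fin_norm p J \<eta>)"
    using le[OF f] fin_norm_le_lp_norm[OF p_gt_1 bounded_op_lp[OF T f] J(1)]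
    by (intro mult_left_mono) (auto simp: nf)
  finally show "norm (\<Sum>s\<in>J. \<Sum>t\<in>J. \<xi> s * entry T s t * \<eta> t) \<le> C * fin_norm q J \<xi> * fin_norm p J \<eta>"
    by (simp add: mult_ac)
qed

lemma mat_bound_entry:
  "bounded_op p I T \<Longrightarrow> mat_bound p I (entry T) (op_norm p I T)"
  by (intro mat_bound_entryI op_norm_nonneg bounded_op_le)

lemma
  assumes S: "bounded_op p I S" and T: "bounded_op p I T"
  shows bounded_op_plus: "bounded_op p I (\<lambda>f i. S f i + T f i)"
    and bounded_op_minus: "bounded_op p I (\<lambda>f i. S f i - T f i)"
    and bounded_op_compose: "bounded_op p I (\<lambda>f. S (T f))"
proof -
  note [simp] = lp_add[OF p_gt_1] lp_diff[OF p_gt_1] bounded_op_lp[OF S] bounded_op_lp[OF T]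
    bounded_op_add[OF S] bounded_op_add[OF T] bounded_op_scale[OF S] bounded_op_scale[OF T]
  show "bounded_op p I (\<lambda>f i. S f i + T f i)"
  proof (rule bounded_opI)
    fix f assume f: "f \<in> lp p I"
    have "lp_norm p (\<lambda>i. S f i + T f i) \<le> lp_norm p (S f) + lp_norm p (T f)"
      using f by (intro lp_norm_triangle[OF p_gt_1, of _ I]) auto
    also have "\<dots> \<le> (op_norm p I S + op_norm p I T) * lp_norm p f"
      using bounded_op_le[OF S f] bounded_op_le[OF T f] by (simp add: algebra_simps)
    finally show "lp_norm p (\<lambda>i. S f i + T f i) \<le> (op_norm p I S + op_norm p I T) * lp_norm p f" .
  qed (auto simp: algebra_simps)
  show "bounded_op p I (\<lambda>f i. S f i - T f i)"
  proof (rule bounded_opI)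
    fix f assume f: "f \<in> lp p I"
    have T': "(\<lambda>i. - T f i) \<in> lp p I" "lp_norm p (\<lambda>i. - T f i) = lp_norm p (T f)"
      using lp_scale[OF p_gt_1 bounded_op_lp[OF T f], of "-1"] by (auto intro: lp_norm_cong)
    have "lp_norm p (\<lambda>i. S f i + (- T f i)) \<le> lp_norm p (S f) + lp_norm p (\<lambda>i. - T f i)"
      using f T' by (intro lp_norm_triangle[OF p_gt_1, of _ I]) auto
    also have "\<dots> \<le> (op_norm p I S + op_norm p I T) * lp_norm p f"
      using bounded_op_le[OF S f] bounded_op_le[OF T f] T' by (simp add: algebra_simps)
    finally show "lp_norm p (\<lambda>i. S f i - T f i) \<le> (op_norm p I S + op_norm p I T) * lp_norm p f" by simp
  qed (auto simp: algebra_simps)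
  show "bounded_op p I (\<lambda>f. S (T f))"
  proof (rule bounded_opI)
    fix f assume f: "f \<in> lp p I"
    have "lp_norm p (S (T f)) \<le> op_norm p I S * lp_norm p (T f)"
      using f by (intro bounded_op_le S) auto
    also have "\<dots> \<le> op_norm p I S * (op_norm p I T * lp_norm p f)"
      by (intro mult_left_mono bounded_op_le T f op_norm_nonneg S)
    finally show "lp_norm p (S (T f)) \<le> op_norm p I S * op_norm p I T * lp_norm p f" by (simp add: mult_ac)
  qed auto
qed

lemma bounded_op_times:
  assumes T: "bounded_op p I T"
  shows "bounded_op p I (\<lambda>f i. c * T f i)"
proof (rule bounded_opI)
  fix f assume f: "f \<in> lp p I"
  show "lp_norm p (\<lambda>i. c * T f i) \<le> norm c * op_norm p I T * lp_norm p f"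
    using lp_norm_scale[OF p_gt_1 bounded_op_lp[OF T f], of c] mult_left_mono[OF bounded_op_le[OF T f], of "norm c"]
    by (simp add: mult_ac)
qed (auto simp: lp_scale[OF p_gt_1] bounded_op_lp[OF T] bounded_op_add[OF T] bounded_op_scale[OF T] algebra_simps)

text \<open>The difference kills every \<open>delta t\<close>, hence every finitely supported
  vector, and these are dense.\<close>

lemma bounded_op_eqI:
  assumes S: "bounded_op p I S" and T: "bounded_op p I T"
    and eq: "\<And>s t. s \<in> I \<Longrightarrow> t \<in> I \<Longrightarrow> entry S s t = entry T s t" and f: "f \<in> lp p I"
  shows "S f = T f"
proof -
  define D where "D f i = S f i - T f i" for f i
  have D: "bounded_op p I D" unfolding D_def[abs_def] by (rule bounded_op_minus[OF S T])
  have Dd: "D (delta t) = (\<lambda>_. 0)" if "t \<in> I" for t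
  proof
    fix s
    have "delta t \<in> lp p I" using delta_in_lp[OF p_gt_1 that] .
    then have "s \<notin> I \<Longrightarrow> D (delta t) s = 0" using lp_vanishes[OF bounded_op_lp[OF D], of "delta t" s] by simp
    then show "D (delta t) s = 0" using eq[of s t] that by (auto simp: D_def entry_def)
  qed
  have "lp_norm p (D f) \<le> 0 + e" if e: "e > 0" for e
  proof -
    \<comment> \<open>Adding 1 keeps \<open>N\<close> positive, so that \<open>e / N\<close> is a
      legitimate tolerance even if \<open>D\<close> has norm 0.\<close>
    define N where "N = op_norm p I D + 1"
    have N: "N > 0" using op_norm_nonneg[OF D] by (simp add: N_def)
    obtain J where J: "finite J" "J \<subseteq> I" and Je: "lp_norm p (\<lambda>i. if i \<in> J then 0 else f i) < e / N"
      using lp_norm_restrict_complement[OF p_gt_1 f, of "e / N"] e N by auto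
    define g where "g i = (\<Sum>t\<in>J. f t * delta t i)" for i
    define h where "h i = (if i \<in> J then 0 else f i)" for i
    have h: "h \<in> lp p I" by (rule lp_dominated[OF p_gt_1 f]) (simp add: h_def)
    have d: "delta t \<in> lp p I" if "t \<in> J" for t using that J delta_in_lp[OF p_gt_1, of t I] by auto
    have g: "g \<in> lp p I" unfolding g_def[abs_def] using d by (intro lp_sum lp_scale p_gt_1 J)
    have fgh: "f = (\<lambda>i. g i + h i)"
      using J by (auto simp: g_def h_def delta_def if_distrib sum.delta cong: if_cong)
    have "D g = (\<lambda>s. \<Sum>t\<in>J. D (\<lambda>i. f t * delta t i) s)"
      unfolding g_def[abs_def] using d by (intro bounded_op_sum[OF D J(1)] lp_scale p_gt_1)
    also have "\<dots> = (\<lambda>_. 0)"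
    proof -
      have "D (\<lambda>i. f t * delta t i) = (\<lambda>_. 0)" if "t \<in> J" for t
        using bounded_op_scale[OF D d[OF that], of "f t"] Dd[of t] that J by auto
      then show ?thesis by simp
    qed
    finally have "D f = D h" using bounded_op_add[OF D g h] fgh by simp
    then have "lp_norm p (D f) \<le> op_norm p I D * lp_norm p h" using bounded_op_le[OF D h] by simp
    also have "\<dots> \<le> N * (e / N)"
      using Je N unfolding N_def h_def[abs_def] by (intro mult_mono) auto
    finally show ?thesis using N by simp
  qed
  then have "lp_norm p (D f) = 0" by (metis antisym field_le_epsilon lp_norm_nonneg)
  then have "D f i = 0" for i by (rule lp_norm_eq_0D[OF p_gt_1 bounded_op_lp[OF D f]])
  then show ?thesis by (auto simp: D_def fun_eq_iff)
qed

lemma lp_ops_eqI: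
  assumes "S \<in> lp_ops p UNIV" "T \<in> lp_ops p UNIV" "\<And>s t. entry S s t = entry T s t"
  shows "S = T"
proof
  fix f show "S f = T f"
  proof (cases "f \<in> lp p UNIV")
    case True
    then show ?thesis using assms by (intro bounded_op_eqI[of UNIV]) (auto simp: lp_ops_iff)
  next
    case False
    then show ?thesis using assms by (auto simp: lp_ops_iff extensional_def)
  qed
qed

lemma bounded_op_apply:
  assumes T: "bounded_op p I T" and f: "f \<in> lp p I" and s: "s \<in> I"
  shows "(\<lambda>t. norm (entry T s t * f t)) summable_on I" "T f s = (\<Sum>\<^sub>\<infinity>t\<in>I. entry T s t * f t)"
proof -
  note a = mat_bound_entry[OF T]
  show "(\<lambda>t. norm (entry T s t * f t)) summable_on I" by (rule mat_bound_row_summable[OF a s f])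
  have "T f = mat_op p I (entry T) f"
    using mat_op_in_lp_ops[OF a]
    by (intro bounded_op_eqI[OF T _ _ f]) (auto simp: lp_ops_iff entry_mat_op)
  then show "T f s = (\<Sum>\<^sub>\<infinity>t\<in>I. entry T s t * f t)" using s f by (simp add: mat_op_def)
qed

text \<open>By \<open>bounded_op_eqI\<close> the operator coincides with \<open>mat_op\<close> of
  its own entries, so its norm is the best constant in \<open>mat_bound\<close>. This moves norm
  estimates to entries, where relabelling and entrywise multiplication are direct.\<close>

lemma op_norm_le_iff:
  assumes T: "bounded_op p I T" and C: "0 \<le> C"
  shows "op_norm p I T \<le> C \<longleftrightarrow> mat_bound p I (entry T) C"
proof
  assume "op_norm p I T \<le> C"
  then show "mat_bound p I (entry T) C" by (rule mat_bound_mono[OF mat_bound_entry[OF T]])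
next
  assume a: "mat_bound p I (entry T) C"
  have "T f = mat_op p I (entry T) f" if f: "f \<in> lp p I" for f
    using mat_op_in_lp_ops[OF a]
    by (intro bounded_op_eqI[OF T _ _ f]) (auto simp: lp_ops_iff entry_mat_op)
  then show "op_norm p I T \<le> C" using mat_op_norm_le[OF a] by (intro op_norm_le C) auto
qed

lemma op_norm_diff_le_iff:
  assumes "bounded_op p I S" "bounded_op p I T" "0 \<le> C"
  shows "op_norm p I (\<lambda>f i. S f i - T f i) \<le> C \<longleftrightarrow> mat_bound p I (\<lambda>s t. entry S s t - entry T s t) C"
  using op_norm_le_iff[OF bounded_op_minus[OF assms(1,2)] assms(3)] by (simp add: entry_def[abs_def])

end

section \<open>Coefficient functions as Schur multipliers\<close>

lemma
  assumes "bij h"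
  shows lp_bij: "f \<in> lp r UNIV \<Longrightarrow> (\<lambda>t. f (h t)) \<in> lp r UNIV"
    and lp_norm_bij: "lp_norm r (\<lambda>t. f (h t)) = lp_norm r f"
  using summable_on_reindex_bij_betw[OF assms, of "\<lambda>i. norm (f i) powr r"]
    infsum_reindex_bij_betw[OF assms, of "\<lambda>i. norm (f i) powr r"]
  by (simp_all add: lp_def lp_norm_def)

lemma has_sum_finite_sum:
  fixes f :: "'a \<Rightarrow> 'b \<Rightarrow> 'c::topological_comm_monoid_add"
  assumes "finite A" "\<And>x. x \<in> A \<Longrightarrow> (f x has_sum S x) B"
  shows "((\<lambda>y. \<Sum>x\<in>A. f x y) has_sum (\<Sum>x\<in>A. S x)) B"
  using assms by (induction A rule: finite_induct) (auto intro: has_sum_add)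

lemma
  fixes f :: "'a \<Rightarrow> 'b \<Rightarrow> 'c::{topological_comm_monoid_add, t2_space}"
  assumes "finite A" "\<And>x. x \<in> A \<Longrightarrow> f x summable_on B"
  shows summable_on_finite_sum: "(\<lambda>y. \<Sum>x\<in>A. f x y) summable_on B"
    and infsum_finite_sum: "(\<Sum>\<^sub>\<infinity>y\<in>B. \<Sum>x\<in>A. f x y) = (\<Sum>x\<in>A. infsum (f x) B)"
  using has_sum_finite_sum[OF assms(1) has_sum_infsum[OF assms(2)]]
  by (auto simp: has_sum_iff)

lemma bij_add_left: "bij (\<lambda>t. s + t :: 'g::group_add)"
  by (rule bij_betw_byWitness[where f' = "\<lambda>t. - s + t"]) (auto simp: add.assoc[symmetric])

lemma bij_add_right: "bij (\<lambda>t. t + s :: 'g::group_add)"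
  by (rule bij_betw_byWitness[where f' = "\<lambda>t. t + - s"]) (auto simp: add.assoc)

text \<open>Fubini: for fixed \<open>s\<close> the map \<open>g \<mapsto> \<pi> s + g\<close> is
  injective, so the sum over \<open>g\<close> of the r-th powers is at most
  \<open>norm (y s) powr r * lp_norm r \<xi> powr r\<close>, and summing over \<open>s\<close>
  bounds the translated vectors jointly.\<close>

lemma
  fixes \<pi> :: "'i \<Rightarrow> 'g::group_add"
  assumes r: "1 < r" and y: "y \<in> lp r UNIV" and \<xi>: "\<xi> \<in> lp r UNIV"
  shows lp_times_translate: "(\<lambda>s. y s * \<xi> (\<pi> s + g)) \<in> lp r UNIV"
    and fin_norm_times_translates:
      "finite R \<Longrightarrow> fin_norm r R (\<lambda>g. complex_of_real (lp_norm r (\<lambda>s. y s * \<xi> (\<pi> s + g)))) \<le> lp_norm r y * lp_norm r \<xi>"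
proof -
  have le: "norm (\<xi> x) \<le> lp_norm r \<xi>" for x
    using fin_norm_le_lp_norm[OF r \<xi>, of "{x}"] r by (simp add: fin_norm_def powr_powr)
  show 1: "(\<lambda>s. y s * \<xi> (\<pi> s + g)) \<in> lp r UNIV" for g
    by (rule lp_dominated[OF r lp_scale[OF r y, of "complex_of_real (lp_norm r \<xi>)"]])
       (simp add: norm_mult, subst mult.commute, intro mult_right_mono le norm_ge_zero)
  assume R: "finite R"
  have summ: "(\<lambda>s. norm (y s * \<xi> (\<pi> s + g)) powr r) summable_on UNIV" for g
    using 1[of g] by (simp add: lp_def)
  have sy: "(\<lambda>s. norm (y s) powr r) summable_on UNIV" using y by (simp add: lp_def)
  have "(\<Sum>g\<in>R. norm (complex_of_real (lp_norm r (\<lambda>s. y s * \<xi> (\<pi> s + g)))) powr r)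
      = (\<Sum>g\<in>R. \<Sum>\<^sub>\<infinity>s. norm (y s * \<xi> (\<pi> s + g)) powr r)"
    using r by (simp add: lp_norm_powr)
  also have "\<dots> = (\<Sum>\<^sub>\<infinity>s. \<Sum>g\<in>R. norm (y s * \<xi> (\<pi> s + g)) powr r)"
    using summ by (intro infsum_finite_sum[symmetric] R) auto
  also have "\<dots> \<le> (\<Sum>\<^sub>\<infinity>s. norm (y s) powr r * lp_norm r \<xi> powr r)"
  proof (rule infsum_mono)
    show "(\<lambda>s. \<Sum>g\<in>R. norm (y s * \<xi> (\<pi> s + g)) powr r) summable_on UNIV"
      using summ by (intro summable_on_finite_sum R) auto
    show "(\<lambda>s. norm (y s) powr r * lp_norm r \<xi> powr r) summable_on UNIV"
      by (intro summable_on_cmult_left sy)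
    fix s
    have "(\<Sum>g\<in>R. norm (\<xi> (\<pi> s + g)) powr r) = (\<Sum>x\<in>(\<lambda>g. \<pi> s + g) ` R. norm (\<xi> x) powr r)"
      by (subst sum.reindex) (auto simp: inj_on_def)
    also have "\<dots> \<le> lp_norm r \<xi> powr r"
      using fin_norm_le_lp_norm[OF r \<xi>, of "(\<lambda>g. \<pi> s + g) ` R"] R r by (simp add: fin_norm_le_iff)
    finally show "(\<Sum>g\<in>R. norm (y s * \<xi> (\<pi> s + g)) powr r) \<le> norm (y s) powr r * lp_norm r \<xi> powr r"
      by (simp add: norm_mult powr_mult sum_distrib_left[symmetric] mult_left_mono)
  qed
  also have "\<dots> = lp_norm r y powr r * lp_norm r \<xi> powr r"
    using r by (simp add: infsum_cmult_left' lp_norm_powr)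
  finally show "fin_norm r R (\<lambda>g. complex_of_real (lp_norm r (\<lambda>s. y s * \<xi> (\<pi> s + g)))) \<le> lp_norm r y * lp_norm r \<xi>"
    using r by (subst fin_norm_le_iff) (auto simp: powr_mult)
qed

text \<open>The value that the projective tensor norm minimizes, for the given
  representation.\<close>

definition nuclear_bound :: "real \<Rightarrow> (nat \<Rightarrow> 'g \<Rightarrow> complex) \<Rightarrow> (nat \<Rightarrow> 'g \<Rightarrow> complex) \<Rightarrow> real" where
  "nuclear_bound p \<xi> \<eta> = (\<Sum>n. lp_norm (conj_exponent p) (\<xi> n) * lp_norm p (\<eta> n))"

lemma infsum_le_finite_sums_nonneg:
  fixes f :: "'a \<Rightarrow> real"
  assumes "\<And>x. 0 \<le> f x" "\<And>F. finite F \<Longrightarrow> sum f F \<le> B"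
  shows "f summable_on UNIV" "infsum f UNIV \<le> B"
proof -
  show "f summable_on UNIV"
    by (rule nonneg_bdd_above_summable_on) (auto simp: bdd_above_def assms intro!: exI[of _ B])
  then show "infsum f UNIV \<le> B" by (rule infsum_le_finite_sums) (simp add: assms)
qed

context lp_exponent
begin

lemma nuclear_dataD:
  assumes "nuclear_data p \<xi> \<eta>"
  shows "\<xi> n \<in> lp q UNIV" "\<eta> n \<in> lp p UNIV" "summable (\<lambda>n. lp_norm q (\<xi> n) * lp_norm p (\<eta> n))"
  using assms by (auto simp: nuclear_data_def)

lemma nuclear_data_fin_sum_le:
  assumes "nuclear_data p \<xi> \<eta>" "finite A"
  shows "(\<Sum>n\<in>A. lp_norm q (\<xi> n) * lp_norm p (\<eta> n)) \<le> nuclear_bound p \<xi> \<eta>"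
  unfolding nuclear_bound_def using nuclear_dataD(3)[OF assms(1)] assms(2) by (intro sum_le_suminf) auto

lemma nuclear_bound_nonneg: "nuclear_data p \<xi> \<eta> \<Longrightarrow> 0 \<le> nuclear_bound p \<xi> \<eta>"
  using nuclear_data_fin_sum_le[of \<xi> \<eta> "{}"] by simp

text \<open>For fixed \<open>n\<close>, Hoelder's inequality over the translations \<open>r\<close>
  combines the two estimates of \<open>fin_norm_times_translates\<close>; summing over
  \<open>n\<close> gives the nuclear bound. The weight \<open>w\<close> is the dominating series for
  the double sums below.\<close>

lemma
  fixes \<xi> \<eta> :: "nat \<Rightarrow> 'g::group_add \<Rightarrow> complex" and \<pi> \<rho> :: "'i \<Rightarrow> 'g"
  assumes nd: "nuclear_data p \<xi> \<eta>" and y: "y \<in> lp q UNIV" and z: "z \<in> lp p UNIV"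
  defines "w \<equiv> \<lambda>(n, r). lp_norm q (\<lambda>s. y s * \<xi> n (\<pi> s + r)) * lp_norm p (\<lambda>s. z s * \<eta> n (\<rho> s + r))"
  shows translates_summable: "w summable_on UNIV"
    and translates_infsum_le: "infsum w UNIV \<le> nuclear_bound p \<xi> \<eta> * (lp_norm q y * lp_norm p z)"
proof -
  have "sum w F \<le> nuclear_bound p \<xi> \<eta> * (lp_norm q y * lp_norm p z)" if F: "finite F" for F
  proof -
    define A where "A = fst ` F"
    define B where "B = snd ` F"
    have AB: "finite A" "finite B" using F by (auto simp: A_def B_def)
    have "sum w F \<le> sum w (A \<times> B)"
      using AB subset_fst_snd[of F] by (intro sum_mono2) (auto simp: w_def A_def B_def)
    also have "\<dots> = (\<Sum>n\<in>A. \<Sum>r\<in>B. w (n, r))" by (simp add: sum.cartesian_product)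
    also have "\<dots> \<le> (\<Sum>n\<in>A. (lp_norm q (\<xi> n) * lp_norm p (\<eta> n)) * (lp_norm q y * lp_norm p z))"
    proof (rule sum_mono)
      fix n
      let ?a = "\<lambda>r. complex_of_real (lp_norm q (\<lambda>s. y s * \<xi> n (\<pi> s + r)))"
      let ?b = "\<lambda>r. complex_of_real (lp_norm p (\<lambda>s. z s * \<eta> n (\<rho> s + r)))"
      have "(\<Sum>r\<in>B. w (n, r)) = (\<Sum>r\<in>B. norm (?a r) * norm (?b r))" by (simp add: w_def)
      also have "\<dots> \<le> fin_norm q B ?a * fin_norm p B ?b" by (rule fin_norm_holder[OF p_gt_1 AB(2)])
      also have "\<dots> \<le> (lp_norm q y * lp_norm q (\<xi> n)) * (lp_norm p z * lp_norm p (\<eta> n))"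
        using fin_norm_times_translates[OF q_gt_1 y nuclear_dataD(1)[OF nd] AB(2), where \<pi> = \<pi>]
          fin_norm_times_translates[OF p_gt_1 z nuclear_dataD(2)[OF nd] AB(2), where \<pi> = \<rho>]
        by (intro mult_mono) auto
      finally show "(\<Sum>r\<in>B. w (n, r)) \<le> (lp_norm q (\<xi> n) * lp_norm p (\<eta> n)) * (lp_norm q y * lp_norm p z)"
        by (simp add: mult_ac)
    qed
    also have "\<dots> = (\<Sum>n\<in>A. lp_norm q (\<xi> n) * lp_norm p (\<eta> n)) * (lp_norm q y * lp_norm p z)"
      by (simp add: sum_distrib_right)
    also have "\<dots> \<le> nuclear_bound p \<xi> \<eta> * (lp_norm q y * lp_norm p z)"
      by (intro mult_right_mono nuclear_data_fin_sum_le nd AB) auto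
    finally show ?thesis .
  qed
  moreover have "0 \<le> w x" for x by (cases x) (simp add: w_def)
  ultimately show "w summable_on UNIV" "infsum w UNIV \<le> nuclear_bound p \<xi> \<eta> * (lp_norm q y * lp_norm p z)"
    using infsum_le_finite_sums_nonneg[of w] by blast+
qed

text \<open>The ordered series of the definition converges absolutely, hence is an unordered sum
  that may be reindexed and regrouped.\<close>

lemma nuclear_functional_infsum:
  fixes \<xi> \<eta> :: "nat \<Rightarrow> 'g \<Rightarrow> complex"
  assumes nd: "nuclear_data p \<xi> \<eta>" and T: "bounded_op p UNIV T"
  shows "(\<lambda>n. norm (pairing (\<xi> n) (T (\<eta> n)))) summable_on UNIV"
    and "summable (\<lambda>n. norm (pairing (\<xi> n) (T (\<eta> n))))"
    and "nuclear_functional \<xi> \<eta> T = (\<Sum>\<^sub>\<infinity>n. pairing (\<xi> n) (T (\<eta> n)))"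
    and "norm (nuclear_functional \<xi> \<eta> T) \<le> op_norm p UNIV T * nuclear_bound p \<xi> \<eta>"
proof -
  have le: "norm (pairing (\<xi> n) (T (\<eta> n))) \<le> op_norm p UNIV T * (lp_norm q (\<xi> n) * lp_norm p (\<eta> n))" for n
  proof -
    have "norm (pairing (\<xi> n) (T (\<eta> n))) \<le> lp_norm q (\<xi> n) * lp_norm p (T (\<eta> n))"
      by (rule norm_pairing_le[OF p_gt_1 nuclear_dataD(1)[OF nd] bounded_op_lp[OF T nuclear_dataD(2)[OF nd]]])
    also have "\<dots> \<le> lp_norm q (\<xi> n) * (op_norm p UNIV T * lp_norm p (\<eta> n))"
      by (intro mult_left_mono bounded_op_le T nuclear_dataD[OF nd] lp_norm_nonneg)
    finally show ?thesis by (simp add: mult_ac)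
  qed
  have s: "summable (\<lambda>n. op_norm p UNIV T * (lp_norm q (\<xi> n) * lp_norm p (\<eta> n)))"
    by (intro summable_mult nuclear_dataD[OF nd])
  show 1: "summable (\<lambda>n. norm (pairing (\<xi> n) (T (\<eta> n))))"
    by (rule summable_comparison_test'[OF s, of 0]) (simp add: le)
  then show 2: "(\<lambda>n. norm (pairing (\<xi> n) (T (\<eta> n)))) summable_on UNIV"
    by (simp add: summable_on_UNIV_nonneg_real_iff)
  show "nuclear_functional \<xi> \<eta> T = (\<Sum>\<^sub>\<infinity>n. pairing (\<xi> n) (T (\<eta> n)))"
    unfolding nuclear_functional_def
    by (rule sums_unique[OF has_sum_imp_sums[OF has_sum_infsum[OF abs_summable_summable[OF 2]]], symmetric])
  have "norm (nuclear_functional \<xi> \<eta> T) \<le> (\<Sum>n. norm (pairing (\<xi> n) (T (\<eta> n))))"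
    unfolding nuclear_functional_def by (rule summable_norm[OF 1])
  also have "\<dots> \<le> (\<Sum>n. op_norm p UNIV T * (lp_norm q (\<xi> n) * lp_norm p (\<eta> n)))"
    by (rule suminf_le[OF le 1 s])
  also have "\<dots> = op_norm p UNIV T * nuclear_bound p \<xi> \<eta>"
    unfolding nuclear_bound_def by (rule suminf_mult[OF nuclear_dataD(3)[OF nd]])
  finally show "norm (nuclear_functional \<xi> \<eta> T) \<le> op_norm p UNIV T * nuclear_bound p \<xi> \<eta>" .
qed

lemma left_reg_apply: "f \<in> lp p UNIV \<Longrightarrow> left_reg p s f = (\<lambda>t. f (- s + t))"
  by (simp add: left_reg_def)

lemma left_reg_in_lp_ops: "left_reg p s \<in> lp_ops p UNIV"
proof -
  have "bounded_op p UNIV (left_reg p s)"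
    by (rule bounded_opI[where C = 1])
       (auto simp: left_reg_apply lp_add[OF p_gt_1] lp_scale[OF p_gt_1] lp_bij[OF bij_add_left] lp_norm_bij[OF bij_add_left])
  then show ?thesis by (simp add: lp_ops_iff left_reg_def)
qed

lemma entry_left_reg: "entry (left_reg p s) a b = (if a = s + b then 1 else 0)"
proof -
  have "- s + a = b \<longleftrightarrow> a = s + b" by (metis add.assoc add_0 left_minus minus_add_cancel)
  then show ?thesis by (simp add: entry_def left_reg_apply delta_in_lp[OF p_gt_1]) (simp add: delta_def)
qed

text \<open>Substituting \<open>t = g + r\<close> in the pairing writes the value at
  \<open>g - h\<close> as a sum of products of a factor in \<open>g\<close> and a factor in
  \<open>h\<close>. This factorization is what makes coefficient functions Schur
  multipliers.\<close>

lemma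
  fixes \<xi> \<eta> :: "nat \<Rightarrow> 'g::group_add \<Rightarrow> complex"
  assumes nd: "nuclear_data p \<xi> \<eta>"
  shows coefficient_summable: "(\<lambda>(n, r). norm (\<xi> n (g + r) * \<eta> n (h + r))) summable_on UNIV"
    and coefficient_diff: "coefficient p \<xi> \<eta> (g - h) = (\<Sum>\<^sub>\<infinity>(n, r). \<xi> n (g + r) * \<eta> n (h + r))"
proof -
  \<comment> \<open>The translate estimates over a one-point index set, with \<open>\<pi>\<close>
    constantly \<open>g\<close> and \<open>\<rho>\<close> constantly \<open>h\<close>, give the
    summability of the plain products.\<close>
  have d: "(\<lambda>_ :: unit. 1) \<in> lp r UNIV" for r by (simp add: lp_def UNIV_unit)
  have n1: "lp_norm r (\<lambda>_ :: unit. c) = norm c" if "1 < r" for r c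
    using that by (simp add: lp_norm_def UNIV_unit powr_powr)
  show 1: "(\<lambda>(n, r). norm (\<xi> n (g + r) * \<eta> n (h + r))) summable_on UNIV"
    using translates_summable[OF nd d d, where \<pi> = "\<lambda>_. g" and \<rho> = "\<lambda>_. h"]
    by (simp add: n1 q_gt_1 p_gt_1 norm_mult)
  have s: "(\<lambda>x. case x of (n, r) \<Rightarrow> \<xi> n (g + r) * \<eta> n (h + r)) summable_on UNIV \<times> UNIV"
    by (rule abs_summable_summable) (use 1 in \<open>simp add: case_prod_unfold\<close>)
  have "coefficient p \<xi> \<eta> (g - h) = (\<Sum>\<^sub>\<infinity>n. pairing (\<xi> n) (left_reg p (g - h) (\<eta> n)))"
    unfolding coefficient_def by (rule nuclear_functional_infsum[OF nd bounded_op_if_lp_ops[OF left_reg_in_lp_ops]])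
  also have "\<dots> = (\<Sum>\<^sub>\<infinity>n. \<Sum>\<^sub>\<infinity>r. \<xi> n (g + r) * \<eta> n (h + r))"
  proof (rule infsum_cong)
    fix n
    have "pairing (\<xi> n) (left_reg p (g - h) (\<eta> n)) = (\<Sum>\<^sub>\<infinity>t. \<xi> n t * \<eta> n (h - g + t))"
      by (simp add: pairing_def left_reg_apply nuclear_dataD[OF nd])
    also have "\<dots> = (\<Sum>\<^sub>\<infinity>r. \<xi> n (g + r) * \<eta> n (h - g + (g + r)))"
      by (rule infsum_reindex_bij_betw[OF bij_add_left, symmetric])
    also have "\<dots> = (\<Sum>\<^sub>\<infinity>r. \<xi> n (g + r) * \<eta> n (h + r))" by (simp add: add.assoc[symmetric])
    finally show "pairing (\<xi> n) (left_reg p (g - h) (\<eta> n)) = (\<Sum>\<^sub>\<infinity>r. \<xi> n (g + r) * \<eta> n (h + r))" .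
  qed
  also have "\<dots> = (\<Sum>\<^sub>\<infinity>(n, r). \<xi> n (g + r) * \<eta> n (h + r))"
    using infsum_Sigma'_banach[OF s] by simp
  finally show "coefficient p \<xi> \<eta> (g - h) = (\<Sum>\<^sub>\<infinity>(n, r). \<xi> n (g + r) * \<eta> n (h + r))" .
qed

lemma coefficient_form:
  fixes \<xi> \<eta> :: "nat \<Rightarrow> 'g::group_add \<Rightarrow> complex" and \<pi> :: "'i \<Rightarrow> 'g"
  assumes nd: "nuclear_data p \<xi> \<eta>" and J: "finite J"
  shows "(\<Sum>s\<in>J. \<Sum>t\<in>J. y s * (coefficient p \<xi> \<eta> (\<pi> s - \<pi> t) * a s t) * z t) =
    (\<Sum>\<^sub>\<infinity>(n, r). \<Sum>s\<in>J. \<Sum>t\<in>J. (y s * \<xi> n (\<pi> s + r)) * a s t * (z t * \<eta> n (\<pi> t + r)))"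
proof -
  have s: "(\<lambda>(n, r). \<xi> n (g + r) * \<eta> n (h + r)) summable_on UNIV" for g h
    by (rule abs_summable_summable) (use coefficient_summable[OF nd] in \<open>simp add: case_prod_unfold\<close>)
  have s': "(\<lambda>(n, r). (y s * \<xi> n (\<pi> s + r)) * a s t * (z t * \<eta> n (\<pi> t + r))) summable_on UNIV" for s t
    using summable_on_cmult_right[OF s[of "\<pi> s" "\<pi> t"], of "y s * a s t * z t"] by (simp add: case_prod_unfold mult_ac)
  have "y s * (coefficient p \<xi> \<eta> (\<pi> s - \<pi> t) * a s t) * z t =
      (\<Sum>\<^sub>\<infinity>(n, r). (y s * \<xi> n (\<pi> s + r)) * a s t * (z t * \<eta> n (\<pi> t + r)))" for s t
    using infsum_cmult_right[OF s[of "\<pi> s" "\<pi> t"], of "y s * a s t * z t"]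
    by (simp add: coefficient_diff[OF nd] case_prod_unfold mult_ac)
  then have "(\<Sum>s\<in>J. \<Sum>t\<in>J. y s * (coefficient p \<xi> \<eta> (\<pi> s - \<pi> t) * a s t) * z t) =
      (\<Sum>s\<in>J. \<Sum>t\<in>J. \<Sum>\<^sub>\<infinity>(n, r). (y s * \<xi> n (\<pi> s + r)) * a s t * (z t * \<eta> n (\<pi> t + r)))"
    by simp
  also have "\<dots> = (\<Sum>\<^sub>\<infinity>x. \<Sum>s\<in>J. \<Sum>t\<in>J. case x of (n, r) \<Rightarrow> (y s * \<xi> n (\<pi> s + r)) * a s t * (z t * \<eta> n (\<pi> t + r)))"
    using s' by (simp add: infsum_finite_sum summable_on_finite_sum J)
  also have "\<dots> = (\<Sum>\<^sub>\<infinity>(n, r). \<Sum>s\<in>J. \<Sum>t\<in>J. (y s * \<xi> n (\<pi> s + r)) * a s t * (z t * \<eta> n (\<pi> t + r)))"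
    by (simp add: case_prod_unfold)
  finally show ?thesis .
qed

text \<open>In \<open>coefficient_form\<close> the multiplier has moved from the matrix to the test
  vectors, so the bound for \<open>a\<close> applies to each pair \<open>(n, r)\<close>, and
  \<open>translates_infsum_le\<close> sums these bounds. The map \<open>\<pi>\<close> lets the
  multiplier act through one coordinate only, as block matrices and product groups require.\<close>

lemma mat_bound_coefficient:
  fixes \<xi> \<eta> :: "nat \<Rightarrow> 'g::group_add \<Rightarrow> complex" and \<pi> :: "'i \<Rightarrow> 'g"
  assumes nd: "nuclear_data p \<xi> \<eta>" and a: "mat_bound p I a C"
  shows "mat_bound p I (\<lambda>s t. coefficient p \<xi> \<eta> (\<pi> s - \<pi> t) * a s t) (C * nuclear_bound p \<xi> \<eta>)"
proof (rule mat_boundI)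
  note C = mat_bound_nonneg[OF a]
  show "0 \<le> C * nuclear_bound p \<xi> \<eta>" using C nuclear_bound_nonneg[OF nd] by simp
  fix J and y z :: "'i \<Rightarrow> complex" assume J: "finite J" "J \<subseteq> I"
  define y' where "y' s = (if s \<in> J then y s else 0)" for s
  define z' where "z' s = (if s \<in> J then z s else 0)" for s
  have ny: "y' \<in> lp q UNIV" "lp_norm q y' = fin_norm q J y"
    using lp_finite_support[OF q_gt_1 J(1), of y'] by (auto simp: y'_def lp_iff_UNIV[of _ _ J] cong: fin_norm_cong)
  have nz: "z' \<in> lp p UNIV" "lp_norm p z' = fin_norm p J z"
    using lp_finite_support[OF p_gt_1 J(1), of z'] by (auto simp: z'_def lp_iff_UNIV[of _ _ J] cong: fin_norm_cong)
  define w where "w = (\<lambda>(n, r). lp_norm q (\<lambda>s. y' s * \<xi> n (\<pi> s + r)) * lp_norm p (\<lambda>s. z' s * \<eta> n (\<pi> s + r)))"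
  have ws: "w summable_on UNIV" "infsum w UNIV \<le> nuclear_bound p \<xi> \<eta> * (fin_norm q J y * fin_norm p J z)"
    using translates_summable[OF nd ny(1) nz(1), where \<pi> = \<pi> and \<rho> = \<pi>] translates_infsum_le[OF nd ny(1) nz(1), where \<pi> = \<pi> and \<rho> = \<pi>]
    by (simp_all add: w_def ny(2) nz(2))
  define v where "v = (\<lambda>(n, r). \<Sum>s\<in>J. \<Sum>t\<in>J. (y' s * \<xi> n (\<pi> s + r)) * a s t * (z' t * \<eta> n (\<pi> t + r)))"
  have vw: "norm (v x) \<le> C * w x" for x
  proof -
    obtain n r where x: "x = (n, r)" by (cases x)
    have "norm (v x) \<le> C * fin_norm q J (\<lambda>s. y' s * \<xi> n (\<pi> s + r)) * fin_norm p J (\<lambda>s. z' s * \<eta> n (\<pi> s + r))"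
      unfolding x v_def prod.case by (rule mat_boundD[OF a J])
    also have "\<dots> = C * w x"
      using lp_finite_support(2)[OF q_gt_1 J(1), of "\<lambda>s. y' s * \<xi> n (\<pi> s + r)"]
        lp_finite_support(2)[OF p_gt_1 J(1), of "\<lambda>s. z' s * \<eta> n (\<pi> s + r)"]
      by (simp add: x w_def y'_def z'_def)
    finally show ?thesis .
  qed
  have "(\<Sum>s\<in>J. \<Sum>t\<in>J. y s * (coefficient p \<xi> \<eta> (\<pi> s - \<pi> t) * a s t) * z t) =
      (\<Sum>s\<in>J. \<Sum>t\<in>J. y' s * (coefficient p \<xi> \<eta> (\<pi> s - \<pi> t) * a s t) * z' t)"
    by (intro sum.cong refl) (simp add: y'_def z'_def)
  also have "\<dots> = infsum v UNIV" unfolding v_def by (rule coefficient_form[OF nd J(1)])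
  finally have eq: "(\<Sum>s\<in>J. \<Sum>t\<in>J. y s * (coefficient p \<xi> \<eta> (\<pi> s - \<pi> t) * a s t) * z t) = infsum v UNIV" .
  have "norm (infsum v UNIV) \<le> C * infsum w UNIV"
    by (rule norm_infsum_le[OF has_sum_infsum has_sum_cmult_right[OF has_sum_infsum[OF ws(1)]] vw])
       (rule abs_summable_summable, rule summable_on_comparison_test[OF summable_on_cmult_right[OF ws(1), of C] vw], auto)
  also have "\<dots> \<le> C * (nuclear_bound p \<xi> \<eta> * (fin_norm q J y * fin_norm p J z))"
    by (intro mult_left_mono ws C)
  finally show "norm (\<Sum>s\<in>J. \<Sum>t\<in>J. y s * (coefficient p \<xi> \<eta> (\<pi> s - \<pi> t) * a s t) * z t) \<le>
      C * nuclear_bound p \<xi> \<eta> * fin_norm q J y * fin_norm p J z"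
    unfolding eq by (simp add: mult_ac)
qed

end

section \<open>Schur multiplication of operators and its adjoint on trace-class data\<close>

definition schur_mult ::
  "real \<Rightarrow> ('g::group_add \<Rightarrow> complex) \<Rightarrow> (('g \<Rightarrow> complex) \<Rightarrow> ('g \<Rightarrow> complex)) \<Rightarrow> ('g \<Rightarrow> complex) \<Rightarrow> ('g \<Rightarrow> complex)" where
  "schur_mult p u T = mat_op p UNIV (\<lambda>s t. u (s - t) * entry T s t)"

context lp_exponent
begin

text \<open>Both vectors are truncated to finite sets; what remains is
  \<open>D y1 z2 + D y2 z\<close>, which is small by boundedness.\<close>

lemma bilinear_form_eq_0:
  fixes D :: "('i \<Rightarrow> complex) \<Rightarrow> ('i \<Rightarrow> complex) \<Rightarrow> complex"
  assumes addl: "\<And>y y' z. y \<in> lp q UNIV \<Longrightarrow> y' \<in> lp q UNIV \<Longrightarrow> z \<in> lp p UNIV \<Longrightarrow> D (\<lambda>i. y i + y' i) z = D y z + D y' z"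
    and addr: "\<And>y z z'. y \<in> lp q UNIV \<Longrightarrow> z \<in> lp p UNIV \<Longrightarrow> z' \<in> lp p UNIV \<Longrightarrow> D y (\<lambda>i. z i + z' i) = D y z + D y z'"
    and bound: "\<And>y z. y \<in> lp q UNIV \<Longrightarrow> z \<in> lp p UNIV \<Longrightarrow> norm (D y z) \<le> C * (lp_norm q y * lp_norm p z)"
    and C: "0 \<le> C"
    and zero: "\<And>J y z. finite J \<Longrightarrow> (\<And>i. i \<notin> J \<Longrightarrow> y i = 0) \<Longrightarrow> (\<And>i. i \<notin> J \<Longrightarrow> z i = 0) \<Longrightarrow> D y z = 0"
    and y: "y \<in> lp q UNIV" and z: "z \<in> lp p UNIV"
  shows "D y z = 0"
proof -
  \<comment> \<open>Chosen so that the two remainders, each carrying a factor at most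
    \<open>e / M\<close>, add up to \<open>(M - 1) * (e / M)\<close>; the summand 1 keeps
    \<open>M\<close> positive.\<close>
  define M where "M = C * (lp_norm q y + lp_norm p z) + 1"
  have M: "M > 0" using C by (simp add: M_def add_nonneg_pos)
  have "norm (D y z) \<le> 0 + e" if e: "e > 0" for e
  proof -
    have eM: "e / M > 0" using e M by simp
    obtain J1 where J1: "finite J1" "lp_norm q (\<lambda>i. if i \<in> J1 then 0 else y i) < e / M"
      using lp_norm_restrict_complement[OF q_gt_1 y eM] by metis
    obtain J2 where J2: "finite J2" "lp_norm p (\<lambda>i. if i \<in> J2 then 0 else z i) < e / M"
      using lp_norm_restrict_complement[OF p_gt_1 z eM] by metis
    define y1 where "y1 i = (if i \<in> J1 then y i else 0)" for i
    define y2 where "y2 i = (if i \<in> J1 then 0 else y i)" for i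
    define z1 where "z1 i = (if i \<in> J2 then z i else 0)" for i
    define z2 where "z2 i = (if i \<in> J2 then 0 else z i)" for i
    have mem: "y1 \<in> lp q UNIV" "y2 \<in> lp q UNIV" "z1 \<in> lp p UNIV" "z2 \<in> lp p UNIV"
      by (rule lp_dominated[OF q_gt_1 y] lp_dominated[OF p_gt_1 z]; simp add: y1_def y2_def z1_def z2_def)+
    have ny1: "lp_norm q y1 \<le> lp_norm q y" by (rule lp_norm_dominated[OF q_gt_1 y]) (simp add: y1_def)
    have n2: "lp_norm q y2 \<le> e / M" "lp_norm p z2 \<le> e / M"
      using J1(2) J2(2) unfolding y2_def[abs_def] z2_def[abs_def] by simp_all
    have ye: "y = (\<lambda>i. y1 i + y2 i)" and ze: "z = (\<lambda>i. z1 i + z2 i)"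
      by (auto simp: y1_def y2_def z1_def z2_def)
    have "D y z = D y1 z + D y2 z" using addl[OF mem(1,2) z] ye by simp
    also have "D y1 z = D y1 z1 + D y1 z2" using addr[OF mem(1,3,4)] ze by simp
    also have "D y1 z1 = 0"
      by (rule zero[of "J1 \<union> J2"]) (auto simp: J1 J2 y1_def z1_def)
    finally have "norm (D y z) \<le> norm (D y1 z2) + norm (D y2 z)" by (simp add: norm_triangle_ineq)
    also have "\<dots> \<le> C * (lp_norm q y1 * lp_norm p z2) + C * (lp_norm q y2 * lp_norm p z)"
      by (intro add_mono bound mem z)
    also have "\<dots> \<le> C * (lp_norm q y * (e / M)) + C * ((e / M) * lp_norm p z)"
      using n2 ny1 eM by (intro add_mono mult_left_mono C mult_mono) auto
    also have "\<dots> = C * (lp_norm q y + lp_norm p z) * (e / M)" by (simp add: algebra_simps add_divide_distrib)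
    also have "\<dots> = (M - 1) * (e / M)" by (simp add: M_def)
    also have "\<dots> \<le> M * (e / M)" using eM by (intro mult_right_mono) auto
    finally show ?thesis using M by simp
  qed
  then have "norm (D y z) \<le> 0" by (rule field_le_epsilon)
  then show ?thesis by simp
qed

lemma pairing_add_left:
  assumes "y \<in> lp q UNIV" "y' \<in> lp q UNIV" "z \<in> lp p UNIV"
  shows "pairing (\<lambda>i. y i + y' i) z = pairing y z + pairing y' z"
  using infsum_add[OF abs_summable_summable[OF holder_abs_summable[OF p_gt_1 assms(1,3)]]
      abs_summable_summable[OF holder_abs_summable[OF p_gt_1 assms(2,3)]]]
  by (simp add: pairing_def distrib_right)

lemma pairing_add_right:
  assumes "y \<in> lp q UNIV" "z \<in> lp p UNIV" "z' \<in> lp p UNIV"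
  shows "pairing y (\<lambda>i. z i + z' i) = pairing y z + pairing y z'"
  using infsum_add[OF abs_summable_summable[OF holder_abs_summable[OF p_gt_1 assms(1,2)]]
      abs_summable_summable[OF holder_abs_summable[OF p_gt_1 assms(1,3)]]]
  by (simp add: pairing_def distrib_left)

lemma pairing_scale_right:
  assumes "y \<in> lp q UNIV" "z \<in> lp p UNIV"
  shows "pairing y (\<lambda>i. c * z i) = c * pairing y z"
  using infsum_cmult_right[OF abs_summable_summable[OF holder_abs_summable[OF p_gt_1 assms]], of c]
  by (simp add: pairing_def mult_ac)

lemma pairing_finite_support:
  assumes T: "bounded_op p UNIV T" and J: "finite J"
    and 0: "\<And>i. i \<notin> J \<Longrightarrow> y i = 0" "\<And>i. i \<notin> J \<Longrightarrow> z i = 0"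
  shows "pairing y (T z) = (\<Sum>s\<in>J. \<Sum>t\<in>J. y s * entry T s t * z t)"
proof -
  have z: "z \<in> lp p UNIV" using lp_finite_support(1)[OF p_gt_1 J 0(2)] by (simp add: lp_iff_UNIV[of _ _ J])
  have "T z s = (\<Sum>t\<in>J. entry T s t * z t)" for s
  proof -
    have "T z s = (\<Sum>\<^sub>\<infinity>t. entry T s t * z t)" by (rule bounded_op_apply[OF T z UNIV_I])
    also have "\<dots> = (\<Sum>\<^sub>\<infinity>t\<in>J. entry T s t * z t)" by (rule infsum_cong_neutral) (auto simp: 0)
    finally show ?thesis using J by simp
  qed
  moreover have "pairing y (T z) = (\<Sum>\<^sub>\<infinity>s\<in>J. y s * T z s)"
    unfolding pairing_def by (rule infsum_cong_neutral) (auto simp: 0)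
  ultimately show ?thesis using J by (simp add: sum_distrib_left mult_ac)
qed

lemma norm_pairing_op_le:
  assumes "bounded_op p UNIV T" "y \<in> lp q UNIV" "z \<in> lp p UNIV"
  shows "norm (pairing y (T z)) \<le> op_norm p UNIV T * (lp_norm q y * lp_norm p z)"
proof -
  have "norm (pairing y (T z)) \<le> lp_norm q y * lp_norm p (T z)"
    by (rule norm_pairing_le[OF p_gt_1 assms(2) bounded_op_lp[OF assms(1,3)]])
  also have "\<dots> \<le> lp_norm q y * (op_norm p UNIV T * lp_norm p z)"
    by (intro mult_left_mono bounded_op_le assms lp_norm_nonneg)
  finally show ?thesis by (simp add: mult_ac)
qed

lemma mat_bound_schur_mult:
  fixes \<xi> \<eta> :: "nat \<Rightarrow> 'g::group_add \<Rightarrow> complex"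
  assumes "nuclear_data p \<xi> \<eta>" "bounded_op p UNIV T"
  shows "mat_bound p UNIV (\<lambda>s t. coefficient p \<xi> \<eta> (s - t) * entry T s t) (op_norm p UNIV T * nuclear_bound p \<xi> \<eta>)"
  using mat_bound_coefficient[OF assms(1) mat_bound_entry[OF assms(2)], where \<pi> = "\<lambda>x. x"] .

lemma schur_mult_in_lp_ops:
  fixes \<xi> \<eta> :: "nat \<Rightarrow> 'g::group_add \<Rightarrow> complex"
  assumes "nuclear_data p \<xi> \<eta>" "bounded_op p UNIV T"
  shows "schur_mult p (coefficient p \<xi> \<eta>) T \<in> lp_ops p UNIV"
  unfolding schur_mult_def by (rule mat_op_in_lp_ops[OF mat_bound_schur_mult[OF assms]])

lemma entry_schur_mult: "entry (schur_mult p u T) s t = u (s - t) * entry T s t"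
  by (simp add: schur_mult_def entry_mat_op)

text \<open>On finitely supported vectors this is \<open>coefficient_form\<close>; both sides are
  bounded bilinear forms in \<open>y\<close> and \<open>z\<close>, so
  \<open>bilinear_form_eq_0\<close> extends it. General vectors must be covered because trace-class
  data are not finitely supported.\<close>

lemma pairing_schur_mult:
  fixes \<xi> \<eta> :: "nat \<Rightarrow> 'g::group_add \<Rightarrow> complex"
  assumes nd: "nuclear_data p \<xi> \<eta>" and X: "bounded_op p UNIV X"
    and y: "y \<in> lp q UNIV" and z: "z \<in> lp p UNIV"
  defines "P \<equiv> \<lambda>y z (n, r). pairing (\<lambda>s. y s * \<xi> n (s + r)) (X (\<lambda>s. z s * \<eta> n (s + r)))"
  shows "pairing y (schur_mult p (coefficient p \<xi> \<eta>) X z) = infsum (P y z) UNIV"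
proof -
  let ?U = "schur_mult p (coefficient p \<xi> \<eta>) X"
  define w where "w y z = (\<lambda>(n, r). lp_norm q (\<lambda>s. y s * \<xi> n (s + r)) * lp_norm p (\<lambda>s. z s * \<eta> n (s + r)))" for y z
  let ?N = "op_norm p UNIV X"
  let ?K = "nuclear_bound p \<xi> \<eta>"
  note N = op_norm_nonneg[OF X]
  have ws: "w y z summable_on UNIV" "infsum (w y z) UNIV \<le> ?K * (lp_norm q y * lp_norm p z)"
    if "y \<in> lp q UNIV" "z \<in> lp p UNIV" for y z
    unfolding w_def by (rule translates_summable[OF nd that, where \<pi> = "\<lambda>x. x" and \<rho> = "\<lambda>x. x"]
        translates_infsum_le[OF nd that, where \<pi> = "\<lambda>x. x" and \<rho> = "\<lambda>x. x"])+
  have tr: "(\<lambda>s. y s * \<xi> n (s + r)) \<in> lp q UNIV" if "y \<in> lp q UNIV" for y n r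
    by (rule lp_times_translate[OF q_gt_1 that nuclear_dataD(1)[OF nd], where \<pi> = "\<lambda>x. x"])
  have tr': "(\<lambda>s. z s * \<eta> n (s + r)) \<in> lp p UNIV" if "z \<in> lp p UNIV" for z n r
    by (rule lp_times_translate[OF p_gt_1 that nuclear_dataD(2)[OF nd], where \<pi> = "\<lambda>x. x"])
  have Pw: "norm (P y z x) \<le> ?N * w y z x" if "y \<in> lp q UNIV" "z \<in> lp p UNIV" for y z x
    unfolding P_def w_def using norm_pairing_op_le[OF X tr[OF that(1)] tr'[OF that(2)]]
    by (simp add: case_prod_unfold)
  have Pn: "(\<lambda>x. norm (P y z x)) summable_on UNIV" if "y \<in> lp q UNIV" "z \<in> lp p UNIV" for y z
    by (rule summable_on_comparison_test[OF summable_on_cmult_right[OF ws(1)[OF that], of ?N] Pw[OF that]]) simp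
  have Ps: "P y z summable_on UNIV" if "y \<in> lp q UNIV" "z \<in> lp p UNIV" for y z
    by (rule abs_summable_summable[OF Pn[OF that]])
  have Pb: "norm (infsum (P y z) UNIV) \<le> ?N * ?K * (lp_norm q y * lp_norm p z)"
    if "y \<in> lp q UNIV" "z \<in> lp p UNIV" for y z
  proof -
    have "norm (infsum (P y z) UNIV) \<le> ?N * infsum (w y z) UNIV"
      by (rule norm_infsum_le[OF has_sum_infsum[OF Ps[OF that]]
            has_sum_cmult_right[OF has_sum_infsum[OF ws(1)[OF that]]] Pw[OF that]])
    also have "\<dots> \<le> ?N * (?K * (lp_norm q y * lp_norm p z))"
      by (intro mult_left_mono ws that N)
    finally show ?thesis by (simp add: mult_ac)
  qed
  have U: "bounded_op p UNIV ?U"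
    by (rule bounded_op_if_lp_ops[OF schur_mult_in_lp_ops[OF nd X]])
  define D where "D y z = pairing y (?U z) - infsum (P y z) UNIV" for y z
  have "D y z = 0"
  proof (rule bilinear_form_eq_0[OF _ _ _ _ _ y z])
    fix y y' z :: "'g \<Rightarrow> complex" assume h: "y \<in> lp q UNIV" "y' \<in> lp q UNIV" "z \<in> lp p UNIV"
    have "P (\<lambda>i. y i + y' i) z = (\<lambda>x. P y z x + P y' z x)"
      using pairing_add_left[OF tr[OF h(1)] tr[OF h(2)] bounded_op_lp[OF X tr'[OF h(3)]]]
      by (auto simp: P_def distrib_right)
    then show "D (\<lambda>i. y i + y' i) z = D y z + D y' z"
      using pairing_add_left[OF h(1,2) bounded_op_lp[OF U h(3)]] infsum_add[OF Ps[OF h(1,3)] Ps[OF h(2,3)]]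
      by (simp add: D_def)
  next
    fix y z z' :: "'g \<Rightarrow> complex" assume h: "y \<in> lp q UNIV" "z \<in> lp p UNIV" "z' \<in> lp p UNIV"
    have "P y (\<lambda>i. z i + z' i) = (\<lambda>x. P y z x + P y z' x)"
      using pairing_add_right[OF tr[OF h(1)] bounded_op_lp[OF X tr'[OF h(2)]] bounded_op_lp[OF X tr'[OF h(3)]]]
      by (auto simp: P_def distrib_right bounded_op_add[OF X tr'[OF h(2)] tr'[OF h(3)]])
    then show "D y (\<lambda>i. z i + z' i) = D y z + D y z'"
      using pairing_add_right[OF h(1) bounded_op_lp[OF U h(2)] bounded_op_lp[OF U h(3)]]
        infsum_add[OF Ps[OF h(1,2)] Ps[OF h(1,3)]]
      by (simp add: D_def bounded_op_add[OF U h(2,3)])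
  next
    fix y z :: "'g \<Rightarrow> complex" assume h: "y \<in> lp q UNIV" "z \<in> lp p UNIV"
    have "norm (D y z) \<le> norm (pairing y (?U z)) + norm (infsum (P y z) UNIV)"
      unfolding D_def by (rule norm_triangle_ineq4)
    also have "\<dots> \<le> op_norm p UNIV ?U * (lp_norm q y * lp_norm p z) + ?N * ?K * (lp_norm q y * lp_norm p z)"
      by (intro add_mono norm_pairing_op_le U h Pb)
    finally show "norm (D y z) \<le> (op_norm p UNIV ?U + ?N * ?K) * (lp_norm q y * lp_norm p z)"
      by (simp add: algebra_simps)
  next
    show "0 \<le> op_norm p UNIV ?U + ?N * ?K"
      using op_norm_nonneg[OF U] N nuclear_bound_nonneg[OF nd] by simp
  next
    fix J and y z :: "'g \<Rightarrow> complex"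
    assume J: "finite J" and 0: "\<And>i. i \<notin> J \<Longrightarrow> y i = 0" "\<And>i. i \<notin> J \<Longrightarrow> z i = 0"
    have "pairing y (?U z) = (\<Sum>s\<in>J. \<Sum>t\<in>J. y s * (coefficient p \<xi> \<eta> (s - t) * entry X s t) * z t)"
      by (simp add: pairing_finite_support[OF U J 0] entry_schur_mult)
    also have "\<dots> = (\<Sum>\<^sub>\<infinity>(n, r). \<Sum>s\<in>J. \<Sum>t\<in>J. (y s * \<xi> n (s + r)) * entry X s t * (z t * \<eta> n (t + r)))"
      by (rule coefficient_form[OF nd J, where \<pi> = "\<lambda>x. x"])
    also have "\<dots> = infsum (P y z) UNIV"
    proof (rule infsum_cong)
      fix x :: "nat \<times> 'g"
      obtain n r where x: "x = (n, r)" by (cases x)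
      have "pairing (\<lambda>s. y s * \<xi> n (s + r)) (X (\<lambda>s. z s * \<eta> n (s + r))) =
          (\<Sum>s\<in>J. \<Sum>t\<in>J. (y s * \<xi> n (s + r)) * entry X s t * (z t * \<eta> n (t + r)))"
        by (rule pairing_finite_support[OF X J]) (simp_all add: 0)
      then show "(case x of (n, r) \<Rightarrow> \<Sum>s\<in>J. \<Sum>t\<in>J. (y s * \<xi> n (s + r)) * entry X s t * (z t * \<eta> n (t + r))) = P y z x"
        by (simp add: P_def x)
    qed
    finally show "D y z = 0" by (simp add: D_def)
  qed
  then show ?thesis by (simp add: D_def)
qed

text \<open>Constructions produce families indexed by pairs, triples or group elements, while
  \<open>nuclear_data\<close> is indexed by naturals; positions outside the range of the enumeration
  receive zero vectors.\<close>

lemma nuclear_data_of_countable: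
  fixes \<Xi> H :: "'k \<Rightarrow> 'g \<Rightarrow> complex"
  assumes ct: "countable (UNIV :: 'k set)"
    and \<Xi>: "\<And>k. \<Xi> k \<in> lp q UNIV" and H: "\<And>k. H k \<in> lp p UNIV"
    and summ: "(\<lambda>k. lp_norm q (\<Xi> k) * lp_norm p (H k)) summable_on UNIV"
  obtains \<xi> \<eta> where "nuclear_data p \<xi> \<eta>"
    "\<And>X. bounded_op p UNIV X \<Longrightarrow> nuclear_functional \<xi> \<eta> X = (\<Sum>\<^sub>\<infinity>k. pairing (\<Xi> k) (X (H k)))"
proof -
  define e where "e = to_nat_on (UNIV :: 'k set)"
  have e: "inj e" unfolding e_def by (rule inj_on_to_nat_on[OF ct])
  define \<xi> where "\<xi> m = (if m \<in> range e then \<Xi> (inv e m) else (\<lambda>_. 0))" for m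
  define \<eta> where "\<eta> m = (if m \<in> range e then H (inv e m) else (\<lambda>_. 0))" for m
  have \<xi>e: "\<xi> (e k) = \<Xi> k" and \<eta>e: "\<eta> (e k) = H k" for k
    using e by (auto simp: \<xi>_def \<eta>_def)
  have "(\<lambda>m. lp_norm q (\<xi> m) * lp_norm p (\<eta> m)) summable_on range e"
    using summ by (simp add: summable_on_reindex[OF e] o_def \<xi>e \<eta>e)
  then have "(\<lambda>m. lp_norm q (\<xi> m) * lp_norm p (\<eta> m)) summable_on UNIV"
    by (rule summable_on_cong_neutral[THEN iffD1, rotated -1]) (auto simp: \<xi>_def)
  then have "summable (\<lambda>m. lp_norm q (\<xi> m) * lp_norm p (\<eta> m))"
    by (rule summable_on_imp_summable)
  then have nd: "nuclear_data p \<xi> \<eta>"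
    by (auto simp: nuclear_data_def \<xi>_def \<eta>_def \<Xi> H)
  have "nuclear_functional \<xi> \<eta> X = (\<Sum>\<^sub>\<infinity>k. pairing (\<Xi> k) (X (H k)))" if X: "bounded_op p UNIV X" for X
  proof -
    have "nuclear_functional \<xi> \<eta> X = (\<Sum>\<^sub>\<infinity>n. pairing (\<xi> n) (X (\<eta> n)))"
      by (rule nuclear_functional_infsum(3)[OF nd X])
    also have "\<dots> = (\<Sum>\<^sub>\<infinity>n\<in>range e. pairing (\<xi> n) (X (\<eta> n)))"
      by (rule infsum_cong_neutral) (auto simp: \<xi>_def pairing_def)
    also have "\<dots> = (\<Sum>\<^sub>\<infinity>k. pairing (\<Xi> k) (X (H k)))"
      by (simp add: infsum_reindex[OF e] o_def \<xi>e \<eta>e)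
    finally show ?thesis .
  qed
  with nd show thesis by (rule that)
qed

text \<open>Schur multiplication is the adjoint of a map on trace-class data: the new data are the
  vectors \<open>y k\<close> and \<open>z k\<close> multiplied by translates of
  \<open>\<xi> n\<close> and \<open>\<eta> n\<close>, over all \<open>(k, n, r)\<close>. This is the
  weak* continuity of the multiplier.\<close>

lemma nuclear_functional_schur_mult:
  fixes \<xi> \<eta> y z :: "nat \<Rightarrow> 'g::group_add \<Rightarrow> complex"
  assumes ct: "countable (UNIV :: 'g set)" and nd: "nuclear_data p \<xi> \<eta>" and yz: "nuclear_data p y z"
  obtains y' z' where "nuclear_data p y' z'"
    "\<And>X. bounded_op p UNIV X \<Longrightarrow>
       nuclear_functional y z (schur_mult p (coefficient p \<xi> \<eta>) X) = nuclear_functional y' z' X"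
proof -
  define \<Xi> where "\<Xi> = (\<lambda>(k, n, r) s. y k s * \<xi> n (s + r))"
  define H where "H = (\<lambda>(k, n, r) s. z k s * \<eta> n (s + r))"
  let ?K = "nuclear_bound p \<xi> \<eta>"
  define w where "w x = lp_norm q (\<Xi> x) * lp_norm p (H x)" for x
  have w0: "0 \<le> w x" for x by (simp add: w_def)
  have wk: "(\<lambda>x. w (k, x)) summable_on UNIV" "(\<Sum>\<^sub>\<infinity>x. w (k, x)) \<le> ?K * (lp_norm q (y k) * lp_norm p (z k))" for k
    using translates_summable[OF nd nuclear_dataD(1)[OF yz, of k] nuclear_dataD(2)[OF yz, of k], where \<pi> = "\<lambda>x. x" and \<rho> = "\<lambda>x. x"]
      translates_infsum_le[OF nd nuclear_dataD(1)[OF yz, of k] nuclear_dataD(2)[OF yz, of k], where \<pi> = "\<lambda>x. x" and \<rho> = "\<lambda>x. x"]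
    by (simp_all add: w_def \<Xi>_def H_def case_prod_unfold)
  have "sum w F \<le> ?K * nuclear_bound p y z" if F: "finite F" for F
  proof -
    define A where "A = fst ` F"
    define B where "B = snd ` F"
    have AB: "finite A" "finite B" using F by (auto simp: A_def B_def)
    have "sum w F \<le> sum w (A \<times> B)"
      using AB w0 subset_fst_snd[of F] by (intro sum_mono2) (auto simp: A_def B_def)
    also have "\<dots> = (\<Sum>k\<in>A. \<Sum>x\<in>B. w (k, x))" by (simp add: sum.cartesian_product)
    also have "\<dots> \<le> (\<Sum>k\<in>A. ?K * (lp_norm q (y k) * lp_norm p (z k)))"
      using AB w0 by (intro sum_mono order_trans[OF finite_sum_le_infsum wk(2)] wk(1)) auto
    also have "\<dots> = ?K * (\<Sum>k\<in>A. lp_norm q (y k) * lp_norm p (z k))" by (simp add: sum_distrib_left)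
    also have "\<dots> \<le> ?K * nuclear_bound p y z"
      by (intro mult_left_mono nuclear_data_fin_sum_le yz AB nuclear_bound_nonneg nd)
    finally show ?thesis .
  qed
  then have ws: "w summable_on UNIV" by (rule infsum_le_finite_sums_nonneg(1)[OF w0])
  have ct': "countable (UNIV :: (nat \<times> nat \<times> 'g) set)"
    using ct countable_SIGMA[of "UNIV :: nat set" "\<lambda>_. UNIV :: (nat \<times> 'g) set"]
      countable_SIGMA[of "UNIV :: nat set" "\<lambda>_. UNIV :: 'g set"] by simp
  have \<Xi>: "\<Xi> x \<in> lp q UNIV" and H: "H x \<in> lp p UNIV" for x
    using lp_times_translate[OF q_gt_1 nuclear_dataD(1)[OF yz] nuclear_dataD(1)[OF nd], where \<pi> = "\<lambda>x. x"]
      lp_times_translate[OF p_gt_1 nuclear_dataD(2)[OF yz] nuclear_dataD(2)[OF nd], where \<pi> = "\<lambda>x. x"]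
    by (auto simp: \<Xi>_def H_def case_prod_unfold)
  obtain y' z' where nd': "nuclear_data p y' z'"
    and eq: "\<And>X. bounded_op p UNIV X \<Longrightarrow> nuclear_functional y' z' X = (\<Sum>\<^sub>\<infinity>k. pairing (\<Xi> k) (X (H k)))"
    using nuclear_data_of_countable[OF ct' \<Xi> H ws[unfolded w_def]] by metis
  have "nuclear_functional y z (schur_mult p (coefficient p \<xi> \<eta>) X) = nuclear_functional y' z' X"
    if X: "bounded_op p UNIV X" for X
  proof -
    have sn: "(\<lambda>x. norm (pairing (\<Xi> x) (X (H x)))) summable_on UNIV"
      by (rule summable_on_comparison_test[OF summable_on_cmult_right[OF ws, of "op_norm p UNIV X"]])
         (simp_all add: w_def norm_pairing_op_le[OF X \<Xi> H])
    have s: "(\<lambda>(k, x). pairing (\<Xi> (k, x)) (X (H (k, x)))) summable_on UNIV \<times> UNIV"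
      by (rule abs_summable_summable) (use sn in \<open>simp add: case_prod_unfold\<close>)
    have "nuclear_functional y z (schur_mult p (coefficient p \<xi> \<eta>) X) =
        (\<Sum>\<^sub>\<infinity>k. pairing (y k) (schur_mult p (coefficient p \<xi> \<eta>) X (z k)))"
      by (rule nuclear_functional_infsum(3)[OF yz bounded_op_if_lp_ops[OF schur_mult_in_lp_ops[OF nd X]]])
    also have "\<dots> = (\<Sum>\<^sub>\<infinity>k. \<Sum>\<^sub>\<infinity>x. pairing (\<Xi> (k, x)) (X (H (k, x))))"
      by (simp add: pairing_schur_mult[OF nd X nuclear_dataD(1,2)[OF yz]] \<Xi>_def H_def case_prod_unfold)
    also have "\<dots> = (\<Sum>\<^sub>\<infinity>x. pairing (\<Xi> x) (X (H x)))"
      using infsum_Sigma'_banach[OF s] by (simp add: case_prod_unfold)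
    also have "\<dots> = nuclear_functional y' z' X" by (rule eq[OF X, symmetric])
    finally show ?thesis .
  qed
  with nd' show thesis by (rule that)
qed

section \<open>The algebra Ap and its pairing with PM\<close>

lemma bounded_op_finite_sum:
  assumes "finite A" "\<And>x. x \<in> A \<Longrightarrow> bounded_op p I (T x)"
  shows "bounded_op p I (\<lambda>f i. \<Sum>x\<in>A. T x f i)"
  using assms
proof (induction A rule: finite_induct)
  case empty
  show ?case by (rule bounded_opI[where C = 0]) auto
next
  case (insert x A)
  then show ?case using bounded_op_plus[of I "T x" "\<lambda>f i. \<Sum>x\<in>A. T x f i"] by simp
qed

lemma restrict_in_lp_ops: "bounded_op p I T \<Longrightarrow> (\<lambda>f\<in>lp p I. T f) \<in> lp_ops p I"
  by (simp add: lp_ops_iff bounded_op_cong[OF _ p_gt_1, of I "restrict T (lp p I)" T])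

lemma nuclear_functional_cong:
  assumes "nuclear_data p \<xi> \<eta>" "\<And>f. f \<in> lp p UNIV \<Longrightarrow> S f = T f"
  shows "nuclear_functional \<xi> \<eta> S = nuclear_functional \<xi> \<eta> T"
  by (simp add: nuclear_functional_def assms(2) nuclear_dataD(2)[OF assms(1)])

lemma nuclear_functional_add:
  assumes nd: "nuclear_data p \<xi> \<eta>" and S: "bounded_op p UNIV S" and T: "bounded_op p UNIV T"
  shows "nuclear_functional \<xi> \<eta> (\<lambda>f i. S f i + T f i) = nuclear_functional \<xi> \<eta> S + nuclear_functional \<xi> \<eta> T"
proof -
  have "pairing (\<xi> n) (\<lambda>i. S (\<eta> n) i + T (\<eta> n) i) = pairing (\<xi> n) (S (\<eta> n)) + pairing (\<xi> n) (T (\<eta> n))" for n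
    by (intro pairing_add_right nuclear_dataD[OF nd] bounded_op_lp[OF S] bounded_op_lp[OF T])
  then show ?thesis
    unfolding nuclear_functional_def
    using suminf_add[OF summable_norm_cancel[OF nuclear_functional_infsum(2)[OF nd S]]
        summable_norm_cancel[OF nuclear_functional_infsum(2)[OF nd T]]] by simp
qed

lemma nuclear_functional_scale:
  assumes nd: "nuclear_data p \<xi> \<eta>" and T: "bounded_op p UNIV T"
  shows "nuclear_functional \<xi> \<eta> (\<lambda>f i. c * T f i) = c * nuclear_functional \<xi> \<eta> T"
proof -
  have "pairing (\<xi> n) (\<lambda>i. c * T (\<eta> n) i) = c * pairing (\<xi> n) (T (\<eta> n))" for n
    by (intro pairing_scale_right nuclear_dataD[OF nd] bounded_op_lp[OF T])
  then show ?thesis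
    unfolding nuclear_functional_def
    using suminf_mult[OF summable_norm_cancel[OF nuclear_functional_infsum(2)[OF nd T]]] by simp
qed

lemma nuclear_functional_sum:
  assumes nd: "nuclear_data p \<xi> \<eta>" and A: "finite A" and T: "\<And>x. x \<in> A \<Longrightarrow> bounded_op p UNIV (T x)"
  shows "nuclear_functional \<xi> \<eta> (\<lambda>f i. \<Sum>x\<in>A. c x * T x f i) = (\<Sum>x\<in>A. c x * nuclear_functional \<xi> \<eta> (T x))"
  using A T
proof (induction A rule: finite_induct)
  case empty
  show ?case by (simp add: nuclear_functional_def pairing_def)
next
  case (insert x A)
  have 1: "bounded_op p UNIV (\<lambda>f i. c x * T x f i)" using insert.prems by (intro bounded_op_times) auto
  have 2: "bounded_op p UNIV (\<lambda>f i. \<Sum>x\<in>A. c x * T x f i)"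
    using insert.prems by (intro bounded_op_finite_sum[OF insert.hyps(1)] bounded_op_times) auto
  show ?case
    using insert nuclear_functional_add[OF nd 1 2] nuclear_functional_scale[OF nd, of "T x" "c x"] by simp
qed

text \<open>The two sequences are put side by side over the index set
  \<open>bool \<times> nat\<close>.\<close>

lemma nuclear_data_add:
  fixes \<xi> \<eta> \<xi>' \<eta>' :: "nat \<Rightarrow> 'g \<Rightarrow> complex"
  assumes nd: "nuclear_data p \<xi> \<eta>" and nd': "nuclear_data p \<xi>' \<eta>'"
  obtains y z where "nuclear_data p y z"
    "\<And>X. bounded_op p UNIV X \<Longrightarrow> nuclear_functional y z X = nuclear_functional \<xi> \<eta> X + nuclear_functional \<xi>' \<eta>' X"
proof -
  define \<Xi> where "\<Xi> = (\<lambda>(b, n). if b then \<xi> n else \<xi>' n)"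
  define H where "H = (\<lambda>(b, n). if b then \<eta> n else \<eta>' n)"
  define w where "w x = lp_norm q (\<Xi> x) * lp_norm p (H x)" for x
  have w0: "0 \<le> w x" for x by (simp add: w_def)
  have "sum w F \<le> nuclear_bound p \<xi> \<eta> + nuclear_bound p \<xi>' \<eta>'" if F: "finite F" for F
  proof -
    define B where "B = snd ` F"
    have B: "finite B" using F by (simp add: B_def)
    have "F \<subseteq> UNIV \<times> B" by (force simp: B_def)
    then have "sum w F \<le> sum w (UNIV \<times> B)" using B w0 by (intro sum_mono2) auto
    also have "\<dots> = (\<Sum>b\<in>UNIV. \<Sum>n\<in>B. w (b, n))" by (simp add: sum.cartesian_product)
    also have "\<dots> = (\<Sum>n\<in>B. lp_norm q (\<xi> n) * lp_norm p (\<eta> n)) + (\<Sum>n\<in>B. lp_norm q (\<xi>' n) * lp_norm p (\<eta>' n))"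
      by (simp add: UNIV_bool w_def \<Xi>_def H_def add.commute)
    also have "\<dots> \<le> nuclear_bound p \<xi> \<eta> + nuclear_bound p \<xi>' \<eta>'"
      by (intro add_mono nuclear_data_fin_sum_le nd nd' B)
    finally show ?thesis .
  qed
  then have ws: "w summable_on UNIV" by (rule infsum_le_finite_sums_nonneg(1)[OF w0])
  have \<Xi>: "\<Xi> x \<in> lp q UNIV" and H: "H x \<in> lp p UNIV" for x
    by (auto simp: \<Xi>_def H_def case_prod_unfold nuclear_dataD[OF nd] nuclear_dataD[OF nd'])
  have "countable (UNIV :: (bool \<times> nat) set)" by simp
  then obtain y z where yz: "nuclear_data p y z"
    and eq: "\<And>X. bounded_op p UNIV X \<Longrightarrow> nuclear_functional y z X = (\<Sum>\<^sub>\<infinity>k. pairing (\<Xi> k) (X (H k)))"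
    by (rule nuclear_data_of_countable[OF _ \<Xi> H ws[unfolded w_def]]) (rule that)
  have "nuclear_functional y z X = nuclear_functional \<xi> \<eta> X + nuclear_functional \<xi>' \<eta>' X"
    if X: "bounded_op p UNIV X" for X
  proof -
    have sn: "(\<lambda>x. norm (pairing (\<Xi> x) (X (H x)))) summable_on UNIV"
      by (rule summable_on_comparison_test[OF summable_on_cmult_right[OF ws, of "op_norm p UNIV X"]])
         (simp_all add: w_def norm_pairing_op_le[OF X \<Xi> H])
    have s: "(\<lambda>(b, n). pairing (\<Xi> (b, n)) (X (H (b, n)))) summable_on UNIV \<times> UNIV"
      by (rule abs_summable_summable) (use sn in \<open>simp add: case_prod_unfold\<close>)
    have "(\<Sum>\<^sub>\<infinity>x. pairing (\<Xi> x) (X (H x))) = (\<Sum>\<^sub>\<infinity>b. \<Sum>\<^sub>\<infinity>n. pairing (\<Xi> (b, n)) (X (H (b, n))))"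
      using infsum_Sigma'_banach[OF s] by (simp add: case_prod_unfold)
    also have "\<dots> = nuclear_functional \<xi> \<eta> X + nuclear_functional \<xi>' \<eta>' X"
      by (simp add: UNIV_bool \<Xi>_def H_def nuclear_functional_infsum(3)[OF nd X] nuclear_functional_infsum(3)[OF nd' X] add.commute)
    finally show ?thesis by (simp add: eq[OF X])
  qed
  with yz show thesis by (rule that)
qed

lemma nuclear_data_scale:
  assumes nd: "nuclear_data p \<xi> \<eta>"
  shows "nuclear_data p \<xi> (\<lambda>n i. c * \<eta> n i)"
    and "nuclear_bound p \<xi> (\<lambda>n i. c * \<eta> n i) = norm c * nuclear_bound p \<xi> \<eta>"
    and "bounded_op p UNIV X \<Longrightarrow> nuclear_functional \<xi> (\<lambda>n i. c * \<eta> n i) X = c * nuclear_functional \<xi> \<eta> X"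
proof -
  have *: "lp_norm q (\<xi> n) * lp_norm p (\<lambda>i. c * \<eta> n i) = norm c * (lp_norm q (\<xi> n) * lp_norm p (\<eta> n))" for n
    by (simp add: lp_norm_scale[OF p_gt_1 nuclear_dataD(2)[OF nd]])
  show "nuclear_data p \<xi> (\<lambda>n i. c * \<eta> n i)"
    using nd summable_mult[OF nuclear_dataD(3)[OF nd]]
    by (simp add: nuclear_data_def lp_scale[OF p_gt_1] *)
  show "nuclear_bound p \<xi> (\<lambda>n i. c * \<eta> n i) = norm c * nuclear_bound p \<xi> \<eta>"
    unfolding nuclear_bound_def * by (rule suminf_mult[OF nuclear_dataD(3)[OF nd]])
  assume X: "bounded_op p UNIV X"
  have "nuclear_functional \<xi> (\<lambda>n i. c * \<eta> n i) X = nuclear_functional \<xi> \<eta> (\<lambda>f i. c * X f i)"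
    by (simp add: nuclear_functional_def bounded_op_scale[OF X nuclear_dataD(2)[OF nd]])
  then show "nuclear_functional \<xi> (\<lambda>n i. c * \<eta> n i) X = c * nuclear_functional \<xi> \<eta> X"
    by (simp add: nuclear_functional_scale[OF nd X])
qed

lemma nuclear_data_single:
  assumes y: "y \<in> lp q UNIV" and z: "z \<in> lp p UNIV"
  obtains \<xi> \<eta> where "nuclear_data p \<xi> \<eta>"
    "\<And>X. bounded_op p UNIV X \<Longrightarrow> nuclear_functional \<xi> \<eta> X = pairing y (X z)"
proof -
  have "countable (UNIV :: unit set)" "(\<lambda>_ :: unit. lp_norm q y * lp_norm p z) summable_on UNIV" by simp_all
  then obtain \<xi> \<eta> where "nuclear_data p \<xi> \<eta>"
    "\<And>X. bounded_op p UNIV X \<Longrightarrow> nuclear_functional \<xi> \<eta> X = (\<Sum>\<^sub>\<infinity>k::unit. pairing y (X z))"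
    using nuclear_data_of_countable[of "\<lambda>_ :: unit. y" "\<lambda>_. z", OF _ y z] by blast
  then show thesis using that by (simp add: UNIV_unit)
qed

definition lambda_sum :: "'g set \<Rightarrow> ('g::group_add \<Rightarrow> complex) \<Rightarrow> ('g \<Rightarrow> complex) \<Rightarrow> ('g \<Rightarrow> complex)" where
  "lambda_sum A c = (\<lambda>f\<in>lp p UNIV. \<lambda>t. \<Sum>s\<in>A. c s * left_reg p s f t)"

lemma lambda_span_iff: "S \<in> lambda_span p \<longleftrightarrow> (\<exists>A c. finite A \<and> S = lambda_sum A c)"
  by (auto simp: lambda_span_def lambda_sum_def)

lemma lambda_sum_in_span: "finite A \<Longrightarrow> lambda_sum A c \<in> lambda_span p"
  unfolding lambda_span_iff by blast

lemma bounded_op_lambda_sum: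
  assumes "finite A"
  shows "bounded_op p UNIV (\<lambda>f t. \<Sum>s\<in>A. c s * left_reg p s f t)"
  by (intro bounded_op_finite_sum bounded_op_times bounded_op_if_lp_ops left_reg_in_lp_ops assms)

lemma lambda_sum_in_lp_ops: "finite A \<Longrightarrow> lambda_sum A c \<in> lp_ops p UNIV"
  unfolding lambda_sum_def by (rule restrict_in_lp_ops[OF bounded_op_lambda_sum])

lemma entry_lambda_sum:
  assumes "finite A"
  shows "entry (lambda_sum A c) s t = (if s - t \<in> A then c (s - t) else 0)"
proof -
  have "entry (lambda_sum A c) s t = (\<Sum>a\<in>A. c a * entry (left_reg p a) s t)"
    by (simp add: entry_def lambda_sum_def delta_in_lp[OF p_gt_1])
  also have "\<dots> = (\<Sum>a\<in>A. if a = s - t then c a else 0)"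
    by (intro sum.cong refl) (auto simp: entry_left_reg)
  finally show ?thesis using assms by (simp add: sum.delta)
qed

lemma nuclear_functional_lambda_sum:
  assumes nd: "nuclear_data p \<xi> \<eta>" and A: "finite A"
  shows "nuclear_functional \<xi> \<eta> (lambda_sum A c) = (\<Sum>s\<in>A. c s * coefficient p \<xi> \<eta> s)"
proof -
  have "nuclear_functional \<xi> \<eta> (lambda_sum A c) = nuclear_functional \<xi> \<eta> (\<lambda>f t. \<Sum>s\<in>A. c s * left_reg p s f t)"
    by (rule nuclear_functional_cong[OF nd]) (simp add: lambda_sum_def)
  then show ?thesis
    by (simp add: nuclear_functional_sum[OF nd A] bounded_op_if_lp_ops[OF left_reg_in_lp_ops] coefficient_def)
qed

lemma schur_mult_lambda_sum:
  fixes \<xi> \<eta> :: "nat \<Rightarrow> 'g::group_add \<Rightarrow> complex"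
  assumes nd: "nuclear_data p \<xi> \<eta>" and A: "finite A"
  shows "schur_mult p (coefficient p \<xi> \<eta>) (lambda_sum A c) = lambda_sum A (\<lambda>s. coefficient p \<xi> \<eta> s * c s)"
  by (rule lp_ops_eqI)
     (simp_all add: schur_mult_in_lp_ops[OF nd bounded_op_if_lp_ops[OF lambda_sum_in_lp_ops[OF A]]]
       lambda_sum_in_lp_ops[OF A] entry_schur_mult entry_lambda_sum[OF A])

lemma left_reg_eq_lambda_sum: "left_reg p s = lambda_sum {s} (\<lambda>_. 1)"
  by (simp add: lambda_sum_def left_reg_def fun_eq_iff)

lemma ApE:
  assumes "f \<in> Ap p"
  obtains \<xi> \<eta> where "nuclear_data p \<xi> \<eta>" "f = coefficient p \<xi> \<eta>"
  using assms by (auto simp: Ap_def)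

lemma coefficient_in_Ap: "nuclear_data p \<xi> \<eta> \<Longrightarrow> coefficient p \<xi> \<eta> \<in> Ap p"
  by (auto simp: Ap_def)

text \<open>The adjoint data are evaluated at \<open>left_reg p s\<close>: multiplication by the
  first coefficient function scales this operator by the value at \<open>s\<close>, which leaves the
  pointwise product. So \<open>Ap\<close> is closed under products.\<close>

lemma nuclear_data_mult:
  fixes \<xi> \<eta> y z :: "nat \<Rightarrow> 'g::group_add \<Rightarrow> complex"
  assumes ct: "countable (UNIV :: 'g set)" and nd: "nuclear_data p \<xi> \<eta>" and yz: "nuclear_data p y z"
  obtains y' z' where "nuclear_data p y' z'"
    "coefficient p y' z' = (\<lambda>s. coefficient p \<xi> \<eta> s * coefficient p y z s)"
    "\<And>X. bounded_op p UNIV X \<Longrightarrow>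
       nuclear_functional y z (schur_mult p (coefficient p \<xi> \<eta>) X) = nuclear_functional y' z' X"
proof -
  obtain y' z' where nd': "nuclear_data p y' z'" and
    eq: "\<And>X. bounded_op p UNIV X \<Longrightarrow>
       nuclear_functional y z (schur_mult p (coefficient p \<xi> \<eta>) X) = nuclear_functional y' z' X"
    by (rule nuclear_functional_schur_mult[OF ct nd yz]) blast
  have "coefficient p y' z' s = coefficient p \<xi> \<eta> s * coefficient p y z s" for s
  proof -
    have "coefficient p y' z' s = nuclear_functional y z (schur_mult p (coefficient p \<xi> \<eta>) (left_reg p s))"
      by (simp add: coefficient_def[of p y'] eq[OF bounded_op_if_lp_ops[OF left_reg_in_lp_ops]])
    then show ?thesis
      by (simp add: left_reg_eq_lambda_sum schur_mult_lambda_sum[OF nd] nuclear_functional_lambda_sum[OF yz])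
  qed
  then show thesis using that[OF nd' _ eq] by blast
qed

lemma Ap_mult:
  fixes u f :: "'g::group_add \<Rightarrow> complex"
  assumes "countable (UNIV :: 'g set)" "u \<in> Ap p" "f \<in> Ap p"
  shows "(\<lambda>s. u s * f s) \<in> Ap p"
proof -
  obtain \<xi> \<eta> where 1: "nuclear_data p \<xi> \<eta>" "u = coefficient p \<xi> \<eta>" using assms(2) by (rule ApE)
  obtain y z where 2: "nuclear_data p y z" "f = coefficient p y z" using assms(3) by (rule ApE)
  obtain y' z' where "nuclear_data p y' z'"
    "coefficient p y' z' = (\<lambda>s. coefficient p \<xi> \<eta> s * coefficient p y z s)"
    by (rule nuclear_data_mult[OF assms(1) 1(1) 2(1)]) (rule that)
  then show ?thesis using coefficient_in_Ap[of y' z'] by (simp add: 1 2)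
qed

lemma Ap_add:
  assumes "f \<in> Ap p" "g \<in> Ap p"
  shows "(\<lambda>s. f s + g s) \<in> Ap p"
proof -
  obtain \<xi> \<eta> where 1: "nuclear_data p \<xi> \<eta>" "f = coefficient p \<xi> \<eta>" using assms(1) by (rule ApE)
  obtain \<xi>' \<eta>' where 2: "nuclear_data p \<xi>' \<eta>'" "g = coefficient p \<xi>' \<eta>'" using assms(2) by (rule ApE)
  obtain y z where 3: "nuclear_data p y z"
    "\<And>X. bounded_op p UNIV X \<Longrightarrow> nuclear_functional y z X = nuclear_functional \<xi> \<eta> X + nuclear_functional \<xi>' \<eta>' X"
    by (rule nuclear_data_add[OF 1(1) 2(1)]) blast
  have "(\<lambda>s. f s + g s) = coefficient p y z"
    by (simp add: 1 2 coefficient_def 3 bounded_op_if_lp_ops[OF left_reg_in_lp_ops] fun_eq_iff)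
  then show ?thesis using coefficient_in_Ap[OF 3(1)] by simp
qed

lemma Ap_scale:
  assumes "f \<in> Ap p"
  shows "(\<lambda>s. c * f s) \<in> Ap p"
proof -
  obtain \<xi> \<eta> where 1: "nuclear_data p \<xi> \<eta>" "f = coefficient p \<xi> \<eta>" using assms by (rule ApE)
  have "(\<lambda>s. c * f s) = coefficient p \<xi> (\<lambda>n i. c * \<eta> n i)"
    by (simp add: 1 coefficient_def nuclear_data_scale(3)[OF 1(1)] bounded_op_if_lp_ops[OF left_reg_in_lp_ops] fun_eq_iff)
  then show ?thesis using coefficient_in_Ap[OF nuclear_data_scale(1)[OF 1(1)]] by simp
qed

lemma PM_lp_ops: "X \<in> PM p \<Longrightarrow> X \<in> lp_ops p UNIV"
  by (simp add: PM_def)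

text \<open>The constant net, given by a principal filter, is the witness.\<close>

lemma lambda_sum_in_PM: "finite A \<Longrightarrow> lambda_sum A c \<in> PM p"
  unfolding PM_def
  by (auto simp: lambda_sum_in_lp_ops lambda_sum_in_span eventually_principal principal_eq_bot_iff
      intro!: exI[of _ "principal {lambda_sum A c}"] tendsto_eventually)

text \<open>On the span of the translations both functionals are determined by the common
  coefficient function, and the weak* limit preserves the equality. Hence the description in
  \<open>PM_pairing\<close> denotes a unique number.\<close>

lemma nuclear_functional_PM_unique:
  assumes X: "X \<in> PM p" and nd: "nuclear_data p \<xi> \<eta>" and nd': "nuclear_data p \<xi>' \<eta>'"
    and eq: "coefficient p \<xi> \<eta> = coefficient p \<xi>' \<eta>'"
  shows "nuclear_functional \<xi> \<eta> X = nuclear_functional \<xi>' \<eta>' X"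
proof -
  obtain F where F: "F \<noteq> bot" "\<forall>\<^sub>F S in F. S \<in> lambda_span p"
    "\<And>\<xi> \<eta>. nuclear_data p \<xi> \<eta> \<Longrightarrow> (nuclear_functional \<xi> \<eta> \<longlongrightarrow> nuclear_functional \<xi> \<eta> X) F"
    using X by (auto simp: PM_def)
  have "nuclear_functional \<xi> \<eta> S = nuclear_functional \<xi>' \<eta>' S" if "S \<in> lambda_span p" for S
    using that eq by (auto simp: lambda_span_iff nuclear_functional_lambda_sum[OF nd] nuclear_functional_lambda_sum[OF nd'])
  then have "\<forall>\<^sub>F S in F. nuclear_functional \<xi> \<eta> S = nuclear_functional \<xi>' \<eta>' S"
    using F(2) by (auto elim: eventually_mono)
  then have "(nuclear_functional \<xi>' \<eta>' \<longlongrightarrow> nuclear_functional \<xi> \<eta> X) F"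
    using F(3)[OF nd] by (simp cong: tendsto_cong)
  then show ?thesis using tendsto_unique[OF F(1)] F(3)[OF nd'] by blast
qed

lemma PM_pairing_eq:
  assumes X: "X \<in> PM p" and nd: "nuclear_data p \<xi> \<eta>"
  shows "PM_pairing p X (coefficient p \<xi> \<eta>) = nuclear_functional \<xi> \<eta> X"
  unfolding PM_pairing_def
proof (rule the_equality)
  show "\<exists>\<xi>' \<eta>'. nuclear_data p \<xi>' \<eta>' \<and> coefficient p \<xi> \<eta> = coefficient p \<xi>' \<eta>' \<and>
      nuclear_functional \<xi> \<eta> X = nuclear_functional \<xi>' \<eta>' X"
    using nd by (intro exI[of _ \<xi>] exI[of _ \<eta>]) simp
next
  fix c assume "\<exists>\<xi>' \<eta>'. nuclear_data p \<xi>' \<eta>' \<and> coefficient p \<xi> \<eta> = coefficient p \<xi>' \<eta>' \<and>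
      c = nuclear_functional \<xi>' \<eta>' X"
  then obtain \<xi>' \<eta>' where "nuclear_data p \<xi>' \<eta>'" "coefficient p \<xi> \<eta> = coefficient p \<xi>' \<eta>'"
    "c = nuclear_functional \<xi>' \<eta>' X" by (elim exE conjE)
  then show "c = nuclear_functional \<xi> \<eta> X" using nuclear_functional_PM_unique[OF X nd] by simp
qed

lemma PM_pairing_lambda_sum:
  assumes "finite A" "f \<in> Ap p"
  shows "PM_pairing p (lambda_sum A c) f = (\<Sum>s\<in>A. c s * f s)"
proof -
  obtain \<xi> \<eta> where 1: "nuclear_data p \<xi> \<eta>" "f = coefficient p \<xi> \<eta>" using assms(2) by (rule ApE)
  then show ?thesis
    by (simp add: PM_pairing_eq[OF lambda_sum_in_PM[OF assms(1)] 1(1)] nuclear_functional_lambda_sum[OF 1(1) assms(1)])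
qed

lemma PM_pairing_add:
  assumes X: "X \<in> PM p" and "f \<in> Ap p" "g \<in> Ap p"
  shows "PM_pairing p X (\<lambda>s. f s + g s) = PM_pairing p X f + PM_pairing p X g"
proof -
  obtain \<xi> \<eta> where 1: "nuclear_data p \<xi> \<eta>" "f = coefficient p \<xi> \<eta>" using assms(2) by (rule ApE)
  obtain \<xi>' \<eta>' where 2: "nuclear_data p \<xi>' \<eta>'" "g = coefficient p \<xi>' \<eta>'" using assms(3) by (rule ApE)
  obtain y z where 3: "nuclear_data p y z"
    "\<And>X. bounded_op p UNIV X \<Longrightarrow> nuclear_functional y z X = nuclear_functional \<xi> \<eta> X + nuclear_functional \<xi>' \<eta>' X"
    by (rule nuclear_data_add[OF 1(1) 2(1)]) blast
  have e: "(\<lambda>s. f s + g s) = coefficient p y z"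
    by (simp add: 1 2 coefficient_def 3 bounded_op_if_lp_ops[OF left_reg_in_lp_ops] fun_eq_iff)
  show ?thesis
    unfolding e unfolding 1 2
    by (simp add: PM_pairing_eq[OF X] 1(1) 2(1) 3 bounded_op_if_lp_ops[OF PM_lp_ops[OF X]])
qed

lemma PM_pairing_scale:
  assumes X: "X \<in> PM p" and "f \<in> Ap p"
  shows "PM_pairing p X (\<lambda>s. c * f s) = c * PM_pairing p X f"
proof -
  obtain \<xi> \<eta> where 1: "nuclear_data p \<xi> \<eta>" "f = coefficient p \<xi> \<eta>" using assms(2) by (rule ApE)
  have e: "(\<lambda>s. c * f s) = coefficient p \<xi> (\<lambda>n i. c * \<eta> n i)"
    by (simp add: 1 coefficient_def nuclear_data_scale(3)[OF 1(1)] bounded_op_if_lp_ops[OF left_reg_in_lp_ops] fun_eq_iff)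
  show ?thesis
    unfolding e unfolding 1
    by (simp add: PM_pairing_eq[OF X] 1(1) nuclear_data_scale[OF 1(1)] bounded_op_if_lp_ops[OF PM_lp_ops[OF X]])
qed

text \<open>The multiplier maps the span of the translations into itself and is weak* continuous, so
  the image net, given by \<open>filtermap\<close>, witnesses membership.\<close>

lemma schur_mult_PM:
  fixes \<xi> \<eta> :: "nat \<Rightarrow> 'g::group_add \<Rightarrow> complex"
  assumes ct: "countable (UNIV :: 'g set)" and nd: "nuclear_data p \<xi> \<eta>" and X: "X \<in> PM p"
  shows "schur_mult p (coefficient p \<xi> \<eta>) X \<in> PM p"
proof -
  let ?M = "schur_mult p (coefficient p \<xi> \<eta>)"
  obtain F where F: "F \<noteq> bot" "\<forall>\<^sub>F S in F. S \<in> lambda_span p"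
    "\<And>\<xi> \<eta>. nuclear_data p \<xi> \<eta> \<Longrightarrow> (nuclear_functional \<xi> \<eta> \<longlongrightarrow> nuclear_functional \<xi> \<eta> X) F"
    using X by (auto simp: PM_def)
  have "?M S \<in> lambda_span p" if "S \<in> lambda_span p" for S
    using that by (auto simp: lambda_span_iff[of S] schur_mult_lambda_sum[OF nd] lambda_sum_in_span)
  then have 1: "\<forall>\<^sub>F S in filtermap ?M F. S \<in> lambda_span p"
    using F(2) by (auto simp: eventually_filtermap elim: eventually_mono)
  have 2: "(nuclear_functional y z \<longlongrightarrow> nuclear_functional y z (?M X)) (filtermap ?M F)"
    if yz: "nuclear_data p y z" for y z :: "nat \<Rightarrow> 'g \<Rightarrow> complex"
  proof -
    obtain y' z' where nd': "nuclear_data p y' z'" and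
      eq: "\<And>X. bounded_op p UNIV X \<Longrightarrow> nuclear_functional y z (?M X) = nuclear_functional y' z' X"
      by (rule nuclear_functional_schur_mult[OF ct nd yz]) blast
    have "\<forall>\<^sub>F S in F. nuclear_functional y z (?M S) = nuclear_functional y' z' S"
      using F(2) by (rule eventually_mono)
        (auto simp: lambda_span_iff intro!: eq bounded_op_if_lp_ops lambda_sum_in_lp_ops)
    then have "((\<lambda>S. nuclear_functional y z (?M S)) \<longlongrightarrow> nuclear_functional y' z' X) F"
      using F(3)[OF nd'] by (simp cong: tendsto_cong)
    then show ?thesis
      by (simp add: filterlim_filtermap eq[OF bounded_op_if_lp_ops[OF PM_lp_ops[OF X]]])
  qed
  have "?M X \<in> lp_ops p UNIV" by (rule schur_mult_in_lp_ops[OF nd bounded_op_if_lp_ops[OF PM_lp_ops[OF X]]])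
  then show ?thesis
    unfolding PM_def using F(1) 1 2 by (auto simp: filtermap_bot_iff intro!: exI[of _ "filtermap ?M F"])
qed

text \<open>Both sides are the value at \<open>X\<close> of the product data from
  \<open>nuclear_data_mult\<close>. This transfers multiplication from \<open>Ap\<close> to
  \<open>PM\<close>, where norms are norms of block matrices.\<close>

lemma PM_pairing_mult:
  fixes \<xi> \<eta> :: "nat \<Rightarrow> 'g::group_add \<Rightarrow> complex"
  assumes ct: "countable (UNIV :: 'g set)" and nd: "nuclear_data p \<xi> \<eta>" and X: "X \<in> PM p" and f: "f \<in> Ap p"
  shows "PM_pairing p X (\<lambda>s. coefficient p \<xi> \<eta> s * f s) = PM_pairing p (schur_mult p (coefficient p \<xi> \<eta>) X) f"
proof -
  obtain y z where yz: "nuclear_data p y z" "f = coefficient p y z" using f by (rule ApE)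
  obtain y' z' where 1: "nuclear_data p y' z'"
    "coefficient p y' z' = (\<lambda>s. coefficient p \<xi> \<eta> s * coefficient p y z s)"
    "\<And>X. bounded_op p UNIV X \<Longrightarrow>
       nuclear_functional y z (schur_mult p (coefficient p \<xi> \<eta>) X) = nuclear_functional y' z' X"
    by (rule nuclear_data_mult[OF ct nd yz(1)]) blast
  show ?thesis
    unfolding yz(2) 1(2)[symmetric]
    by (simp add: PM_pairing_eq[OF X 1(1)] PM_pairing_eq[OF schur_mult_PM[OF ct nd X] yz(1)]
        1(3)[OF bounded_op_if_lp_ops[OF PM_lp_ops[OF X]]])
qed

text \<open>The rank-one data \<open>delta g\<close>, \<open>delta h\<close> have coefficient
  function \<open>delta (g - h)\<close> and evaluate an operator at its entry \<open>(g, h)\<close>.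
  Pairing with point masses therefore reads off matrix entries.\<close>

lemma
  fixes g h :: "'g::group_add"
  shows delta_diff_in_Ap: "delta (g - h) \<in> Ap p"
    and PM_pairing_delta_diff: "X \<in> PM p \<Longrightarrow> PM_pairing p X (delta (g - h)) = entry X g h"
proof -
  have d: "delta h \<in> lp p UNIV" "delta g \<in> lp q UNIV" by (auto intro: delta_in_lp p_gt_1 q_gt_1)
  obtain \<xi> \<eta> where nd: "nuclear_data p \<xi> \<eta>"
    and eq: "\<And>X. bounded_op p UNIV X \<Longrightarrow> nuclear_functional \<xi> \<eta> X = pairing (delta g) (X (delta h))"
    by (rule nuclear_data_single[OF d(2,1)]) blast
  have pe: "pairing (delta g) (X (delta h)) = entry X g h" for X
  proof -
    have "pairing (delta g) (X (delta h)) = (\<Sum>\<^sub>\<infinity>i\<in>{g}. delta g i * X (delta h) i)"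
      unfolding pairing_def by (rule infsum_cong_neutral) (auto simp: delta_def)
    then show ?thesis by (simp add: entry_def delta_def)
  qed
  have c: "coefficient p \<xi> \<eta> = delta (g - h)"
  proof
    fix s
    have "g = s + h \<longleftrightarrow> s = g - h" by auto
    then show "coefficient p \<xi> \<eta> s = delta (g - h) s"
      by (simp add: coefficient_def eq[OF bounded_op_if_lp_ops[OF left_reg_in_lp_ops]] pe entry_left_reg)
         (simp add: delta_def)
  qed
  show "delta (g - h) \<in> Ap p" using coefficient_in_Ap[OF nd] c by simp
  assume X: "X \<in> PM p"
  show "PM_pairing p X (delta (g - h)) = entry X g h"
    using PM_pairing_eq[OF X nd] by (simp add: c eq[OF bounded_op_if_lp_ops[OF PM_lp_ops[OF X]]] pe)
qed

end

section \<open>Matrices over PM\<close>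

definition slot :: "nat \<Rightarrow> ('g \<Rightarrow> complex) \<Rightarrow> nat \<times> 'g \<Rightarrow> complex" where
  "slot k h = (\<lambda>(k', s). if k' = k then h s else 0)"

context lp_exponent
begin

lemma
  assumes r: "1 < r" and h: "h \<in> lp r UNIV" and k: "k < m"
  shows slot_lp: "slot k h \<in> lp r ({..<m} \<times> UNIV)"
    and lp_norm_slot: "lp_norm r (slot k h) \<le> lp_norm r h"
proof -
  have *: "fin_norm r J (slot k h) \<le> lp_norm r h" if "finite J" for J
  proof -
    have "(\<Sum>i\<in>J. norm (slot k h i) powr r) = (\<Sum>i\<in>J \<inter> range (Pair k). norm (slot k h i) powr r)"
      using that by (intro sum.mono_neutral_right) (auto simp: slot_def split: if_splits)
    also have "J \<inter> range (Pair k) = Pair k ` (Pair k -` J)" by auto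
    also have "(\<Sum>i\<in>Pair k ` (Pair k -` J). norm (slot k h i) powr r) = (\<Sum>s\<in>Pair k -` J. norm (h s) powr r)"
      by (subst sum.reindex) (auto simp: slot_def inj_on_def)
    finally have "fin_norm r J (slot k h) = fin_norm r (Pair k -` J) h" by (simp add: fin_norm_def)
    also have "\<dots> \<le> lp_norm r h"
      by (rule fin_norm_le_lp_norm[OF r h]) (intro finite_vimageI that, simp add: inj_on_def)
    finally show ?thesis .
  qed
  have 0: "slot k h i = 0" if "i \<notin> {..<m} \<times> UNIV" for i
    using that k by (cases i) (auto simp: slot_def)
  show "slot k h \<in> lp r ({..<m} \<times> UNIV)" "lp_norm r (slot k h) \<le> lp_norm r h"
    by (rule lp_of_fin_norm_le_on[OF r lp_norm_nonneg * 0]; assumption)+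
qed

lemma
  fixes f :: "nat \<times> 'g \<Rightarrow> complex"
  assumes r: "1 < r" and f: "f \<in> lp r I"
  shows slice_lp: "(\<lambda>t. f (l, t)) \<in> lp r UNIV"
    and lp_norm_slice: "lp_norm r (\<lambda>t. f (l, t)) \<le> lp_norm r f"
proof -
  have *: "fin_norm r J (\<lambda>t. f (l, t)) \<le> lp_norm r f" if "finite J" for J
  proof -
    have "fin_norm r J (\<lambda>t. f (l, t)) = fin_norm r (Pair l ` J) f"
      unfolding fin_norm_def by (subst sum.reindex) (auto simp: inj_on_def)
    also have "\<dots> \<le> lp_norm r f" by (rule fin_norm_le_lp_norm[OF r f]) (simp add: that)
    finally show ?thesis .
  qed
  show "(\<lambda>t. f (l, t)) \<in> lp r UNIV" "lp_norm r (\<lambda>t. f (l, t)) \<le> lp_norm r f"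
    by (rule lp_of_fin_norm_le[where B = "lp_norm r f"]; simp add: r *)+
qed

text \<open>As a finite sum of maps that take a slice, apply one entry and embed the result, the
  block operator inherits boundedness term by term.\<close>

lemma block_op_eq:
  "block_op m X f = (\<lambda>i. \<Sum>kl\<in>{..<m} \<times> {..<m}. slot (fst kl) (X (fst kl) (snd kl) (\<lambda>t. f (snd kl, t))) i)"
proof
  fix i :: "nat \<times> 'a"
  obtain k s where i: "i = (k, s)" by (cases i)
  have "(\<Sum>kl\<in>{..<m} \<times> {..<m}. slot (fst kl) (X (fst kl) (snd kl) (\<lambda>t. f (snd kl, t))) i) =
      (\<Sum>k'<m. \<Sum>l<m. slot k' (X k' l (\<lambda>t. f (l, t))) i)"
    by (simp add: sum.cartesian_product case_prod_unfold)
  also have "\<dots> = (\<Sum>k'<m. \<Sum>l<m. if k = k' then X k' l (\<lambda>t. f (l, t)) s else 0)"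
    by (simp add: slot_def i)
  also have "\<dots> = (\<Sum>k'<m. if k = k' then \<Sum>l<m. X k l (\<lambda>t. f (l, t)) s else 0)"
    by (intro sum.cong) auto
  also have "\<dots> = block_op m X f i" by (simp add: block_op_def i sum.delta)
  finally show "block_op m X f i = (\<Sum>kl\<in>{..<m} \<times> {..<m}. slot (fst kl) (X (fst kl) (snd kl) (\<lambda>t. f (snd kl, t))) i)"
    by simp
qed

lemma bounded_op_block_op:
  assumes X: "\<And>k l. k < m \<Longrightarrow> l < m \<Longrightarrow> bounded_op p UNIV (X k l)"
  shows "bounded_op p ({..<m} \<times> UNIV) (block_op m X)"
proof -
  have *: "bounded_op p ({..<m} \<times> UNIV) (\<lambda>f. slot k (X k l (\<lambda>t. f (l, t))))" if kl: "k < m" "l < m" for k l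
  proof (rule bounded_opI)
    note Xkl = X[OF kl]
    fix f assume f: "f \<in> lp p ({..<m} \<times> (UNIV :: 'a set))"
    note fl = slice_lp[OF p_gt_1 f, of l]
    show "slot k (X k l (\<lambda>t. f (l, t))) \<in> lp p ({..<m} \<times> UNIV)"
      by (rule slot_lp[OF p_gt_1 bounded_op_lp[OF Xkl fl] kl(1)])
    show "slot k (X k l (\<lambda>t. c * f (l, t))) = (\<lambda>i. c * slot k (X k l (\<lambda>t. f (l, t))) i)" for c
      by (auto simp: bounded_op_scale[OF Xkl fl] slot_def)
    have "lp_norm p (slot k (X k l (\<lambda>t. f (l, t)))) \<le> lp_norm p (X k l (\<lambda>t. f (l, t)))"
      by (rule lp_norm_slot[OF p_gt_1 bounded_op_lp[OF Xkl fl] kl(1)])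
    also have "\<dots> \<le> op_norm p UNIV (X k l) * lp_norm p (\<lambda>t. f (l, t))" by (rule bounded_op_le[OF Xkl fl])
    also have "\<dots> \<le> op_norm p UNIV (X k l) * lp_norm p f"
      by (intro mult_left_mono lp_norm_slice[OF p_gt_1 f] op_norm_nonneg Xkl)
    finally show "lp_norm p (slot k (X k l (\<lambda>t. f (l, t)))) \<le> op_norm p UNIV (X k l) * lp_norm p f" .
    fix g assume g: "g \<in> lp p ({..<m} \<times> (UNIV :: 'a set))"
    show "slot k (X k l (\<lambda>t. f (l, t) + g (l, t))) = (\<lambda>i. slot k (X k l (\<lambda>t. f (l, t))) i + slot k (X k l (\<lambda>t. g (l, t))) i)"
      by (auto simp: bounded_op_add[OF Xkl fl slice_lp[OF p_gt_1 g]] slot_def)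
  qed
  show ?thesis
    unfolding block_op_eq[abs_def] by (rule bounded_op_finite_sum) (auto intro!: *)
qed

lemma entry_block_op:
  assumes X: "\<And>k l. k < m \<Longrightarrow> l < m \<Longrightarrow> bounded_op p UNIV (X k l)" and kl: "k < m" "l < m"
  shows "entry (block_op m X) (k, s) (l, t) = entry (X k l) s t"
proof -
  have "X k l' (\<lambda>t'. delta (l, t) (l', t')) s = (if l' = l then entry (X k l) s t else 0)" if "l' < m" for l'
  proof (cases "l' = l")
    case True
    then have "(\<lambda>t'. delta (l, t) (l', t')) = delta t" by (auto simp: delta_def)
    then show ?thesis using True by (simp add: entry_def)
  next
    case False
    then have "(\<lambda>t'. delta (l, t) (l', t')) = (\<lambda>_. 0)" by (auto simp: delta_def)
    then show ?thesis using False bounded_op_zero[OF X[OF kl(1) that]] by simp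
  qed
  then have "(\<Sum>l'<m. X k l' (\<lambda>t'. delta (l, t) (l', t')) s) = (\<Sum>l'<m. if l' = l then entry (X k l) s t else 0)"
    by (intro sum.cong) auto
  then show ?thesis using kl by (simp add: entry_def[of "block_op m X"] block_op_def sum.delta)
qed

lemma PM_mat_norm_le_iff:
  assumes X: "\<And>k l. k < m \<Longrightarrow> l < m \<Longrightarrow> bounded_op p UNIV (X k l)" and C: "0 \<le> C"
  shows "PM_mat_norm p m X \<le> C \<longleftrightarrow> mat_bound p ({..<m} \<times> UNIV) (\<lambda>(k, s) (l, t). entry (X k l) s t) C"
proof -
  have "PM_mat_norm p m X \<le> C \<longleftrightarrow> mat_bound p ({..<m} \<times> UNIV) (entry (block_op m X)) C"
    unfolding PM_mat_norm_def by (rule op_norm_le_iff[OF bounded_op_block_op[OF X] C])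
  also have "\<dots> \<longleftrightarrow> mat_bound p ({..<m} \<times> UNIV) (\<lambda>(k, s) (l, t). entry (X k l) s t) C"
    by (rule mat_bound_cong) (auto simp: entry_block_op[OF X])
  finally show ?thesis .
qed

lemma
  fixes h :: "'g \<Rightarrow> complex" and b :: "nat \<Rightarrow> complex"
  assumes r: "1 < r" and J: "finite J" "J \<subseteq> {..<m}" and h: "h \<in> lp r UNIV"
  defines "f \<equiv> \<lambda>(l, t). if l \<in> J then b l * h t else 0"
  shows tensor_lp: "f \<in> lp r ({..<m} \<times> UNIV)"
    and lp_norm_tensor: "lp_norm r f \<le> fin_norm r J b * lp_norm r h"
proof -
  have *: "fin_norm r K f \<le> fin_norm r J b * lp_norm r h" if K: "finite K" for K
  proof -
    define B where "B = snd ` K"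
    have B: "finite B" using K by (simp add: B_def)
    have "(\<Sum>i\<in>K. norm (f i) powr r) = (\<Sum>i\<in>K \<inter> J \<times> B. norm (f i) powr r)"
      using K by (intro sum.mono_neutral_right) (auto simp: f_def B_def split: if_splits intro: rev_image_eqI)
    also have "\<dots> \<le> (\<Sum>i\<in>J \<times> B. norm (f i) powr r)"
      using J B by (intro sum_mono2) auto
    also have "\<dots> = (\<Sum>l\<in>J. \<Sum>t\<in>B. norm (f (l, t)) powr r)"
      by (simp add: sum.cartesian_product)
    also have "\<dots> = (\<Sum>l\<in>J. \<Sum>t\<in>B. norm (b l) powr r * norm (h t) powr r)"
      by (intro sum.cong refl) (simp add: f_def norm_mult powr_mult)
    also have "\<dots> = fin_norm r J b powr r * fin_norm r B h powr r"
      using r by (simp add: fin_norm_powr sum_product)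
    also have "\<dots> \<le> fin_norm r J b powr r * lp_norm r h powr r"
      using r fin_norm_le_lp_norm[OF r h B] by (intro mult_left_mono powr_mono2) auto
    finally show ?thesis using r by (subst fin_norm_le_iff) (auto simp: powr_mult)
  qed
  have 0: "f i = 0" if "i \<notin> {..<m} \<times> UNIV" for i
    using that J by (cases i) (auto simp: f_def)
  show "f \<in> lp r ({..<m} \<times> UNIV)" "lp_norm r f \<le> fin_norm r J b * lp_norm r h"
    by (rule lp_of_fin_norm_le_on[OF r _ * 0]; simp)+
qed

text \<open>The block operator is tested on the elementary tensors of \<open>b\<close> with
  \<open>\<eta>\<close> and of \<open>a\<close> with \<open>\<xi>\<close>, whose norms are at most
  the products of the norms. In other words, a vector functional is completely bounded with constant
  \<open>lp_norm q \<xi> * lp_norm p \<eta>\<close>.\<close>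

lemma mat_bound_pairing_block:
  fixes X :: "nat \<Rightarrow> nat \<Rightarrow> ('g \<Rightarrow> complex) \<Rightarrow> ('g \<Rightarrow> complex)"
  assumes X: "\<And>k l. k < m \<Longrightarrow> l < m \<Longrightarrow> bounded_op p UNIV (X k l)" and N: "PM_mat_norm p m X \<le> N" "0 \<le> N"
    and \<xi>: "\<xi> \<in> lp q UNIV" and \<eta>: "\<eta> \<in> lp p UNIV"
  shows "mat_bound p {..<m} (\<lambda>k l. pairing \<xi> (X k l \<eta>)) (N * (lp_norm q \<xi> * lp_norm p \<eta>))"
proof (rule mat_boundI)
  show "0 \<le> N * (lp_norm q \<xi> * lp_norm p \<eta>)" using N by simp
  fix J and a b :: "nat \<Rightarrow> complex" assume J: "finite J" "J \<subseteq> {..<m}"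
  define f where "f = (\<lambda>(l, t). if l \<in> J then b l * \<eta> t else 0)"
  define g where "g = (\<lambda>(k, s). if k \<in> J then a k * \<xi> s else 0)"
  have f: "f \<in> lp p ({..<m} \<times> UNIV)" "lp_norm p f \<le> fin_norm p J b * lp_norm p \<eta>"
    unfolding f_def by (rule tensor_lp[OF p_gt_1 J \<eta>] lp_norm_tensor[OF p_gt_1 J \<eta>])+
  have g: "g \<in> lp q ({..<m} \<times> UNIV)" "lp_norm q g \<le> fin_norm q J a * lp_norm q \<xi>"
    unfolding g_def by (rule tensor_lp[OF q_gt_1 J \<xi>] lp_norm_tensor[OF q_gt_1 J \<xi>])+
  note B = bounded_op_block_op[of m X, OF X]
  have Bf: "block_op m X f \<in> lp p ({..<m} \<times> UNIV)" by (rule bounded_op_lp[OF B f(1)])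
  have fl: "(\<lambda>t. f (l, t)) = (\<lambda>t. (if l \<in> J then b l else 0) * \<eta> t)" for l by (auto simp: f_def)
  have bf: "block_op m X f (k, s) = (\<Sum>l\<in>J. b l * X k l \<eta> s)" if "k \<in> J" for k s
  proof -
    have k: "k < m" using that J by auto
    have "X k l (\<lambda>t. (if l \<in> J then b l else 0) * \<eta> t) s = (if l \<in> J then b l else 0) * X k l \<eta> s" if "l < m" for l
      unfolding bounded_op_scale[OF X[OF k that] \<eta>] ..
    then have "block_op m X f (k, s) = (\<Sum>l<m. (if l \<in> J then b l else 0) * X k l \<eta> s)"
      using k unfolding block_op_def fl by simp
    also have "\<dots> = (\<Sum>l\<in>J. (if l \<in> J then b l else 0) * X k l \<eta> s)"
      using J by (intro sum.mono_neutral_right) auto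
    finally show ?thesis by simp
  qed
  have sn: "(\<lambda>i. norm (g i * block_op m X f i)) summable_on UNIV"
    by (rule holder_abs_summable[OF p_gt_1 g(1) Bf])
  have s: "(\<lambda>(k, s). g (k, s) * block_op m X f (k, s)) summable_on UNIV \<times> UNIV"
    by (rule abs_summable_summable) (use sn in \<open>simp add: case_prod_unfold\<close>)
  have "pairing g (block_op m X f) = (\<Sum>\<^sub>\<infinity>k. \<Sum>\<^sub>\<infinity>s. g (k, s) * block_op m X f (k, s))"
    using infsum_Sigma'_banach[OF s] by (simp add: pairing_def case_prod_unfold)
  also have "\<dots> = (\<Sum>\<^sub>\<infinity>k\<in>J. \<Sum>\<^sub>\<infinity>s. g (k, s) * block_op m X f (k, s))"
    by (rule infsum_cong_neutral) (auto simp: g_def)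
  also have "\<dots> = (\<Sum>k\<in>J. pairing \<xi> (\<lambda>s. \<Sum>l\<in>J. (a k * b l) * X k l \<eta> s))"
    unfolding infsum_finite[OF J(1)] pairing_def
    by (intro sum.cong refl infsum_cong) (simp add: g_def bf sum_distrib_left mult_ac)
  also have "\<dots> = (\<Sum>k\<in>J. \<Sum>l\<in>J. a k * pairing \<xi> (X k l \<eta>) * b l)"
  proof (rule sum.cong[OF refl])
    fix k assume "k \<in> J"
    then have kl: "k < m" "\<And>l. l \<in> J \<Longrightarrow> l < m" using J by auto
    have ss: "(\<lambda>s. \<xi> s * ((a k * b l) * X k l \<eta> s)) summable_on UNIV" if "l \<in> J" for l
      by (rule abs_summable_summable[OF holder_abs_summable[OF p_gt_1 \<xi> lp_scale[OF p_gt_1 bounded_op_lp[OF X[OF kl(1) kl(2)[OF that]] \<eta>]]]])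
    have "pairing \<xi> (\<lambda>s. \<Sum>l\<in>J. (a k * b l) * X k l \<eta> s) = (\<Sum>l\<in>J. pairing \<xi> (\<lambda>s. (a k * b l) * X k l \<eta> s))"
      unfolding pairing_def sum_distrib_left by (rule infsum_finite_sum[OF J(1) ss])
    also have "\<dots> = (\<Sum>l\<in>J. a k * pairing \<xi> (X k l \<eta>) * b l)"
    proof (rule sum.cong[OF refl])
      fix l assume "l \<in> J"
      then have "l < m" by (rule kl(2))
      from pairing_scale_right[OF \<xi> bounded_op_lp[OF X[OF kl(1) this] \<eta>], of "a k * b l"]
      show "pairing \<xi> (\<lambda>s. (a k * b l) * X k l \<eta> s) = a k * pairing \<xi> (X k l \<eta>) * b l"
        by (metis mult.assoc mult.commute)
    qed
    finally show "pairing \<xi> (\<lambda>s. \<Sum>l\<in>J. (a k * b l) * X k l \<eta> s) = (\<Sum>l\<in>J. a k * pairing \<xi> (X k l \<eta>) * b l)" .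
  qed
  finally have eq: "pairing g (block_op m X f) = (\<Sum>k\<in>J. \<Sum>l\<in>J. a k * pairing \<xi> (X k l \<eta>) * b l)" .
  have Nf: "lp_norm p (block_op m X f) \<le> N * lp_norm p f"
  proof (rule order_trans[OF bounded_op_le[OF B f(1)]])
    show "op_norm p ({..<m} \<times> UNIV) (block_op m X) * lp_norm p f \<le> N * lp_norm p f"
      using N by (intro mult_right_mono) (auto simp: PM_mat_norm_def)
  qed simp_all
  have "norm (pairing g (block_op m X f)) \<le> lp_norm q g * lp_norm p (block_op m X f)"
    by (rule norm_pairing_le[OF p_gt_1 g(1) Bf])
  also have "\<dots> \<le> lp_norm q g * (N * lp_norm p f)"
    by (rule mult_left_mono[OF Nf]) simp
  also have "\<dots> \<le> (fin_norm q J a * lp_norm q \<xi>) * (N * (fin_norm p J b * lp_norm p \<eta>))"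
    using f g N by (intro mult_mono) auto
  finally show "norm (\<Sum>k\<in>J. \<Sum>l\<in>J. a k * pairing \<xi> (X k l \<eta>) * b l) \<le>
      N * (lp_norm q \<xi> * lp_norm p \<eta>) * fin_norm q J a * fin_norm p J b"
    unfolding eq by (simp add: mult_ac)
qed

text \<open>The constant is crude; its purpose is to make every finite matrix a bounded operator, so
  that \<open>op_norm_le_iff\<close> applies to it.\<close>

lemma mat_bound_finite:
  assumes J: "finite J"
  shows "mat_bound p J a (\<Sum>s\<in>J. \<Sum>t\<in>J. norm (a s t))"
proof (rule mat_boundI)
  show "0 \<le> (\<Sum>s\<in>J. \<Sum>t\<in>J. norm (a s t))" by (intro sum_nonneg) auto
  fix K and y z :: "'a \<Rightarrow> complex" assume K: "finite K" "K \<subseteq> J"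
  have le: "norm (f i) \<le> fin_norm r K f" if "i \<in> K" "1 < r" for i f r
  proof -
    have "fin_norm r {i} f \<le> fin_norm r K f" using that K by (intro fin_norm_mono) auto
    then show ?thesis using that by (simp add: fin_norm_def powr_powr)
  qed
  have "norm (\<Sum>s\<in>K. \<Sum>t\<in>K. y s * a s t * z t) \<le> (\<Sum>s\<in>K. \<Sum>t\<in>K. norm (y s * a s t * z t))"
    by (intro order_trans[OF norm_sum] sum_mono norm_sum)
  also have "\<dots> \<le> (\<Sum>s\<in>K. \<Sum>t\<in>K. norm (a s t) * (fin_norm q K y * fin_norm p K z))"
  proof (intro sum_mono)
    fix s t assume "s \<in> K" "t \<in> K"
    then have "norm (a s t) * (norm (y s) * norm (z t)) \<le> norm (a s t) * (fin_norm q K y * fin_norm p K z)"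
      by (intro mult_left_mono mult_mono le q_gt_1 p_gt_1) auto
    then show "norm (y s * a s t * z t) \<le> norm (a s t) * (fin_norm q K y * fin_norm p K z)"
      by (simp add: norm_mult mult_ac)
  qed
  also have "\<dots> = (\<Sum>s\<in>K. \<Sum>t\<in>K. norm (a s t)) * (fin_norm q K y * fin_norm p K z)"
    by (simp add: sum_distrib_right)
  also have "\<dots> \<le> (\<Sum>s\<in>J. \<Sum>t\<in>J. norm (a s t)) * (fin_norm q K y * fin_norm p K z)"
  proof (rule mult_right_mono)
    have "(\<Sum>s\<in>K. \<Sum>t\<in>K. norm (a s t)) \<le> (\<Sum>s\<in>K. \<Sum>t\<in>J. norm (a s t))"
      using J K by (intro sum_mono sum_mono2) auto
    also have "\<dots> \<le> (\<Sum>s\<in>J. \<Sum>t\<in>J. norm (a s t))"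
      using J K by (intro sum_mono2 sum_nonneg) auto
    finally show "(\<Sum>s\<in>K. \<Sum>t\<in>K. norm (a s t)) \<le> (\<Sum>s\<in>J. \<Sum>t\<in>J. norm (a s t))" .
  qed simp
  finally show "norm (\<Sum>s\<in>K. \<Sum>t\<in>K. y s * a s t * z t) \<le>
      (\<Sum>s\<in>J. \<Sum>t\<in>J. norm (a s t)) * fin_norm q K y * fin_norm p K z"
    by (simp add: mult_ac)
qed

lemma op_norm_matrix_op_le_iff:
  assumes J: "finite J" and C: "0 \<le> C"
  shows "op_norm p J (matrix_op J a) \<le> C \<longleftrightarrow> mat_bound p J a C"
proof -
  have "matrix_op J a f = mat_op p J a f" if "f \<in> lp p J" for f
    using that J by (auto simp: matrix_op_def mat_op_def)
  then have "op_norm p J (matrix_op J a) = op_norm p J (mat_op p J a)" by (rule op_norm_cong)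
  also have "\<dots> \<le> C \<longleftrightarrow> mat_bound p J (entry (mat_op p J a)) C"
    by (rule op_norm_le_iff[OF bounded_op_if_lp_ops[OF mat_op_in_lp_ops[OF mat_bound_finite[OF J]]] C])
  also have "\<dots> \<longleftrightarrow> mat_bound p J a C" by (rule mat_bound_cong) (simp add: entry_mat_op)
  finally show ?thesis .
qed

lemma mat_bound_entry_le:
  assumes "mat_bound p I a C" "s \<in> I" "t \<in> I"
  shows "norm (a s t) \<le> C"
  using mat_bound_two_sets[OF assms(1), of "{s}" "{t}" "\<lambda>_. 1" "\<lambda>_. 1"] assms by (simp add: fin_norm_def)

text \<open>Conjugation by the diagonal operator with entries \<open>\<lambda>(\<pi> k)\<close> turns \<open>a \<otimes> 1\<close> into this matrix.\<close>

lemma mat_bound_translation_matrix: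
  fixes \<pi> :: "'i \<Rightarrow> 'g::group_add"
  assumes a: "mat_bound p I a C"
  shows "mat_bound p (I \<times> UNIV) (\<lambda>(k, s) (l, t). if s = \<pi> k - \<pi> l + t then a k l else 0) C"
proof (rule mat_boundI[OF mat_bound_nonneg[OF a]])
  fix J :: "('i \<times> 'g) set" and y z :: "'i \<times> 'g \<Rightarrow> complex" assume J: "finite J" "J \<subseteq> I \<times> UNIV"
  define A where "A = fst ` J"
  \<comment> \<open>\<open>r = - \<pi> k + s\<close> is the second coordinate after the conjugation,
    in which the matrix becomes \<open>a \<otimes> 1\<close>; \<open>R\<close> collects the values
    that occur in \<open>J\<close>.\<close>
  define R where "R = (\<lambda>(k, s). - \<pi> k + s) ` J"
  have A: "finite A" "A \<subseteq> I" and R: "finite R" using J by (auto simp: A_def R_def)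
  define y' where "y' i = (if i \<in> J then y i else 0)" for i
  define z' where "z' i = (if i \<in> J then z i else 0)" for i
  define \<phi> where "\<phi> = (\<lambda>(k, r). (k, \<pi> k + r))"
  have inj: "inj_on \<phi> (A \<times> R)" by (auto simp: \<phi>_def inj_on_def)
  have J\<phi>: "J \<subseteq> \<phi> ` (A \<times> R)"
  proof
    fix i assume i: "i \<in> J"
    obtain k s where ks: "i = (k, s)" by (cases i)
    have "k \<in> A" using i ks by (force simp: A_def)
    moreover have "- \<pi> k + s \<in> R" using i ks by (force simp: R_def)
    moreover have "i = \<phi> (k, - \<pi> k + s)" by (simp add: ks \<phi>_def add.assoc[symmetric])
    ultimately show "i \<in> \<phi> ` (A \<times> R)" by blast
  qed
  have sumJ: "sum h J = (\<Sum>k\<in>A. \<Sum>r\<in>R. h (k, \<pi> k + r))"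
    if h: "\<And>i. i \<notin> J \<Longrightarrow> h i = 0" for h :: "'i \<times> 'g \<Rightarrow> 'c::comm_monoid_add"
  proof -
    have "sum h J = sum h (\<phi> ` (A \<times> R))"
      using J\<phi> A R h by (intro sum.mono_neutral_left) auto
    also have "\<dots> = (\<Sum>x\<in>A \<times> R. h (\<phi> x))" by (simp add: sum.reindex[OF inj])
    finally show ?thesis by (simp add: sum.cartesian_product \<phi>_def case_prod_unfold)
  qed
  \<comment> \<open>In the new coordinates, nonzero entries occur only at equal second
    coordinates.\<close>
  have cond: "\<pi> k + r = \<pi> k - \<pi> l + (\<pi> l + r') \<longleftrightarrow> r = r'" for k l r r'
    by (simp add: add.assoc[symmetric])
  define M where "M = (\<lambda>(k, s) (l, t). if s = \<pi> k - \<pi> l + t then a k l else 0)"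
  have inner: "(\<Sum>t\<in>J. y' s * M s t * z' t) = (\<Sum>l\<in>A. \<Sum>r'\<in>R. y' s * M s (l, \<pi> l + r') * z' (l, \<pi> l + r'))" for s
    by (rule sumJ) (simp add: z'_def)
  have "(\<Sum>s\<in>J. \<Sum>t\<in>J. y s * M s t * z t) = (\<Sum>s\<in>J. \<Sum>t\<in>J. y' s * M s t * z' t)"
    by (intro sum.cong refl) (simp add: y'_def z'_def)
  also have "\<dots> = (\<Sum>k\<in>A. \<Sum>r\<in>R. \<Sum>l\<in>A. \<Sum>r'\<in>R. y' (k, \<pi> k + r) * M (k, \<pi> k + r) (l, \<pi> l + r') * z' (l, \<pi> l + r'))"
    unfolding inner by (rule sumJ) (simp add: y'_def)
  also have "\<dots> = (\<Sum>k\<in>A. \<Sum>r\<in>R. \<Sum>l\<in>A. y' (k, \<pi> k + r) * a k l * z' (l, \<pi> l + r))"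
  proof (intro sum.cong refl)
    fix k r l assume r: "r \<in> R"
    have "(\<Sum>r'\<in>R. y' (k, \<pi> k + r) * M (k, \<pi> k + r) (l, \<pi> l + r') * z' (l, \<pi> l + r')) =
        (\<Sum>r'\<in>R. if r = r' then y' (k, \<pi> k + r) * a k l * z' (l, \<pi> l + r') else 0)"
      by (intro sum.cong refl) (simp add: M_def cond)
    then show "(\<Sum>r'\<in>R. y' (k, \<pi> k + r) * M (k, \<pi> k + r) (l, \<pi> l + r') * z' (l, \<pi> l + r')) =
        y' (k, \<pi> k + r) * a k l * z' (l, \<pi> l + r)"
      using r R by (simp add: sum.delta')
  qed
  also have "\<dots> = (\<Sum>r\<in>R. \<Sum>k\<in>A. \<Sum>l\<in>A. y' (k, \<pi> k + r) * a k l * z' (l, \<pi> l + r))"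
    by (rule sum.swap)
  finally have eq: "(\<Sum>s\<in>J. \<Sum>t\<in>J. y s * M s t * z t) = \<dots>" .
  \<comment> \<open>\<open>Y r\<close> and \<open>Z r\<close> are norms of the slices at
    \<open>r\<close>: the bound for \<open>a\<close> acts on each slice, and Hoelder's inequality
    over \<open>r\<close> puts the slices together.\<close>
  define Y where "Y r = complex_of_real (fin_norm q A (\<lambda>k. y' (k, \<pi> k + r)))" for r
  define Z where "Z r = complex_of_real (fin_norm p A (\<lambda>k. z' (k, \<pi> k + r)))" for r
  have fn: "fin_norm e R (\<lambda>r. complex_of_real (fin_norm e A (\<lambda>k. f' (k, \<pi> k + r)))) = fin_norm e J f"
    if e: "1 < e" and f': "\<And>i. f' i = (if i \<in> J then f i else 0)" for e and f f' :: "'i \<times> 'g \<Rightarrow> complex"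
  proof -
    have "(\<Sum>r\<in>R. norm (complex_of_real (fin_norm e A (\<lambda>k. f' (k, \<pi> k + r)))) powr e) =
        (\<Sum>r\<in>R. \<Sum>k\<in>A. norm (f' (k, \<pi> k + r)) powr e)" using e by (simp add: fin_norm_powr)
    also have "\<dots> = (\<Sum>k\<in>A. \<Sum>r\<in>R. norm (f' (k, \<pi> k + r)) powr e)" by (rule sum.swap)
    also have "\<dots> = (\<Sum>i\<in>J. norm (f' i) powr e)" by (rule sumJ[symmetric]) (simp add: f')
    also have "\<dots> = (\<Sum>i\<in>J. norm (f i) powr e)" by (simp add: f')
    finally show ?thesis unfolding fin_norm_def[of e R] fin_norm_def[of e J] by simp
  qed
  have "norm (\<Sum>s\<in>J. \<Sum>t\<in>J. y s * M s t * z t) \<le> (\<Sum>r\<in>R. norm (\<Sum>k\<in>A. \<Sum>l\<in>A. y' (k, \<pi> k + r) * a k l * z' (l, \<pi> l + r)))"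
    unfolding eq by (rule norm_sum)
  also have "\<dots> \<le> (\<Sum>r\<in>R. C * (norm (Y r) * norm (Z r)))"
    using mat_boundD[OF a A] by (intro sum_mono) (simp add: Y_def Z_def mult.assoc)
  also have "\<dots> = C * (\<Sum>r\<in>R. norm (Y r) * norm (Z r))" by (simp add: sum_distrib_left)
  also have "\<dots> \<le> C * (fin_norm q R Y * fin_norm p R Z)"
    by (intro mult_left_mono fin_norm_holder[OF p_gt_1 R] mat_bound_nonneg[OF a])
  also have "fin_norm q R Y = fin_norm q J y" unfolding Y_def[abs_def] by (rule fn[OF q_gt_1]) (simp add: y'_def)
  also have "fin_norm p R Z = fin_norm p J z" unfolding Z_def[abs_def] by (rule fn[OF p_gt_1]) (simp add: z'_def)
  finally show "norm (\<Sum>s\<in>J. \<Sum>t\<in>J. y s * (case s of (k, s) \<Rightarrow> \<lambda>(l, t). if s = \<pi> k - \<pi> l + t then a k l else 0) t * z t)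
      \<le> C * fin_norm q J y * fin_norm p J z"
    by (simp add: M_def mult.assoc)
qed

section \<open>Completely bounded multipliers\<close>

abbreviation PM_ball :: "nat \<Rightarrow> (nat \<Rightarrow> nat \<Rightarrow> ('g::group_add \<Rightarrow> complex) \<Rightarrow> ('g \<Rightarrow> complex)) \<Rightarrow> bool" where
  "PM_ball m X \<equiv> (\<forall>k<m. \<forall>l<m. X k l \<in> PM p) \<and> PM_mat_norm p m X \<le> 1"

abbreviation pairing_mat ::
  "(nat \<Rightarrow> nat \<Rightarrow> ('g::group_add \<Rightarrow> complex) \<Rightarrow> ('g \<Rightarrow> complex)) \<Rightarrow> (nat \<Rightarrow> nat \<Rightarrow> 'g \<Rightarrow> complex) \<Rightarrow>
    nat \<times> nat \<Rightarrow> nat \<times> nat \<Rightarrow> complex" where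
  "pairing_mat X f \<equiv> \<lambda>(k, i) (l, j). PM_pairing p (X k l) (f i j)"

lemma PM_bounded_op: "X \<in> PM p \<Longrightarrow> bounded_op p UNIV X"
  by (rule bounded_op_if_lp_ops[OF PM_lp_ops])

lemma Ap_mat_norm_eq:
  "Ap_mat_norm p n f = Sup {op_norm p ({..<m} \<times> {..<n}) (matrix_op ({..<m} \<times> {..<n}) (pairing_mat X f)) |m X. PM_ball m X}"
  by (simp add: Ap_mat_norm_def)

text \<open>Ensures that the supremum in \<open>Ap_mat_norm\<close> ranges over a nonempty
  set.\<close>

lemma PM_ball_0: "PM_ball 0 X"
  using PM_mat_norm_le_iff[of 0 X 1] by (simp add: mat_bound_def)

lemma Ap_mat_norm_le:
  fixes f :: "nat \<Rightarrow> nat \<Rightarrow> 'g::group_add \<Rightarrow> complex"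
  assumes "\<And>m X. PM_ball m X \<Longrightarrow> mat_bound p ({..<m} \<times> {..<n}) (pairing_mat X f) C" "0 \<le> C"
  shows "Ap_mat_norm p n f \<le> C"
  unfolding Ap_mat_norm_eq
proof (rule cSup_least)
  show "{op_norm p ({..<m} \<times> {..<n}) (matrix_op ({..<m} \<times> {..<n}) (pairing_mat X f)) |m X. PM_ball m X} \<noteq> {}"
    using PM_ball_0 by blast
  fix x assume "x \<in> {op_norm p ({..<m} \<times> {..<n}) (matrix_op ({..<m} \<times> {..<n}) (pairing_mat X f)) |m X. PM_ball m X}"
  then obtain m X where X: "PM_ball m X"
    and x: "x = op_norm p ({..<m} \<times> {..<n}) (matrix_op ({..<m} \<times> {..<n}) (pairing_mat X f))" by blast
  show "x \<le> C"
    unfolding x using assms(1)[OF X] by (subst op_norm_matrix_op_le_iff) (auto simp: assms(2))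
qed

text \<open>This is \<open>B\<close> tensored with the matrix unit at \<open>(i, j)\<close>: only
  rows with second index \<open>i\<close> and columns with second index \<open>j\<close> matter, and
  restricting a test vector to them does not increase its norm.\<close>

lemma mat_bound_matrix_unit:
  fixes m n i j :: nat
  assumes B: "mat_bound p {..<m} B K" and ij: "i < n" "j < n"
  shows "mat_bound p ({..<m} \<times> {..<n}) (\<lambda>(k, i') (l, j'). if i' = i \<and> j' = j then B k l else 0) K"
proof (rule mat_boundI[OF mat_bound_nonneg[OF B]])
  fix J :: "(nat \<times> nat) set" and y z :: "nat \<times> nat \<Rightarrow> complex"
  assume J: "finite J" "J \<subseteq> {..<m} \<times> {..<n}"
  define M where "M = (\<lambda>(k, i') (l, j'). if i' = i \<and> j' = j then B k l else 0)"
  define Ji where "Ji e = {k. (k, e) \<in> J}" for e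
  have Ji: "finite (Ji e)" "Ji e \<subseteq> {..<m}" "inj_on (\<lambda>k. (k, e)) (Ji e)" "(\<lambda>k. (k, e)) ` Ji e \<subseteq> J" for e
  proof -
    show "Ji e \<subseteq> {..<m}" using J by (auto simp: Ji_def)
    then show "finite (Ji e)" by (rule finite_subset) simp
  qed (auto simp: Ji_def inj_on_def)
  have red: "sum h J = (\<Sum>k\<in>Ji e. h (k, e))" if "\<And>k e'. e' \<noteq> e \<Longrightarrow> h (k, e') = 0" for h :: "nat \<times> nat \<Rightarrow> complex" and e
  proof -
    have "sum h J = sum h ((\<lambda>k. (k, e)) ` Ji e)"
    proof (intro sum.mono_neutral_right J Ji ballI)
      fix x assume x: "x \<in> J - (\<lambda>k. (k, e)) ` Ji e"
      then have "snd x \<noteq> e" by (cases x) (auto simp: Ji_def)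
      then show "h x = 0" using that[of "snd x" "fst x"] by simp
    qed
    then show ?thesis by (simp add: sum.reindex[OF Ji(3)])
  qed
  have "(\<Sum>s\<in>J. \<Sum>t\<in>J. y s * M s t * z t) = (\<Sum>k\<in>Ji i. \<Sum>t\<in>J. y (k, i) * M (k, i) t * z t)"
    by (rule red) (simp add: M_def case_prod_unfold)
  also have "\<dots> = (\<Sum>k\<in>Ji i. \<Sum>l\<in>Ji j. y (k, i) * M (k, i) (l, j) * z (l, j))"
    by (intro sum.cong[OF refl] red) (simp add: M_def)
  also have "\<dots> = (\<Sum>k\<in>Ji i. \<Sum>l\<in>Ji j. y (k, i) * B k l * z (l, j))" by (simp add: M_def)
  finally have eq: "(\<Sum>s\<in>J. \<Sum>t\<in>J. y s * M s t * z t) = \<dots>" .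
  have fn: "fin_norm r (Ji e) (\<lambda>k. f (k, e)) \<le> fin_norm r J f" if "1 < r" for r e and f :: "nat \<times> nat \<Rightarrow> complex"
  proof -
    have "fin_norm r (Ji e) (\<lambda>k. f (k, e)) = fin_norm r ((\<lambda>k. (k, e)) ` Ji e) f"
      by (simp add: fin_norm_def sum.reindex[OF Ji(3)])
    also have "\<dots> \<le> fin_norm r J f" using that J Ji(4) by (intro fin_norm_mono) auto
    finally show ?thesis .
  qed
  have "norm (\<Sum>s\<in>J. \<Sum>t\<in>J. y s * M s t * z t) \<le> K * fin_norm q (Ji i) (\<lambda>k. y (k, i)) * fin_norm p (Ji j) (\<lambda>l. z (l, j))"
    unfolding eq by (rule mat_bound_two_sets[OF B Ji(1,2) Ji(1,2)])
  also have "\<dots> \<le> K * fin_norm q J y * fin_norm p J z"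
    using mat_bound_nonneg[OF B] by (intro mult_mono fn q_gt_1 p_gt_1) auto
  finally show "norm (\<Sum>s\<in>J. \<Sum>t\<in>J. y s * (case s of (k, i') \<Rightarrow> \<lambda>(l, j'). if i' = i \<and> j' = j then B k l else 0) t * z t)
      \<le> K * fin_norm q J y * fin_norm p J z"
    by (simp add: M_def)
qed

text \<open>\<open>mat_bound_pairing_block\<close> bounds each term of the trace-class series by the
  product of its two norms, and the estimate survives summation.\<close>

lemma mat_bound_PM_pairing:
  fixes \<xi> \<eta> :: "nat \<Rightarrow> 'g::group_add \<Rightarrow> complex"
  assumes X: "PM_ball m X" and nd: "nuclear_data p \<xi> \<eta>"
  shows "mat_bound p {..<m} (\<lambda>k l. PM_pairing p (X k l) (coefficient p \<xi> \<eta>)) (nuclear_bound p \<xi> \<eta>)"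
proof (rule mat_boundI[OF nuclear_bound_nonneg[OF nd]])
  fix J and a b :: "nat \<Rightarrow> complex" assume J: "finite J" "J \<subseteq> {..<m}"
  have Xb: "bounded_op p UNIV (X k l)" if "k < m" "l < m" for k l using X that by (intro PM_bounded_op) simp
  have JX: "X k l \<in> PM p" "bounded_op p UNIV (X k l)" if "k \<in> J" "l \<in> J" for k l
  proof -
    have "k < m" "l < m" using J that by auto
    then show "X k l \<in> PM p" "bounded_op p UNIV (X k l)" using X Xb by simp_all
  qed
  define c where "c n = (\<Sum>k\<in>J. \<Sum>l\<in>J. a k * pairing (\<xi> n) (X k l (\<eta> n)) * b l)" for n
  define w where "w n = lp_norm q (\<xi> n) * lp_norm p (\<eta> n)" for n
  define N where "N = fin_norm q J a * fin_norm p J b"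
  have cw: "norm (c n) \<le> N * w n" for n
  proof -
    have "mat_bound p {..<m} (\<lambda>k l. pairing (\<xi> n) (X k l (\<eta> n))) (1 * w n)"
      unfolding w_def using X Xb by (intro mat_bound_pairing_block nuclear_dataD[OF nd]) auto
    from mat_boundD[OF this J, of a b] show ?thesis by (simp add: c_def N_def mult_ac)
  qed
  have ws: "summable w" unfolding w_def by (rule nuclear_dataD(3)[OF nd])
  have "(\<lambda>n. pairing (\<xi> n) (X k l (\<eta> n))) sums PM_pairing p (X k l) (coefficient p \<xi> \<eta>)" if "k \<in> J" "l \<in> J" for k l
    unfolding PM_pairing_eq[OF JX(1)[OF that] nd] nuclear_functional_def
    by (rule summable_sums[OF summable_norm_cancel[OF nuclear_functional_infsum(2)[OF nd JX(2)[OF that]]]])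
  then have "c sums (\<Sum>k\<in>J. \<Sum>l\<in>J. a k * PM_pairing p (X k l) (coefficient p \<xi> \<eta>) * b l)"
    unfolding c_def by (intro sums_sum sums_mult sums_mult2) auto
  then have eq: "(\<Sum>k\<in>J. \<Sum>l\<in>J. a k * PM_pairing p (X k l) (coefficient p \<xi> \<eta>) * b l) = (\<Sum>n. c n)"
    by (rule sums_unique)
  have sN: "summable (\<lambda>n. N * w n)" by (rule summable_mult[OF ws])
  have sc: "summable (\<lambda>n. norm (c n))" by (rule summable_comparison_test'[OF sN, of 0]) (simp add: cw)
  have "norm (\<Sum>n. c n) \<le> (\<Sum>n. norm (c n))" by (rule summable_norm[OF sc])
  also have "\<dots> \<le> (\<Sum>n. N * w n)" by (rule suminf_le[OF cw sc sN])
  also have "\<dots> = N * nuclear_bound p \<xi> \<eta>" unfolding nuclear_bound_def w_def[symmetric] by (rule suminf_mult[OF ws])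
  finally show "norm (\<Sum>k\<in>J. \<Sum>l\<in>J. a k * PM_pairing p (X k l) (coefficient p \<xi> \<eta>) * b l)
      \<le> nuclear_bound p \<xi> \<eta> * fin_norm q J a * fin_norm p J b"
    unfolding eq by (simp add: N_def mult_ac)
qed

text \<open>A member lies below a real supremum only if the set is bounded above, and this
  boundedness has to be established for each matrix over \<open>Ap\<close>.\<close>

lemma Ap_mat_norm_bound:
  fixes f :: "nat \<Rightarrow> nat \<Rightarrow> 'g::group_add \<Rightarrow> complex"
  assumes f: "\<And>i j. i < n \<Longrightarrow> j < n \<Longrightarrow> f i j \<in> Ap p" and X: "PM_ball m X"
  shows "mat_bound p ({..<m} \<times> {..<n}) (pairing_mat X f) (Ap_mat_norm p n f)"
proof -
  have "\<forall>i j. \<exists>\<xi> \<eta>. i < n \<longrightarrow> j < n \<longrightarrow> nuclear_data p \<xi> \<eta> \<and> f i j = coefficient p \<xi> \<eta>"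
    using f by (fastforce simp: Ap_def)
  then obtain \<xi> \<eta> where \<xi>\<eta>: "\<And>i j. i < n \<Longrightarrow> j < n \<Longrightarrow> nuclear_data p (\<xi> i j) (\<eta> i j)"
    "\<And>i j. i < n \<Longrightarrow> j < n \<Longrightarrow> f i j = coefficient p (\<xi> i j) (\<eta> i j)"
    by metis
  \<comment> \<open>A crude bound that does not depend on \<open>m\<close> and \<open>X\<close>: the
    matrix is decomposed into its entries tensored with matrix units, each contributing the nuclear
    bound of its entry.\<close>
  define K where "K = (\<Sum>ij\<in>{..<n} \<times> {..<n}. nuclear_bound p (\<xi> (fst ij) (snd ij)) (\<eta> (fst ij) (snd ij)))"
  have K: "0 \<le> K" unfolding K_def by (intro sum_nonneg nuclear_bound_nonneg \<xi>\<eta>) auto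
  have bd: "mat_bound p ({..<m} \<times> {..<n}) (pairing_mat X f) K" if X: "PM_ball m X" for m X
  proof -
    define M where "M ij = (\<lambda>(k, i') (l, j'). if i' = fst ij \<and> j' = snd ij
        then PM_pairing p (X k l) (coefficient p (\<xi> (fst ij) (snd ij)) (\<eta> (fst ij) (snd ij))) else 0)" for ij :: "nat \<times> nat"
    have "mat_bound p ({..<m} \<times> {..<n}) (\<lambda>s t. \<Sum>ij\<in>{..<n} \<times> {..<n}. M ij s t) K"
      unfolding K_def
    proof (rule mat_bound_sum)
      fix ij assume "ij \<in> {..<n} \<times> {..<n}"
      then have ij: "fst ij < n" "snd ij < n" by auto
      show "mat_bound p ({..<m} \<times> {..<n}) (M ij) (nuclear_bound p (\<xi> (fst ij) (snd ij)) (\<eta> (fst ij) (snd ij)))"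
        unfolding M_def by (rule mat_bound_matrix_unit[OF mat_bound_PM_pairing[OF X \<xi>\<eta>(1)[OF ij]] ij])
    qed simp
    note 1 = this
    have 2: "(\<Sum>ij\<in>{..<n} \<times> {..<n}. M ij s t) = pairing_mat X f s t"
      if s: "s \<in> {..<m} \<times> {..<n}" and t: "t \<in> {..<m} \<times> {..<n}" for s t
    proof -
      have "(\<Sum>ij\<in>{..<n} \<times> {..<n}. M ij s t) = (\<Sum>ij\<in>{..<n} \<times> {..<n}. if ij = (snd s, snd t) then pairing_mat X f s t else 0)"
        by (intro sum.cong refl) (use s t in \<open>auto simp: M_def \<xi>\<eta>(2) split: if_splits\<close>)
      then show ?thesis using s t by (simp add: sum.delta mem_Times_iff)
    qed
    show ?thesis using 1 by (rule mat_bound_cong[THEN iffD1, rotated]) (rule 2)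
  qed
  let ?S = "{op_norm p ({..<m} \<times> {..<n}) (matrix_op ({..<m} \<times> {..<n}) (pairing_mat X f)) |m X. PM_ball m X}"
  have "x \<le> K" if x: "x \<in> ?S" for x
  proof -
    obtain m X where X: "PM_ball m X"
      and x: "x = op_norm p ({..<m} \<times> {..<n}) (matrix_op ({..<m} \<times> {..<n}) (pairing_mat X f))" using x by blast
    show "x \<le> K" unfolding x using bd[OF X] K by (subst op_norm_matrix_op_le_iff) auto
  qed
  then have "bdd_above ?S" by (auto simp: bdd_above_def)
  then have le: "op_norm p ({..<m} \<times> {..<n}) (matrix_op ({..<m} \<times> {..<n}) (pairing_mat X f)) \<le> Ap_mat_norm p n f"
    unfolding Ap_mat_norm_eq using X by (intro cSup_upper) blast
  have "0 \<le> op_norm p ({..<m} \<times> {..<n}) (matrix_op ({..<m} \<times> {..<n}) (pairing_mat X f))"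
  proof -
    have "matrix_op ({..<m} \<times> {..<n}) (pairing_mat X f) g = mat_op p ({..<m} \<times> {..<n}) (pairing_mat X f) g"
      if "g \<in> lp p ({..<m} \<times> {..<n})" for g
      using that by (auto simp: matrix_op_def mat_op_def)
    then show ?thesis
      using op_norm_nonneg[OF bounded_op_if_lp_ops[OF mat_op_in_lp_ops[OF bd[OF X]]]]
      by (subst op_norm_cong) auto
  qed
  with le have "0 \<le> Ap_mat_norm p n f" by simp
  then show ?thesis using le by (simp add: op_norm_matrix_op_le_iff)
qed

lemma Ap_mat_norm_nonneg:
  fixes f :: "nat \<Rightarrow> nat \<Rightarrow> 'g::group_add \<Rightarrow> complex"
  assumes "\<And>i j. i < n \<Longrightarrow> j < n \<Longrightarrow> f i j \<in> Ap p"
  shows "0 \<le> Ap_mat_norm p n f"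
  by (rule mat_bound_nonneg[OF Ap_mat_norm_bound[OF assms PM_ball_0]])

text \<open>Pairing with \<open>X\<close> gives the entries of \<open>X k l\<close> at
  \<open>(\<kappa> i, \<kappa> j)\<close>, a submatrix of the block matrix of \<open>X\<close>;
  injectivity of \<open>\<kappa>\<close> makes the relabelling of rows and columns
  injective.\<close>

lemma Ap_mat_norm_delta_diff:
  fixes \<kappa> :: "nat \<Rightarrow> 'g::group_add"
  assumes \<kappa>: "inj_on \<kappa> {..<n}"
  shows "Ap_mat_norm p n (\<lambda>i j. delta (\<kappa> i - \<kappa> j)) \<le> 1"
proof (rule Ap_mat_norm_le)
  fix m and X :: "nat \<Rightarrow> nat \<Rightarrow> ('g \<Rightarrow> complex) \<Rightarrow> 'g \<Rightarrow> complex" assume X: "PM_ball m X"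
  have Xb: "bounded_op p UNIV (X k l)" if "k < m" "l < m" for k l using X that by (intro PM_bounded_op) simp
  have "mat_bound p ({..<m} \<times> UNIV) (\<lambda>(k, s) (l, t). entry (X k l) s t) 1"
    using PM_mat_norm_le_iff[of m X 1, OF Xb] X by simp
  then have "mat_bound p ({..<m} \<times> {..<n}) (\<lambda>s t. (case (case s of (k, i) \<Rightarrow> (k, \<kappa> i)) of (k, s) \<Rightarrow> \<lambda>(l, t). entry (X k l) s t)
      (case t of (k, i) \<Rightarrow> (k, \<kappa> i))) 1"
    by (rule mat_bound_reindex) (use \<kappa> in \<open>auto simp: inj_on_def\<close>)
  then show "mat_bound p ({..<m} \<times> {..<n}) (pairing_mat X (\<lambda>i j. delta (\<kappa> i - \<kappa> j))) 1"
    by (rule mat_bound_cong[THEN iffD1, rotated]) (use X in \<open>auto simp: PM_pairing_delta_diff\<close>)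
qed simp

lemma amplified_norm_le_Mcb_norm:
  assumes u: "u \<in> Mcb p" and f: "\<And>i j. i < n \<Longrightarrow> j < n \<Longrightarrow> f i j \<in> Ap p" "Ap_mat_norm p n f \<le> 1"
  shows "Ap_mat_norm p n (\<lambda>i j s. u s * f i j s) \<le> Mcb_norm p u"
  unfolding Mcb_norm_def
proof (rule cSup_upper)
  show "Ap_mat_norm p n (\<lambda>i j s. u s * f i j s) \<in> amplified_norms p u"
    unfolding amplified_norms_def using f by blast
  show "bdd_above (amplified_norms p u)" using u by (simp add: Mcb_def)
qed

lemma Mcb_Ap: "u \<in> Mcb p \<Longrightarrow> f \<in> Ap p \<Longrightarrow> (\<lambda>s. u s * f s) \<in> Ap p"
  by (simp add: Mcb_def)

text \<open>The multiplier norm is evaluated on the test functions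
  \<open>delta (\<kappa> i - \<kappa> j)\<close>, paired with multiples of translations. The
  resulting matrix is indexed by pairs \<open>(k, i)\<close>; its rows and columns with
  \<open>\<kappa> i = \<pi> (e k)\<close> carry the entries
  \<open>u (\<pi> s - \<pi> t) * a s t\<close>, up to the factor \<open>C\<close>.\<close>

lemma mat_bound_Mcb:
  fixes \<pi> :: "'i \<Rightarrow> 'g::group_add"
  assumes u: "u \<in> Mcb p" and a: "mat_bound p I a C"
  shows "mat_bound p I (\<lambda>s t. u (\<pi> s - \<pi> t) * a s t) (C * Mcb_norm p u)"
proof -
  have main: "mat_bound p J (\<lambda>s t. u (\<pi> s - \<pi> t) * a s t) (C * Mcb_norm p u)"
    if J: "finite J" "J \<subseteq> I" and C: "C > 0" for J
  proof -
    have aJ: "mat_bound p J a C"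
      using mat_bound_reindex[OF a, of "\<lambda>x. x" J "\<lambda>x. x"] J by simp
    obtain e where e: "bij_betw e {..<card J} J"
      using ex_bij_betw_nat_finite[OF J(1)] by (auto simp: atLeast0LessThan)
    \<comment> \<open>\<open>\<pi>\<close> may take a value several times, so its image is
      enumerated separately from \<open>J\<close>: \<open>Ap_mat_norm_delta_diff\<close> requires
      distinct elements.\<close>
    obtain \<kappa> where \<kappa>: "bij_betw \<kappa> {..<card (\<pi> ` J)} (\<pi> ` J)"
      using ex_bij_betw_nat_finite[of "\<pi> ` J"] J(1) by (auto simp: atLeast0LessThan)
    define m where "m = card J"
    define n where "n = card (\<pi> ` J)"
    have e: "inj_on e {..<m}" "e ` {..<m} = J" using e by (auto simp: bij_betw_def m_def)
    have \<kappa>: "inj_on \<kappa> {..<n}" "\<kappa> ` {..<n} = \<pi> ` J" using \<kappa> by (auto simp: bij_betw_def n_def)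
    define g where "g k l = \<pi> (e k) - \<pi> (e l)" for k l
    \<comment> \<open>Dividing by \<open>C\<close> puts \<open>X\<close> into the unit ball; the
      factor is restored at the end.\<close>
    define x where "x k l = a (e k) (e l) / of_real C" for k l
    define X where "X k l = lambda_sum {g k l} (\<lambda>_. x k l)" for k l
    define f where "f i j = (delta (\<kappa> i - \<kappa> j) :: 'g \<Rightarrow> complex)" for i j
    have "mat_bound p J (\<lambda>s t. of_real (1 / C) * a s t) (norm (complex_of_real (1 / C)) * C)"
      by (rule mat_bound_scale[OF aJ])
    then have x: "mat_bound p {..<m} x 1"
      using mat_bound_reindex[of J "\<lambda>s t. of_real (1 / C) * a s t" 1 e "{..<m}" e] e C
      by (simp add: x_def[abs_def] norm_divide)
    have X: "PM_ball m X"
    proof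
      show "\<forall>k<m. \<forall>l<m. X k l \<in> PM p" by (simp add: X_def lambda_sum_in_PM)
      have "mat_bound p ({..<m} \<times> UNIV) (\<lambda>(k, s) (l, t). if s = \<pi> (e k) - \<pi> (e l) + t then x k l else 0) 1"
        by (rule mat_bound_translation_matrix[OF x])
      then have "mat_bound p ({..<m} \<times> UNIV) (\<lambda>(k, s) (l, t). entry (X k l) s t) 1"
        by (rule mat_bound_cong[THEN iffD1, rotated])
           (auto simp: X_def entry_lambda_sum g_def diff_eq_eq)
      then show "PM_mat_norm p m X \<le> 1"
        by (subst PM_mat_norm_le_iff) (auto simp: X_def lambda_sum_in_lp_ops bounded_op_if_lp_ops)
    qed
    have f: "f i j \<in> Ap p" for i j by (simp add: f_def delta_diff_in_Ap)
    have uf: "(\<lambda>s. u s * f i j s) \<in> Ap p" for i j by (rule Mcb_Ap[OF u f])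
    have "Ap_mat_norm p n f \<le> 1"
      using Ap_mat_norm_delta_diff[OF \<kappa>(1)] by (simp add: f_def[abs_def])
    then have le: "Ap_mat_norm p n (\<lambda>i j s. u s * f i j s) \<le> Mcb_norm p u"
      by (rule amplified_norm_le_Mcb_norm[OF u f])
    have "mat_bound p ({..<m} \<times> {..<n}) (pairing_mat X (\<lambda>i j s. u s * f i j s)) (Mcb_norm p u)"
      by (rule mat_bound_mono[OF Ap_mat_norm_bound[OF uf X] le])
    \<comment> \<open>Index \<open>k\<close> is completed by the \<open>i\<close> with
      \<open>\<kappa> i = \<pi> (e k)\<close>; for such rows and columns \<open>f i j\<close> equals
      1 at the group element by which \<open>X k l\<close> translates.\<close>
    define \<iota> where "\<iota> k = (k, the_inv_into {..<n} \<kappa> (\<pi> (e k)))" for k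
    have \<iota>: "the_inv_into {..<n} \<kappa> (\<pi> (e k)) < n" "\<kappa> (the_inv_into {..<n} \<kappa> (\<pi> (e k))) = \<pi> (e k)" if "k < m" for k
    proof -
      have "\<pi> (e k) \<in> \<kappa> ` {..<n}" using that e \<kappa> by auto
      then show "the_inv_into {..<n} \<kappa> (\<pi> (e k)) < n" "\<kappa> (the_inv_into {..<n} \<kappa> (\<pi> (e k))) = \<pi> (e k)"
        using the_inv_into_into[OF \<kappa>(1), of "\<pi> (e k)" "{..<n}"] f_the_inv_into_f[OF \<kappa>(1)] by auto
    qed
    have "mat_bound p {..<m} (\<lambda>k l. pairing_mat X (\<lambda>i j s. u s * f i j s) (\<iota> k) (\<iota> l)) (Mcb_norm p u)"
      by (rule mat_bound_reindex[OF \<open>mat_bound p ({..<m} \<times> {..<n}) _ _\<close>]) (auto simp: \<iota>_def inj_on_def intro: \<iota>)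
    then have "mat_bound p {..<m} (\<lambda>k l. u (g k l) * x k l) (Mcb_norm p u)"
      by (rule mat_bound_cong[THEN iffD1, rotated])
         (simp add: \<iota>_def X_def PM_pairing_lambda_sum[OF _ uf], simp add: f_def \<iota>(2) g_def delta_def mult.commute)
    from mat_bound_scale[OF this, of "of_real C"]
    have "mat_bound p {..<m} (\<lambda>k l. u (g k l) * a (e k) (e l)) (C * Mcb_norm p u)"
      using C by (simp add: x_def mult.left_commute)
    from mat_bound_reindex[OF this, of "the_inv_into {..<m} e" J "the_inv_into {..<m} e"]
    have "mat_bound p J (\<lambda>s t. u (g (the_inv_into {..<m} e s) (the_inv_into {..<m} e t)) *
        a (e (the_inv_into {..<m} e s)) (e (the_inv_into {..<m} e t))) (C * Mcb_norm p u)"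
      using e inj_on_the_inv_into[OF e(1)] the_inv_into_onto[OF e(1)] by simp
    then show ?thesis
      by (rule mat_bound_cong[THEN iffD1, rotated]) (use e in \<open>auto simp: g_def f_the_inv_into_f\<close>)
  qed
  have M: "0 \<le> Mcb_norm p u"
  proof -
    \<comment> \<open>The empty matrix lies in the unit ball, so the supremum defining
      \<open>Mcb_norm\<close> is at least a nonnegative number.\<close>
    have "(0::real) \<le> Ap_mat_norm p 0 (\<lambda>i j s. u s * 0)" by (rule Ap_mat_norm_nonneg) simp
    also have "\<dots> \<le> Mcb_norm p u"
      by (rule amplified_norm_le_Mcb_norm[OF u]) (auto intro!: Ap_mat_norm_le simp: mat_bound_def)
    finally show ?thesis .
  qed
  \<comment> \<open>The normalization by \<open>C\<close> is impossible for \<open>C = 0\<close>,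
    but then every entry vanishes.\<close>
  consider "C = 0" | "C > 0" using mat_bound_nonneg[OF a] by linarith
  then show ?thesis
  proof cases
    case 1
    then have "a s t = 0" if "s \<in> I" "t \<in> I" for s t using mat_bound_entry_le[OF a that] by simp
    then show ?thesis using mat_bound_cong[of I "\<lambda>s t. u (\<pi> s - \<pi> t) * a s t" "\<lambda>_ _. 0"] 1 by (simp add: mat_bound_zero)
  next
    case 2
    show ?thesis
    proof (rule mat_boundI)
      show "0 \<le> C * Mcb_norm p u" using 2 M by simp
      fix J and y z :: "'i \<Rightarrow> complex" assume J: "finite J" "J \<subseteq> I"
      show "norm (\<Sum>s\<in>J. \<Sum>t\<in>J. y s * (u (\<pi> s - \<pi> t) * a s t) * z t) \<le> C * Mcb_norm p u * fin_norm q J y * fin_norm p J z"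
        by (rule mat_boundD[OF main[OF J 2] J(1) order_refl])
    qed
  qed
qed

lemma Mcb_norm_nonneg:
  assumes "u \<in> Mcb p"
  shows "0 \<le> Mcb_norm p u"
proof -
  have "mat_bound p (UNIV :: unit set) (\<lambda>_ _. 0) 1" by (rule mat_bound_mono[OF mat_bound_zero]) simp
  from mat_bound_nonneg[OF mat_bound_Mcb[OF assms this, of "\<lambda>_. 0"]] show ?thesis by simp
qed

section \<open>The multipliers form a linear space that contains A_p\<close>

lemma McbI:
  assumes "\<And>f. f \<in> Ap p \<Longrightarrow> (\<lambda>s. u s * f s) \<in> Ap p"
    "\<And>n f. (\<And>i j. i < n \<Longrightarrow> j < n \<Longrightarrow> f i j \<in> Ap p) \<Longrightarrow> Ap_mat_norm p n f \<le> 1 \<Longrightarrow>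
       Ap_mat_norm p n (\<lambda>i j s. u s * f i j s) \<le> C"
  shows "u \<in> Mcb p"
  unfolding Mcb_def amplified_norms_def
  using assms by (auto simp: bdd_above_def intro!: exI[of _ C])

lemma one_in_Mcb: "(\<lambda>_. 1) \<in> Mcb p"
  by (rule McbI[where C = 1]) auto

lemma Mcb_add:
  fixes u v :: "'g::group_add \<Rightarrow> complex"
  assumes u: "u \<in> Mcb p" and v: "v \<in> Mcb p"
  shows "(\<lambda>s. u s + v s) \<in> Mcb p"
proof (rule McbI[where C = "Mcb_norm p u + Mcb_norm p v"])
  fix f :: "'g \<Rightarrow> complex" assume "f \<in> Ap p"
  then show "(\<lambda>s. (u s + v s) * f s) \<in> Ap p"
    using Ap_add[OF Mcb_Ap[OF u] Mcb_Ap[OF v]] by (simp add: distrib_right)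
next
  fix n and f :: "nat \<Rightarrow> nat \<Rightarrow> 'g \<Rightarrow> complex"
  assume f: "\<And>i j. i < n \<Longrightarrow> j < n \<Longrightarrow> f i j \<in> Ap p" "Ap_mat_norm p n f \<le> 1"
  show "Ap_mat_norm p n (\<lambda>i j s. (u s + v s) * f i j s) \<le> Mcb_norm p u + Mcb_norm p v"
  proof (rule Ap_mat_norm_le)
    fix m and X :: "nat \<Rightarrow> nat \<Rightarrow> ('g \<Rightarrow> complex) \<Rightarrow> 'g \<Rightarrow> complex" assume X: "PM_ball m X"
    have b: "mat_bound p ({..<m} \<times> {..<n}) (pairing_mat X (\<lambda>i j s. w s * f i j s)) (Mcb_norm p w)" if "w \<in> Mcb p" for w
      by (rule mat_bound_mono[OF Ap_mat_norm_bound[OF Mcb_Ap[OF that f(1)] X] amplified_norm_le_Mcb_norm[OF that f]])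
    have "mat_bound p ({..<m} \<times> {..<n}) (\<lambda>s t. pairing_mat X (\<lambda>i j s. u s * f i j s) s t + pairing_mat X (\<lambda>i j s. v s * f i j s) s t)
        (Mcb_norm p u + Mcb_norm p v)"
      by (rule mat_bound_add[OF b[OF u] b[OF v]])
    then show "mat_bound p ({..<m} \<times> {..<n}) (pairing_mat X (\<lambda>i j s. (u s + v s) * f i j s)) (Mcb_norm p u + Mcb_norm p v)"
      by (rule mat_bound_cong[THEN iffD1, rotated])
         (use X in \<open>auto simp: PM_pairing_add Mcb_Ap[OF u f(1)] Mcb_Ap[OF v f(1)] distrib_right\<close>)
  qed (simp add: Mcb_norm_nonneg u v)
qed

lemma Mcb_scale:
  fixes u :: "'g::group_add \<Rightarrow> complex"
  assumes u: "u \<in> Mcb p"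
  shows "(\<lambda>s. c * u s) \<in> Mcb p"
proof (rule McbI[where C = "norm c * Mcb_norm p u"])
  fix f :: "'g \<Rightarrow> complex" assume "f \<in> Ap p"
  then show "(\<lambda>s. c * u s * f s) \<in> Ap p"
    using Ap_scale[OF Mcb_Ap[OF u], of f c] by (simp add: mult.assoc)
next
  fix n and f :: "nat \<Rightarrow> nat \<Rightarrow> 'g \<Rightarrow> complex"
  assume f: "\<And>i j. i < n \<Longrightarrow> j < n \<Longrightarrow> f i j \<in> Ap p" "Ap_mat_norm p n f \<le> 1"
  show "Ap_mat_norm p n (\<lambda>i j s. c * u s * f i j s) \<le> norm c * Mcb_norm p u"
  proof (rule Ap_mat_norm_le)
    fix m and X :: "nat \<Rightarrow> nat \<Rightarrow> ('g \<Rightarrow> complex) \<Rightarrow> 'g \<Rightarrow> complex" assume X: "PM_ball m X"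
    have "mat_bound p ({..<m} \<times> {..<n}) (\<lambda>s t. c * pairing_mat X (\<lambda>i j s. u s * f i j s) s t) (norm c * Mcb_norm p u)"
      by (rule mat_bound_scale[OF mat_bound_mono[OF Ap_mat_norm_bound[OF Mcb_Ap[OF u f(1)] X] amplified_norm_le_Mcb_norm[OF u f]]])
    then show "mat_bound p ({..<m} \<times> {..<n}) (pairing_mat X (\<lambda>i j s. c * u s * f i j s)) (norm c * Mcb_norm p u)"
      by (rule mat_bound_cong[THEN iffD1, rotated])
         (use X in \<open>auto simp: PM_pairing_scale Mcb_Ap[OF u f(1)] mult.assoc\<close>)
  qed (simp add: Mcb_norm_nonneg u)
qed

text \<open>By \<open>PM_pairing_mult\<close> the multiplication moves to the \<open>PM\<close>
  side, where \<open>mat_bound_coefficient\<close>, applied through the group coordinate of the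
  block matrix, controls the norm.\<close>

lemma Ap_subset_Mcb:
  fixes u :: "'g::group_add \<Rightarrow> complex"
  assumes ct: "countable (UNIV :: 'g set)" and u: "u \<in> Ap p"
  shows "u \<in> Mcb p"
proof -
  obtain \<xi> \<eta> where nd: "nuclear_data p \<xi> \<eta>" and ue: "u = coefficient p \<xi> \<eta>" using u by (rule ApE)
  \<comment> \<open>The scaled function has nuclear bound at most 1, so its Schur multiplication
    maps the unit ball of matrices over \<open>PM\<close> into itself; adding 1 avoids division by
    0.\<close>
  define c where "c = complex_of_real (1 / (nuclear_bound p \<xi> \<eta> + 1))"
  note N = nuclear_bound_nonneg[OF nd]
  define \<eta>' where "\<eta>' = (\<lambda>n i. c * \<eta> n i)"
  have nd': "nuclear_data p \<xi> \<eta>'" unfolding \<eta>'_def by (rule nuclear_data_scale(1)[OF nd])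
  have "nuclear_bound p \<xi> \<eta>' = norm c * nuclear_bound p \<xi> \<eta>"
    unfolding \<eta>'_def by (rule nuclear_data_scale(2)[OF nd])
  also have "\<dots> \<le> 1" using N by (simp add: c_def norm_divide)
  finally have N': "nuclear_bound p \<xi> \<eta>' \<le> 1" .
  have u': "coefficient p \<xi> \<eta>' = (\<lambda>s. c * u s)"
    by (simp add: ue \<eta>'_def coefficient_def nuclear_data_scale(3)[OF nd] bounded_op_if_lp_ops[OF left_reg_in_lp_ops] fun_eq_iff)
  let ?v = "coefficient p \<xi> \<eta>'"
  have "?v \<in> Mcb p"
  proof (rule McbI[where C = 1])
    fix f :: "'g \<Rightarrow> complex" assume "f \<in> Ap p"
    then show "(\<lambda>s. ?v s * f s) \<in> Ap p" by (rule Ap_mult[OF ct coefficient_in_Ap[OF nd']])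
  next
    fix n and f :: "nat \<Rightarrow> nat \<Rightarrow> 'g \<Rightarrow> complex"
    assume f: "\<And>i j. i < n \<Longrightarrow> j < n \<Longrightarrow> f i j \<in> Ap p" "Ap_mat_norm p n f \<le> 1"
    show "Ap_mat_norm p n (\<lambda>i j s. ?v s * f i j s) \<le> 1"
    proof (rule Ap_mat_norm_le)
      fix m and X :: "nat \<Rightarrow> nat \<Rightarrow> ('g \<Rightarrow> complex) \<Rightarrow> 'g \<Rightarrow> complex" assume X: "PM_ball m X"
      have Xb: "bounded_op p UNIV (X k l)" if "k < m" "l < m" for k l using X that by (intro PM_bounded_op) simp
      define Y where "Y k l = schur_mult p ?v (X k l)" for k l
      have "mat_bound p ({..<m} \<times> UNIV) (\<lambda>(k, s) (l, t). entry (X k l) s t) 1"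
        using PM_mat_norm_le_iff[of m X 1, OF Xb] X by simp
      from mat_bound_mono[OF mat_bound_coefficient[OF nd' this, of snd]] N'
      have "mat_bound p ({..<m} \<times> UNIV) (\<lambda>s t. ?v (snd s - snd t) * (case s of (k, s) \<Rightarrow> \<lambda>(l, t). entry (X k l) s t) t) 1"
        by simp
      then have b: "mat_bound p ({..<m} \<times> UNIV) (\<lambda>(k, s) (l, t). entry (Y k l) s t) 1"
        by (rule mat_bound_cong[THEN iffD1, rotated]) (auto simp: Y_def entry_schur_mult)
      have Ym: "\<forall>k<m. \<forall>l<m. Y k l \<in> PM p" using X by (simp add: Y_def schur_mult_PM[OF ct nd'])
      have Yb: "bounded_op p UNIV (Y k l)" if "k < m" "l < m" for k l using Ym that by (intro PM_bounded_op) simp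
      have "PM_mat_norm p m Y \<le> 1" using b PM_mat_norm_le_iff[of m Y 1, OF Yb] by simp
      with Ym have Y: "PM_ball m Y" by blast
      have "mat_bound p ({..<m} \<times> {..<n}) (pairing_mat Y f) 1"
        by (rule mat_bound_mono[OF Ap_mat_norm_bound[OF f(1) Y] f(2)])
      then show "mat_bound p ({..<m} \<times> {..<n}) (pairing_mat X (\<lambda>i j s. ?v s * f i j s)) 1"
        by (rule mat_bound_cong[THEN iffD1, rotated])
           (use X in \<open>auto simp: Y_def PM_pairing_mult[OF ct nd' _ f(1)]\<close>)
    qed simp
  qed
  from Mcb_scale[OF this, of "1 / c"] have "(\<lambda>s. 1 / c * (c * u s)) \<in> Mcb p" by (simp add: u')
  moreover have "c \<noteq> 0"
  proof -
    have "nuclear_bound p \<xi> \<eta> + 1 \<noteq> 0" using N by simp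
    then show ?thesis unfolding c_def by (metis divide_eq_0_iff of_real_eq_0_iff zero_neq_one)
  qed
  ultimately show ?thesis by simp
qed

section \<open>The algebras of the translation approximation property\<close>

lemma
  assumes S: "S \<in> lp_ops p UNIV" and T: "T \<in> lp_ops p UNIV"
  shows lp_ops_add: "(\<lambda>f\<in>lp p UNIV. \<lambda>i. S f i + T f i) \<in> lp_ops p UNIV"
    and entry_add: "entry (\<lambda>f\<in>lp p UNIV. \<lambda>i. S f i + T f i) s t = entry S s t + entry T s t"
    and lp_ops_compose: "compose (lp p UNIV) S T \<in> lp_ops p UNIV"
    and entry_compose: "entry (compose (lp p UNIV) S T) s t = (\<Sum>\<^sub>\<infinity>r. entry S s r * entry T r t)"
    and entry_compose_summable: "(\<lambda>r. entry S s r * entry T r t) summable_on UNIV"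
proof -
  note S' = bounded_op_if_lp_ops[OF S] and T' = bounded_op_if_lp_ops[OF T]
  have d: "delta t \<in> lp p UNIV" by (rule delta_in_lp[OF p_gt_1 UNIV_I])
  show "(\<lambda>f\<in>lp p UNIV. \<lambda>i. S f i + T f i) \<in> lp_ops p UNIV"
    by (rule restrict_in_lp_ops[OF bounded_op_plus[OF S' T']])
  show "compose (lp p UNIV) S T \<in> lp_ops p UNIV"
    unfolding compose_def by (rule restrict_in_lp_ops[OF bounded_op_compose[OF S' T']])
  show "entry (\<lambda>f\<in>lp p UNIV. \<lambda>i. S f i + T f i) s t = entry S s t + entry T s t"
    using d by (simp add: entry_def)
  note Sa = bounded_op_apply[OF S' bounded_op_lp[OF T' d] UNIV_I, of s]
  show "entry (compose (lp p UNIV) S T) s t = (\<Sum>\<^sub>\<infinity>r. entry S s r * entry T r t)"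
  proof -
    have "entry (compose (lp p UNIV) S T) s t = S (T (delta t)) s" using d by (simp add: entry_def compose_def)
    then show ?thesis using Sa(2) by (simp add: entry_def[of T])
  qed
  show "(\<lambda>r. entry S s r * entry T r t) summable_on UNIV"
    using abs_summable_summable[OF Sa(1)] by (simp add: entry_def[of T])
qed

lemma
  assumes T: "T \<in> lp_ops p UNIV"
  shows lp_ops_scale: "(\<lambda>f\<in>lp p UNIV. \<lambda>i. c * T f i) \<in> lp_ops p UNIV"
    and entry_scale: "entry (\<lambda>f\<in>lp p UNIV. \<lambda>i. c * T f i) s t = c * entry T s t"
proof -
  show "(\<lambda>f\<in>lp p UNIV. \<lambda>i. c * T f i) \<in> lp_ops p UNIV"
    by (rule restrict_in_lp_ops[OF bounded_op_times[OF bounded_op_if_lp_ops[OF T]]])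
  have "delta t \<in> lp p UNIV" by (rule delta_in_lp[OF p_gt_1 UNIV_I])
  then show "entry (\<lambda>f\<in>lp p UNIV. \<lambda>i. c * T f i) s t = c * entry T s t" by (simp add: entry_def)
qed

lemma mat_bound_compose:
  assumes S: "S \<in> lp_ops p UNIV" "mat_bound p UNIV (entry S) A"
    and T: "T \<in> lp_ops p UNIV" "mat_bound p UNIV (entry T) B"
  shows "mat_bound p UNIV (entry (compose (lp p UNIV) S T)) (A * B)"
proof -
  note S' = bounded_op_if_lp_ops[OF S(1)] and T' = bounded_op_if_lp_ops[OF T(1)]
  note A = mat_bound_nonneg[OF S(2)] and B = mat_bound_nonneg[OF T(2)]
  have nS: "op_norm p UNIV S \<le> A" using op_norm_le_iff[OF S' A] S(2) by simp
  have nT: "op_norm p UNIV T \<le> B" using op_norm_le_iff[OF T' B] T(2) by simp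
  show ?thesis
  proof (rule mat_bound_entryI)
    show "bounded_op p UNIV (compose (lp p UNIV) S T)" by (rule bounded_op_if_lp_ops[OF lp_ops_compose[OF S(1) T(1)]])
    show "0 \<le> A * B" using A B by simp
    fix f :: "'a \<Rightarrow> complex" assume f: "f \<in> lp p UNIV"
    have "lp_norm p (S (T f)) \<le> op_norm p UNIV S * lp_norm p (T f)"
      by (rule bounded_op_le[OF S' bounded_op_lp[OF T' f]])
    also have "\<dots> \<le> A * (op_norm p UNIV T * lp_norm p f)"
      by (intro mult_mono nS A bounded_op_le T' f lp_norm_nonneg)
    also have "\<dots> \<le> A * (B * lp_norm p f)"
      by (intro mult_left_mono mult_right_mono nT A lp_norm_nonneg)
    finally show "lp_norm p (compose (lp p UNIV) S T f) \<le> A * B * lp_norm p f"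
      using f by (simp add: compose_def mult.assoc)
  qed
qed

text \<open>The definition asks for a strict inequality while \<open>mat_bound\<close> is
  non-strict; halving \<open>\<epsilon>\<close> reconciles the two.\<close>

lemma op_closure_iff:
  assumes A: "A \<subseteq> lp_ops p UNIV"
  shows "T \<in> op_closure p A \<longleftrightarrow> T \<in> lp_ops p UNIV \<and>
    (\<forall>\<epsilon>>0. \<exists>S\<in>A. mat_bound p UNIV (\<lambda>s t. entry T s t - entry S s t) \<epsilon>)"
proof -
  have "(\<forall>\<epsilon>>0. \<exists>S\<in>A. op_norm p UNIV (\<lambda>f i. T f i - S f i) < \<epsilon>) \<longleftrightarrow>
      (\<forall>\<epsilon>>0. \<exists>S\<in>A. mat_bound p UNIV (\<lambda>s t. entry T s t - entry S s t) \<epsilon>)" if T: "T \<in> lp_ops p UNIV"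
  proof -
    have iff: "op_norm p UNIV (\<lambda>f i. T f i - S f i) \<le> \<epsilon> \<longleftrightarrow> mat_bound p UNIV (\<lambda>s t. entry T s t - entry S s t) \<epsilon>"
      if "S \<in> A" "0 < \<epsilon>" for S \<epsilon>
      using that A T by (intro op_norm_diff_le_iff bounded_op_if_lp_ops) auto
    show ?thesis
    proof (intro iffI allI impI)
      fix \<epsilon> :: real assume h: "\<forall>\<epsilon>>0. \<exists>S\<in>A. op_norm p UNIV (\<lambda>f i. T f i - S f i) < \<epsilon>" "0 < \<epsilon>"
      then obtain S where "S \<in> A" "op_norm p UNIV (\<lambda>f i. T f i - S f i) < \<epsilon>" by blast
      then show "\<exists>S\<in>A. mat_bound p UNIV (\<lambda>s t. entry T s t - entry S s t) \<epsilon>"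
        using iff[OF _ h(2), of S] by (intro bexI[of _ S]) auto
    next
      fix \<epsilon> :: real assume h: "\<forall>\<epsilon>>0. \<exists>S\<in>A. mat_bound p UNIV (\<lambda>s t. entry T s t - entry S s t) \<epsilon>" "0 < \<epsilon>"
      then have "0 < \<epsilon> / 2" by simp
      with h(1) obtain S where S: "S \<in> A" "mat_bound p UNIV (\<lambda>s t. entry T s t - entry S s t) (\<epsilon> / 2)" by blast
      then have "op_norm p UNIV (\<lambda>f i. T f i - S f i) \<le> \<epsilon> / 2" using iff[of S "\<epsilon> / 2"] h(2) by simp
      then show "\<exists>S\<in>A. op_norm p UNIV (\<lambda>f i. T f i - S f i) < \<epsilon>"
        using S h(2) by (intro bexI[of _ S]) auto
    qed
  qed
  then show ?thesis by (auto simp: op_closure_def)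
qed

lemma closed_subalgebraI:
  assumes "A \<subseteq> lp_ops p UNIV"
    "\<And>S T. S \<in> A \<Longrightarrow> T \<in> A \<Longrightarrow> (\<lambda>f\<in>lp p UNIV. \<lambda>i. S f i + T f i) \<in> A"
    "\<And>c T. T \<in> A \<Longrightarrow> (\<lambda>f\<in>lp p UNIV. \<lambda>i. c * T f i) \<in> A"
    "\<And>S T. S \<in> A \<Longrightarrow> T \<in> A \<Longrightarrow> compose (lp p UNIV) S T \<in> A"
    "\<And>T. T \<in> lp_ops p UNIV \<Longrightarrow> (\<And>\<epsilon>. \<epsilon> > 0 \<Longrightarrow> \<exists>S\<in>A. mat_bound p UNIV (\<lambda>s t. entry T s t - entry S s t) \<epsilon>) \<Longrightarrow> T \<in> A"
  shows "closed_subalgebra p A"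
  unfolding closed_subalgebra_def using assms by (auto simp: op_closure_iff)

lemma
  assumes A: "closed_subalgebra p A"
  shows closed_subalgebra_lp_ops: "T \<in> A \<Longrightarrow> T \<in> lp_ops p UNIV"
    and closed_subalgebra_add: "S \<in> A \<Longrightarrow> T \<in> A \<Longrightarrow> (\<lambda>f\<in>lp p UNIV. \<lambda>i. S f i + T f i) \<in> A"
    and closed_subalgebra_scale: "T \<in> A \<Longrightarrow> (\<lambda>f\<in>lp p UNIV. \<lambda>i. c * T f i) \<in> A"
    and closed_subalgebra_compose: "S \<in> A \<Longrightarrow> T \<in> A \<Longrightarrow> compose (lp p UNIV) S T \<in> A"
    and closed_subalgebra_closed: "T \<in> lp_ops p UNIV \<Longrightarrow>
      (\<And>\<epsilon>. \<epsilon> > 0 \<Longrightarrow> \<exists>S\<in>A. mat_bound p UNIV (\<lambda>s t. entry T s t - entry S s t) \<epsilon>) \<Longrightarrow> T \<in> A"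
proof -
  have sub: "A \<subseteq> lp_ops p UNIV" using A by (simp add: closed_subalgebra_def)
  then show "T \<in> A \<Longrightarrow> T \<in> lp_ops p UNIV" by auto
  show "S \<in> A \<Longrightarrow> T \<in> A \<Longrightarrow> (\<lambda>f\<in>lp p UNIV. \<lambda>i. S f i + T f i) \<in> A"
    and "T \<in> A \<Longrightarrow> (\<lambda>f\<in>lp p UNIV. \<lambda>i. c * T f i) \<in> A"
    and "S \<in> A \<Longrightarrow> T \<in> A \<Longrightarrow> compose (lp p UNIV) S T \<in> A"
    using A by (simp_all add: closed_subalgebra_def)
  assume "T \<in> lp_ops p UNIV"
    "\<And>\<epsilon>. \<epsilon> > 0 \<Longrightarrow> \<exists>S\<in>A. mat_bound p UNIV (\<lambda>s t. entry T s t - entry S s t) \<epsilon>"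
  then have "T \<in> op_closure p A" by (simp add: op_closure_iff[OF sub])
  then show "T \<in> A" using A by (auto simp: closed_subalgebra_def)
qed

lemma closed_subalgebra_lp_ops_UNIV: "closed_subalgebra p (lp_ops p UNIV)"
  by (rule closed_subalgebraI) (auto simp: lp_ops_add lp_ops_scale lp_ops_compose)

lemma closed_subalgebra_Inter:
  assumes "\<And>A. A \<in> \<A> \<Longrightarrow> closed_subalgebra p A" "B \<in> \<A>"
  shows "closed_subalgebra p (\<Inter>\<A>)"
proof (rule closed_subalgebraI)
  show "\<Inter>\<A> \<subseteq> lp_ops p UNIV" using closed_subalgebra_lp_ops[OF assms(1)[OF assms(2)]] assms(2) by auto
  fix T :: "('a \<Rightarrow> complex) \<Rightarrow> 'a \<Rightarrow> complex"
  show "T \<in> \<Inter>\<A>" if "T \<in> lp_ops p UNIV"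
    "\<And>\<epsilon>. \<epsilon> > 0 \<Longrightarrow> \<exists>S\<in>\<Inter>\<A>. mat_bound p UNIV (\<lambda>s t. entry T s t - entry S s t) \<epsilon>"
  proof
    fix A assume A: "A \<in> \<A>"
    show "T \<in> A"
    proof (rule closed_subalgebra_closed[OF assms(1)[OF A] that(1)])
      fix \<epsilon> :: real assume "\<epsilon> > 0"
      from that(2)[OF this] show "\<exists>S\<in>A. mat_bound p UNIV (\<lambda>s t. entry T s t - entry S s t) \<epsilon>"
        using A by blast
    qed
  qed
qed (auto intro: closed_subalgebra_add closed_subalgebra_scale closed_subalgebra_compose assms(1))

text \<open>Minimality reduces inclusions of \<open>F_lambda\<close> in a set to checking that this
  set is a closed subalgebra containing the translations; both uses below have this form.\<close>

lemma
  shows closed_subalgebra_F_lambda: "closed_subalgebra p (F_lambda p :: (('g::group_add \<Rightarrow> complex) \<Rightarrow> 'g \<Rightarrow> complex) set)"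
    and left_reg_in_F_lambda: "left_reg p s \<in> F_lambda p"
    and F_lambda_minimal: "closed_subalgebra p A \<Longrightarrow> (\<And>s. left_reg p s \<in> A) \<Longrightarrow> F_lambda p \<subseteq> A"
proof -
  show "closed_subalgebra p (F_lambda p :: (('g::group_add \<Rightarrow> complex) \<Rightarrow> 'g \<Rightarrow> complex) set)"
    unfolding F_lambda_def hull_def
    by (rule closed_subalgebra_Inter[where B = "lp_ops p UNIV"])
       (auto simp: closed_subalgebra_lp_ops_UNIV left_reg_in_lp_ops)
  show "left_reg p s \<in> F_lambda p" unfolding F_lambda_def by (rule hull_inc) simp
  show "closed_subalgebra p A \<Longrightarrow> (\<And>s. left_reg p s \<in> A) \<Longrightarrow> F_lambda p \<subseteq> A"
    unfolding F_lambda_def by (rule hull_minimal) auto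
qed

lemma finite_propagation_iff: "finite_propagation d T \<longleftrightarrow> (\<exists>R. \<forall>s t. entry T s t \<noteq> 0 \<longrightarrow> d s t \<le> R)"
  by (auto simp: finite_propagation_def bdd_above_def)

lemma uniform_Roe_iff:
  "T \<in> uniform_Roe p d \<longleftrightarrow> T \<in> lp_ops p UNIV \<and>
    (\<forall>\<epsilon>>0. \<exists>S\<in>lp_ops p UNIV. finite_propagation d S \<and> mat_bound p UNIV (\<lambda>s t. entry T s t - entry S s t) \<epsilon>)"
  unfolding uniform_Roe_def by (subst op_closure_iff) auto

lemma
  fixes g :: "'g::group_add"
  shows right_reg_in_lp_ops: "right_reg p g \<in> lp_ops p UNIV"
    and right_reg_apply: "f \<in> lp p UNIV \<Longrightarrow> right_reg p g f = (\<lambda>t. f (t + g))"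
proof -
  show *: "f \<in> lp p UNIV \<Longrightarrow> right_reg p g f = (\<lambda>t. f (t + g))" for f by (simp add: right_reg_def)
  have "bounded_op p UNIV (right_reg p g)"
    by (rule bounded_opI[where C = 1])
       (auto simp: * lp_add[OF p_gt_1] lp_scale[OF p_gt_1] lp_bij[OF bij_add_right] lp_norm_bij[OF bij_add_right])
  then show "right_reg p g \<in> lp_ops p UNIV" by (simp add: lp_ops_iff right_reg_def)
qed

text \<open>The conjugated operator has at \<open>(s, t)\<close> the entry of \<open>T\<close> at
  \<open>(s + g, t + g)\<close>, and operators are determined by their entries.\<close>

lemma right_reg_conj_fixed_iff:
  fixes T :: "('g::group_add \<Rightarrow> complex) \<Rightarrow> 'g \<Rightarrow> complex"
  assumes T: "T \<in> lp_ops p UNIV"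
  shows "compose (lp p UNIV) (right_reg p g) (compose (lp p UNIV) T (right_reg p (- g))) = T \<longleftrightarrow>
    (\<forall>s t. entry T (s + g) (t + g) = entry T s t)"
proof -
  let ?C = "compose (lp p UNIV) (right_reg p g) (compose (lp p UNIV) T (right_reg p (- g)))"
  have C: "?C \<in> lp_ops p UNIV" by (intro lp_ops_compose right_reg_in_lp_ops T)
  have e: "entry ?C s t = entry T (s + g) (t + g)" for s t
  proof -
    have d: "delta t \<in> lp p UNIV" for t :: 'g by (rule delta_in_lp[OF p_gt_1 UNIV_I])
    have "right_reg p (- g) (delta t) = delta (t + g)"
      unfolding right_reg_apply[OF d] by (auto simp: delta_def fun_eq_iff diff_eq_eq)
    then have "?C (delta t) = right_reg p g (T (delta (t + g)))"
      by (simp add: compose_def d)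
    also have "\<dots> = (\<lambda>s. T (delta (t + g)) (s + g))"
      by (rule right_reg_apply[OF bounded_op_lp[OF bounded_op_if_lp_ops[OF T] d]])
    finally show ?thesis by (simp add: entry_def)
  qed
  show ?thesis
  proof
    assume "?C = T"
    then show "\<forall>s t. entry T (s + g) (t + g) = entry T s t" using e by metis
  next
    assume "\<forall>s t. entry T (s + g) (t + g) = entry T s t"
    then show "?C = T" by (intro lp_ops_eqI C T) (simp add: e)
  qed
qed

lemma uniform_Roe_fixed_iff:
  "T \<in> uniform_Roe_fixed p d \<longleftrightarrow> T \<in> uniform_Roe p d \<and> (\<forall>g s t. entry T (s + g) (t + g) = entry T s t)"
  unfolding uniform_Roe_fixed_def by (auto simp: uniform_Roe_iff right_reg_conj_fixed_iff)

text \<open>The invariant part of the uniform Roe algebra is a closed subalgebra, and a left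
  translation by \<open>s\<close> has propagation at most \<open>d s 0\<close> because the metric is
  right invariant.\<close>

lemma F_lambda_subset_uniform_Roe_fixed:
  fixes d :: "'g::group_add \<Rightarrow> 'g \<Rightarrow> real"
  assumes d: "proper_right_invariant_metric d"
  shows "F_lambda p \<subseteq> uniform_Roe_fixed p d"
proof (rule F_lambda_minimal)
  have inv: "d (s + g) (t + g) = d s t" for s t g using d by (simp add: proper_right_invariant_metric_def)
  interpret Metric_space UNIV d using d by (simp add: proper_right_invariant_metric_def)
  show "left_reg p s \<in> uniform_Roe_fixed p d" for s
    unfolding uniform_Roe_fixed_iff uniform_Roe_iff
  proof (intro conjI allI impI)
    show "left_reg p s \<in> lp_ops p UNIV" by (rule left_reg_in_lp_ops)
    show "entry (left_reg p s) (a + g) (b + g) = entry (left_reg p s) a b" for g a b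
      by (simp add: entry_left_reg add.assoc[symmetric])
    fix \<epsilon> :: real assume e: "\<epsilon> > 0"
    have "finite_propagation d (left_reg p s)"
      unfolding finite_propagation_iff
    proof (intro exI[of _ "d s 0"] allI impI)
      fix a b assume "entry (left_reg p s) a b \<noteq> 0"
      then have "a = s + b" by (simp add: entry_left_reg split: if_splits)
      then show "d a b \<le> d s 0" using inv[of s b 0] by simp
    qed
    then show "\<exists>S\<in>lp_ops p UNIV. finite_propagation d S \<and> mat_bound p UNIV (\<lambda>a b. entry (left_reg p s) a b - entry S a b) \<epsilon>"
      using mat_bound_mono[OF mat_bound_zero, of \<epsilon> p UNIV] e
      by (intro bexI[of _ "left_reg p s"]) (auto simp: left_reg_in_lp_ops)
  qed
  show "closed_subalgebra p (uniform_Roe_fixed p d)"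
  proof (rule closed_subalgebraI)
    show "uniform_Roe_fixed p d \<subseteq> lp_ops p UNIV" by (auto simp: uniform_Roe_fixed_iff uniform_Roe_iff)
  next
    fix S T assume S: "S \<in> uniform_Roe_fixed p d" and T: "T \<in> uniform_Roe_fixed p d"
    have SL: "S \<in> lp_ops p UNIV" and TL: "T \<in> lp_ops p UNIV"
      using S T by (auto simp: uniform_Roe_fixed_iff uniform_Roe_iff)
    show "(\<lambda>f\<in>lp p UNIV. \<lambda>i. S f i + T f i) \<in> uniform_Roe_fixed p d"
      unfolding uniform_Roe_fixed_iff uniform_Roe_iff
    proof (intro conjI allI impI lp_ops_add SL TL)
      show "entry (\<lambda>f\<in>lp p UNIV. \<lambda>i. S f i + T f i) (s + g) (t + g) = entry (\<lambda>f\<in>lp p UNIV. \<lambda>i. S f i + T f i) s t" for g s t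
        using S T by (simp add: entry_add[OF SL TL] uniform_Roe_fixed_iff)
      fix \<epsilon> :: real assume "\<epsilon> > 0"
      then have e: "\<epsilon> / 2 > 0" by simp
      obtain S' where S': "S' \<in> lp_ops p UNIV" "finite_propagation d S'" "mat_bound p UNIV (\<lambda>s t. entry S s t - entry S' s t) (\<epsilon> / 2)"
        using S e unfolding uniform_Roe_fixed_iff uniform_Roe_iff by blast
      obtain T' where T': "T' \<in> lp_ops p UNIV" "finite_propagation d T'" "mat_bound p UNIV (\<lambda>s t. entry T s t - entry T' s t) (\<epsilon> / 2)"
        using T e unfolding uniform_Roe_fixed_iff uniform_Roe_iff by blast
      obtain R1 R2 where R: "\<And>s t. entry S' s t \<noteq> 0 \<Longrightarrow> d s t \<le> R1" "\<And>s t. entry T' s t \<noteq> 0 \<Longrightarrow> d s t \<le> R2"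
        using S'(2) T'(2) unfolding finite_propagation_iff by blast
      let ?U = "\<lambda>f\<in>lp p UNIV. \<lambda>i. S' f i + T' f i"
      have "finite_propagation d ?U"
        unfolding finite_propagation_iff
      proof (intro exI[of _ "max R1 R2"] allI impI)
        fix s t assume "entry ?U s t \<noteq> 0"
        then have "entry S' s t \<noteq> 0 \<or> entry T' s t \<noteq> 0" by (auto simp: entry_add[OF S'(1) T'(1)])
        then show "d s t \<le> max R1 R2" using R[of s t] by (auto simp: le_max_iff_disj)
      qed
      moreover have "mat_bound p UNIV (\<lambda>s t. entry (\<lambda>f\<in>lp p UNIV. \<lambda>i. S f i + T f i) s t - entry ?U s t) \<epsilon>"
        using mat_bound_add[OF S'(3) T'(3)] by (simp add: entry_add[OF SL TL] entry_add[OF S'(1) T'(1)] algebra_simps)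
      ultimately show "\<exists>U\<in>lp_ops p UNIV. finite_propagation d U \<and>
          mat_bound p UNIV (\<lambda>s t. entry (\<lambda>f\<in>lp p UNIV. \<lambda>i. S f i + T f i) s t - entry U s t) \<epsilon>"
        by (intro bexI[of _ ?U] conjI lp_ops_add S' T')
    qed
    show "compose (lp p UNIV) S T \<in> uniform_Roe_fixed p d"
      unfolding uniform_Roe_fixed_iff uniform_Roe_iff
    proof (intro conjI allI impI lp_ops_compose SL TL)
      fix g s t
      have "entry (compose (lp p UNIV) S T) (s + g) (t + g) = (\<Sum>\<^sub>\<infinity>r. entry S (s + g) (r + g) * entry T (r + g) (t + g))"
        unfolding entry_compose[OF SL TL] by (rule infsum_reindex_bij_betw[OF bij_add_right, symmetric])
      then show "entry (compose (lp p UNIV) S T) (s + g) (t + g) = entry (compose (lp p UNIV) S T) s t"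
        using S T by (simp add: entry_compose[OF SL TL] uniform_Roe_fixed_iff)
    next
      fix \<epsilon> :: real assume e: "\<epsilon> > 0"
      \<comment> \<open>The tolerances are chosen in this order: \<open>T'\<close> is close relative
        to the norm of \<open>S\<close>, then \<open>S'\<close> is close relative to the norm of
        \<open>T'\<close>. The error of the product is \<open>S (T - T') + (S - S') T'\<close>, each
        part bounded by \<open>\<epsilon> / 2\<close>.\<close>
      define A where "A = op_norm p UNIV S + 1"
      have A: "A > 0" using op_norm_nonneg[OF bounded_op_if_lp_ops[OF SL]] by (simp add: A_def)
      have "\<epsilon> / (2 * A) > 0" using e A by simp
      then obtain T' where T': "T' \<in> lp_ops p UNIV" "finite_propagation d T'" "mat_bound p UNIV (\<lambda>s t. entry T s t - entry T' s t) (\<epsilon> / (2 * A))"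
        using T unfolding uniform_Roe_fixed_iff uniform_Roe_iff by blast
      define B where "B = op_norm p UNIV T' + 1"
      have B: "B > 0" using op_norm_nonneg[OF bounded_op_if_lp_ops[OF T'(1)]] by (simp add: B_def)
      have "\<epsilon> / (2 * B) > 0" using e B by simp
      then obtain S' where S': "S' \<in> lp_ops p UNIV" "finite_propagation d S'" "mat_bound p UNIV (\<lambda>s t. entry S s t - entry S' s t) (\<epsilon> / (2 * B))"
        using S unfolding uniform_Roe_fixed_iff uniform_Roe_iff by blast
      obtain R1 R2 where R: "\<And>s t. entry S' s t \<noteq> 0 \<Longrightarrow> d s t \<le> R1" "\<And>s t. entry T' s t \<noteq> 0 \<Longrightarrow> d s t \<le> R2"
        using S'(2) T'(2) unfolding finite_propagation_iff by blast
      let ?U = "compose (lp p UNIV) S' T'"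
      have "finite_propagation d ?U"
        unfolding finite_propagation_iff
      proof (intro exI[of _ "R1 + R2"] allI impI)
        fix s t assume ne: "entry ?U s t \<noteq> 0"
        \<comment> \<open>A nonzero entry of the product needs an intermediate point, and the
          triangle inequality then adds the propagations.\<close>
        have "\<exists>r. entry S' s r * entry T' r t \<noteq> 0"
        proof (rule ccontr)
          assume "\<nexists>r. entry S' s r * entry T' r t \<noteq> 0"
          then have "(\<Sum>\<^sub>\<infinity>r. entry S' s r * entry T' r t) = 0" by (intro infsum_0) auto
          then show False using ne by (simp add: entry_compose[OF S'(1) T'(1)])
        qed
        then obtain r where "entry S' s r \<noteq> 0" "entry T' r t \<noteq> 0" by auto
        then have "d s r \<le> R1" "d r t \<le> R2" using R by auto
        then show "d s t \<le> R1 + R2" using triangle[of s r t] by simp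
      qed
      moreover have "mat_bound p UNIV (\<lambda>s t. entry (compose (lp p UNIV) S T) s t - entry ?U s t) \<epsilon>"
      proof -
        let ?m = "\<lambda>X. (\<lambda>f\<in>lp p UNIV. \<lambda>i. -1 * X f i)"
        let ?D = "\<lambda>f\<in>lp p UNIV. \<lambda>i. T f i + ?m T' f i"
        let ?E = "\<lambda>f\<in>lp p UNIV. \<lambda>i. S f i + ?m S' f i"
        have L: "?m T' \<in> lp_ops p UNIV" "?m S' \<in> lp_ops p UNIV" by (intro lp_ops_scale T' S')+
        have DL: "?D \<in> lp_ops p UNIV" "?E \<in> lp_ops p UNIV" by (intro lp_ops_add SL TL L)+
        have De: "entry ?D s t = entry T s t - entry T' s t" "entry ?E s t = entry S s t - entry S' s t" for s t
          by (simp_all only: entry_add[OF TL L(1)] entry_add[OF SL L(2)] entry_scale[OF T'(1)] entry_scale[OF S'(1)]) simp_all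
        have "mat_bound p UNIV (entry ?D) (\<epsilon> / (2 * A))" "mat_bound p UNIV (entry ?E) (\<epsilon> / (2 * B))"
          by (rule mat_bound_cong[THEN iffD2, OF De(1) T'(3)] mat_bound_cong[THEN iffD2, OF De(2) S'(3)])+
        moreover have "mat_bound p UNIV (entry S) A" "mat_bound p UNIV (entry T') B"
          unfolding A_def B_def by (rule mat_bound_mono[OF mat_bound_entry[OF bounded_op_if_lp_ops]]; simp add: SL T'(1))+
        ultimately have "mat_bound p UNIV (\<lambda>s t. entry (compose (lp p UNIV) S ?D) s t + entry (compose (lp p UNIV) ?E T') s t)
            (A * (\<epsilon> / (2 * A)) + (\<epsilon> / (2 * B)) * B)"
          by (intro mat_bound_add mat_bound_compose DL SL T')
        moreover have "A * (\<epsilon> / (2 * A)) + (\<epsilon> / (2 * B)) * B = \<epsilon>" using A B by simp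
        moreover have "entry (compose (lp p UNIV) S ?D) s t + entry (compose (lp p UNIV) ?E T') s t =
            entry (compose (lp p UNIV) S T) s t - entry ?U s t" for s t
        proof -
          have "entry (compose (lp p UNIV) S ?D) s t = entry (compose (lp p UNIV) S T) s t - entry (compose (lp p UNIV) S T') s t"
            unfolding entry_compose[OF SL DL(1)] entry_compose[OF SL TL] entry_compose[OF SL T'(1)] De
            using infsum_add[OF entry_compose_summable[OF SL TL] summable_on_cmult_right[OF entry_compose_summable[OF SL T'(1)], of "-1"], of s t s t]
            by (simp add: infsum_uminus right_diff_distrib)
          moreover have "entry (compose (lp p UNIV) ?E T') s t = entry (compose (lp p UNIV) S T') s t - entry ?U s t"
            unfolding entry_compose[OF DL(2) T'(1)] entry_compose[OF S'(1) T'(1)] entry_compose[OF SL T'(1)] De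
            using infsum_add[OF entry_compose_summable[OF SL T'(1)] summable_on_cmult_right[OF entry_compose_summable[OF S'(1) T'(1)], of "-1"], of s t s t]
            by (simp add: infsum_uminus left_diff_distrib)
          ultimately show ?thesis by simp
        qed
        ultimately show ?thesis by simp
      qed
      ultimately show "\<exists>U\<in>lp_ops p UNIV. finite_propagation d U \<and>
          mat_bound p UNIV (\<lambda>s t. entry (compose (lp p UNIV) S T) s t - entry U s t) \<epsilon>"
        by (intro bexI[of _ ?U] conjI lp_ops_compose S' T')
    qed
  next
    fix c T assume T: "T \<in> uniform_Roe_fixed p d"
    have TL: "T \<in> lp_ops p UNIV" using T by (auto simp: uniform_Roe_fixed_iff uniform_Roe_iff)
    show "(\<lambda>f\<in>lp p UNIV. \<lambda>i. c * T f i) \<in> uniform_Roe_fixed p d"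
      unfolding uniform_Roe_fixed_iff uniform_Roe_iff
    proof (intro conjI allI impI lp_ops_scale TL)
      show "entry (\<lambda>f\<in>lp p UNIV. \<lambda>i. c * T f i) (s + g) (t + g) = entry (\<lambda>f\<in>lp p UNIV. \<lambda>i. c * T f i) s t" for g s t
        using T by (simp add: entry_scale[OF TL] uniform_Roe_fixed_iff)
      fix \<epsilon> :: real assume e: "\<epsilon> > 0"
      then have "\<epsilon> / (norm c + 1) > 0" by (simp add: add_nonneg_pos)
      then obtain T' where T': "T' \<in> lp_ops p UNIV" "finite_propagation d T'" "mat_bound p UNIV (\<lambda>s t. entry T s t - entry T' s t) (\<epsilon> / (norm c + 1))"
        using T unfolding uniform_Roe_fixed_iff uniform_Roe_iff by blast
      let ?U = "\<lambda>f\<in>lp p UNIV. \<lambda>i. c * T' f i"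
      have "finite_propagation d ?U"
        using T'(2) by (auto simp: finite_propagation_iff entry_scale[OF T'(1)])
      moreover have "mat_bound p UNIV (\<lambda>s t. entry (\<lambda>f\<in>lp p UNIV. \<lambda>i. c * T f i) s t - entry ?U s t) \<epsilon>"
      proof -
        have pos: "norm c + 1 > 0" by (simp add: add_nonneg_pos)
        have "norm c * (\<epsilon> / (norm c + 1)) = norm c * \<epsilon> / (norm c + 1)" by simp
        also have "\<dots> \<le> \<epsilon>"
          by (subst pos_divide_le_eq[OF pos]) (use e in \<open>simp add: algebra_simps\<close>)
        finally have "norm c * (\<epsilon> / (norm c + 1)) \<le> \<epsilon>" .
        then show ?thesis
          using mat_bound_mono[OF mat_bound_scale[OF T'(3), of c]]
          by (simp add: entry_scale[OF TL] entry_scale[OF T'(1)] right_diff_distrib)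
      qed
      ultimately show "\<exists>U\<in>lp_ops p UNIV. finite_propagation d U \<and>
          mat_bound p UNIV (\<lambda>s t. entry (\<lambda>f\<in>lp p UNIV. \<lambda>i. c * T f i) s t - entry U s t) \<epsilon>"
        by (intro bexI[of _ ?U] conjI lp_ops_scale T')
    qed
  next
    fix T :: "('g \<Rightarrow> complex) \<Rightarrow> 'g \<Rightarrow> complex"
    assume TL: "T \<in> lp_ops p UNIV"
      and ap: "\<And>\<epsilon>. \<epsilon> > 0 \<Longrightarrow> \<exists>S\<in>uniform_Roe_fixed p d. mat_bound p UNIV (\<lambda>s t. entry T s t - entry S s t) \<epsilon>"
    show "T \<in> uniform_Roe_fixed p d"
      unfolding uniform_Roe_fixed_iff uniform_Roe_iff
    proof (intro conjI allI impI TL)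
      fix g s t
      \<comment> \<open>Each entry is bounded by the matrix norm, so invariance is inherited from
        the approximants.\<close>
      have "norm (entry T (s + g) (t + g) - entry T s t) \<le> 0 + e" if e: "e > 0" for e
      proof -
        obtain S where S: "S \<in> uniform_Roe_fixed p d" "mat_bound p UNIV (\<lambda>s t. entry T s t - entry S s t) (e / 2)"
          using ap[of "e / 2"] e by auto
        have "entry S (s + g) (t + g) = entry S s t" using S(1) by (simp add: uniform_Roe_fixed_iff)
        then show ?thesis
          using mat_bound_entry_le[OF S(2), of "s + g" "t + g"] mat_bound_entry_le[OF S(2), of s t]
            norm_triangle_ineq4[of "entry T (s + g) (t + g) - entry S (s + g) (t + g)" "entry T s t - entry S s t"]
          by simp
      qed
      then have "norm (entry T (s + g) (t + g) - entry T s t) \<le> 0" by (rule field_le_epsilon)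
      then show "entry T (s + g) (t + g) = entry T s t" by simp
    next
      fix \<epsilon> :: real assume "\<epsilon> > 0"
      then have e: "\<epsilon> / 2 > 0" by simp
      obtain S where S: "S \<in> uniform_Roe_fixed p d" "mat_bound p UNIV (\<lambda>s t. entry T s t - entry S s t) (\<epsilon> / 2)"
        using ap[OF e] by auto
      obtain S' where S': "S' \<in> lp_ops p UNIV" "finite_propagation d S'" "mat_bound p UNIV (\<lambda>s t. entry S s t - entry S' s t) (\<epsilon> / 2)"
        using S e unfolding uniform_Roe_fixed_iff uniform_Roe_iff by blast
      then show "\<exists>U\<in>lp_ops p UNIV. finite_propagation d U \<and> mat_bound p UNIV (\<lambda>s t. entry T s t - entry U s t) \<epsilon>"
        using mat_bound_add[OF S(2) S'(3)] by (intro bexI[of _ S']) auto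
    qed
  qed
qed

end

section \<open>Products of groups\<close>

text \<open>The operator \<open>1 \<otimes> R\<close>, acting as the identity in the first
  coordinate.\<close>

definition ampliation ::
  "real \<Rightarrow> (('h \<Rightarrow> complex) \<Rightarrow> ('h \<Rightarrow> complex)) \<Rightarrow> ('g \<times> 'h \<Rightarrow> complex) \<Rightarrow> ('g \<times> 'h \<Rightarrow> complex)" where
  "ampliation p R = mat_op p UNIV (\<lambda>x y. if fst x = fst y then entry R (snd x) (snd y) else 0)"

definition fst_mult ::
  "real \<Rightarrow> ('g::group_add \<Rightarrow> complex) \<Rightarrow> (('g \<times> 'h \<Rightarrow> complex) \<Rightarrow> ('g \<times> 'h \<Rightarrow> complex)) \<Rightarrow>
    ('g \<times> 'h \<Rightarrow> complex) \<Rightarrow> ('g \<times> 'h \<Rightarrow> complex)" where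
  "fst_mult p u T = mat_op p UNIV (\<lambda>x y. u (fst x - fst y) * entry T x y)"

lemma max_metric_proper:
  assumes dG: "proper_right_invariant_metric dG" and dH: "proper_right_invariant_metric dH"
  shows "proper_right_invariant_metric (max_metric dG dH)"
proof -
  interpret G: Metric_space UNIV dG using dG by (simp add: proper_right_invariant_metric_def)
  interpret H: Metric_space UNIV dH using dH by (simp add: proper_right_invariant_metric_def)
  show ?thesis
    unfolding proper_right_invariant_metric_def
  proof (intro conjI allI)
    show "Metric_space UNIV (max_metric dG dH)"
    proof
      fix x y z :: "'a \<times> 'b"
      show "0 \<le> max_metric dG dH x y" by (simp add: max_metric_def le_max_iff_disj)
      show "max_metric dG dH x y = max_metric dG dH y x"
        by (simp add: max_metric_def G.commute[of "fst x"] H.commute[of "snd x"])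
      have "max a b = 0 \<longleftrightarrow> a = 0 \<and> b = 0" if "0 \<le> a" "0 \<le> b" for a b :: real using that by linarith
      then show "max_metric dG dH x y = 0 \<longleftrightarrow> x = y"
        by (simp add: max_metric_def prod_eq_iff)
      show "max_metric dG dH x z \<le> max_metric dG dH x y + max_metric dG dH y z"
        unfolding max_metric_def
        using G.triangle[of "fst x" "fst y" "fst z"] H.triangle[of "snd x" "snd y" "snd z"] by (simp add: max_def)
    qed
    show "max_metric dG dH (s + g) (t + g) = max_metric dG dH s t" for s t g
      using dG dH by (simp add: max_metric_def proper_right_invariant_metric_def)
    fix x r
    have "{y. max_metric dG dH x y \<le> r} \<subseteq> {y. dG (fst x) y \<le> r} \<times> {y. dH (snd x) y \<le> r}"
      by (auto simp: max_metric_def)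
    moreover have "finite ({y. dG (fst x) y \<le> r} \<times> {y. dH (snd x) y \<le> r})"
      using dG dH by (simp add: proper_right_invariant_metric_def)
    ultimately show "finite {y. max_metric dG dH x y \<le> r}" by (rule finite_subset)
  qed
qed

lemma countable_if_proper_metric:
  fixes d :: "'g::group_add \<Rightarrow> 'g \<Rightarrow> real"
  assumes "proper_right_invariant_metric d"
  shows "countable (UNIV :: 'g set)"
proof -
  have "(UNIV :: 'g set) = (\<Union>n. {y. d 0 y \<le> real n})"
    using real_arch_simple by auto
  moreover have "finite {y. d 0 y \<le> real n}" for n
    using assms by (simp add: proper_right_invariant_metric_def)
  ultimately show ?thesis by (metis countable_UN countable_finite countableI_type)
qed

context lp_exponent
begin

text \<open>This is \<open>mat_bound_translation_matrix\<close> for the constant map with value 0,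
  with the two coordinates swapped.\<close>

lemma mat_bound_ampliation:
  assumes "mat_bound p UNIV a C"
  shows "mat_bound p (UNIV :: ('g::group_add \<times> 'h) set) (\<lambda>x y. if fst x = fst y then a (snd x) (snd y) else 0) C"
proof -
  have "mat_bound p (UNIV \<times> UNIV) (\<lambda>(k, s) (l, t). if s = (0::'g) - 0 + t then a k l else 0) C"
    by (rule mat_bound_translation_matrix[OF assms])
  from mat_bound_reindex[OF this, of prod.swap UNIV prod.swap] show ?thesis
    by (simp add: case_prod_unfold cong: if_cong)
qed

lemma
  fixes R S :: "('h::group_add \<Rightarrow> complex) \<Rightarrow> 'h \<Rightarrow> complex"
  assumes R: "R \<in> lp_ops p UNIV"
  shows ampliation_in_lp_ops: "(ampliation p R :: ('g::group_add \<times> 'h \<Rightarrow> complex) \<Rightarrow> _) \<in> lp_ops p UNIV"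
    and entry_ampliation: "entry (ampliation p R) x y = (if fst x = fst y then entry R (snd x) (snd y) else 0)"
proof -
  show "(ampliation p R :: ('g::group_add \<times> 'h \<Rightarrow> complex) \<Rightarrow> _) \<in> lp_ops p UNIV"
    unfolding ampliation_def
    by (rule mat_op_in_lp_ops[OF mat_bound_ampliation[OF mat_bound_entry[OF bounded_op_if_lp_ops[OF R]]]])
  show "entry (ampliation p R) x y = (if fst x = fst y then entry R (snd x) (snd y) else 0)"
    unfolding ampliation_def by (rule entry_mat_op) auto
qed

text \<open>The operators whose ampliation lies in \<open>F_lambda\<close> form a closed subalgebra,
  and the ampliation of the translation by \<open>s\<close> is the translation by
  \<open>(0, s)\<close>.\<close>

lemma ampliation_F_lambda:
  fixes R :: "('h::group_add \<Rightarrow> complex) \<Rightarrow> 'h \<Rightarrow> complex"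
  assumes R: "R \<in> F_lambda p"
  shows "(ampliation p R :: ('g::group_add \<times> 'h \<Rightarrow> complex) \<Rightarrow> _) \<in> F_lambda p"
proof -
  let ?am = "ampliation p :: _ \<Rightarrow> ('g \<times> 'h \<Rightarrow> complex) \<Rightarrow> _"
  let ?A = "{R \<in> lp_ops p UNIV. ?am R \<in> F_lambda p}"
  note F = closed_subalgebra_F_lambda
  have "F_lambda p \<subseteq> ?A"
  proof (rule F_lambda_minimal)
    fix s :: 'h
    have "?am (left_reg p s) = left_reg p (0, s)"
      by (rule lp_ops_eqI)
         (auto simp: ampliation_in_lp_ops left_reg_in_lp_ops entry_ampliation entry_left_reg prod_eq_iff)
    then show "left_reg p s \<in> ?A" by (simp add: left_reg_in_lp_ops left_reg_in_F_lambda)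
  next
    show "closed_subalgebra p ?A"
    proof (rule closed_subalgebraI)
      fix S T assume "S \<in> ?A" "T \<in> ?A"
      then have L: "S \<in> lp_ops p UNIV" "T \<in> lp_ops p UNIV" and M: "?am S \<in> F_lambda p" "?am T \<in> F_lambda p" by auto
      note LL = L[THEN ampliation_in_lp_ops]
      let ?s = "\<lambda>f\<in>lp p UNIV. \<lambda>i. S f i + T f i"
      have "?am ?s = (\<lambda>f\<in>lp p UNIV. \<lambda>i. ?am S f i + ?am T f i)"
        by (rule lp_ops_eqI[OF ampliation_in_lp_ops[OF lp_ops_add[OF L]] lp_ops_add[OF LL]])
           (simp add: entry_ampliation[OF lp_ops_add[OF L]] entry_add[OF LL] entry_add[OF L] entry_ampliation L)
      then show "?s \<in> ?A" using closed_subalgebra_add[OF F M] lp_ops_add[OF L] by simp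
      let ?c = "compose (lp p UNIV) S T"
      have "?am ?c = compose (lp p UNIV) (?am S) (?am T)"
      proof (rule lp_ops_eqI[OF ampliation_in_lp_ops[OF lp_ops_compose[OF L]] lp_ops_compose[OF LL]])
        fix x y :: "'g \<times> 'h"
        have inj: "inj (Pair (fst x) :: 'h \<Rightarrow> _)" by (simp add: inj_on_def)
        have "entry (compose (lp p UNIV) (?am S) (?am T)) x y = (\<Sum>\<^sub>\<infinity>r. entry (?am S) x r * entry (?am T) r y)"
          by (rule entry_compose[OF LL])
        \<comment> \<open>Only intermediate points with the first coordinate of \<open>x\<close>
          contribute, so the sum becomes one over the second group.\<close>
        also have "\<dots> = (\<Sum>\<^sub>\<infinity>r\<in>range (Pair (fst x)). entry (?am S) x r * entry (?am T) r y)"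
          by (rule infsum_cong_neutral) (auto simp: entry_ampliation L)
        also have "\<dots> = (\<Sum>\<^sub>\<infinity>r. entry (?am S) x (fst x, r) * entry (?am T) (fst x, r) y)"
          by (simp add: infsum_reindex[OF inj] o_def)
        also have "\<dots> = entry (?am ?c) x y"
          by (simp add: entry_ampliation[OF lp_ops_compose[OF L]] entry_ampliation L entry_compose[OF L])
        finally show "entry (?am ?c) x y = entry (compose (lp p UNIV) (?am S) (?am T)) x y" by simp
      qed
      then show "?c \<in> ?A" using closed_subalgebra_compose[OF F M] lp_ops_compose[OF L] by simp
    next
      fix c T assume "T \<in> ?A"
      then have L: "T \<in> lp_ops p UNIV" and M: "?am T \<in> F_lambda p" by auto
      let ?s = "\<lambda>f\<in>lp p UNIV. \<lambda>i. c * T f i"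
      have "?am ?s = (\<lambda>f\<in>lp p UNIV. \<lambda>i. c * ?am T f i)"
        by (rule lp_ops_eqI[OF ampliation_in_lp_ops[OF lp_ops_scale[OF L]] lp_ops_scale[OF ampliation_in_lp_ops[OF L]]])
           (simp add: entry_ampliation[OF lp_ops_scale[OF L]] entry_scale[OF ampliation_in_lp_ops[OF L]] entry_scale[OF L] entry_ampliation L)
      then show "?s \<in> ?A" using closed_subalgebra_scale[OF F M] lp_ops_scale[OF L] by simp
    next
      fix T :: "('h \<Rightarrow> complex) \<Rightarrow> 'h \<Rightarrow> complex"
      assume T: "T \<in> lp_ops p UNIV"
        and ap: "\<And>\<epsilon>. \<epsilon> > 0 \<Longrightarrow> \<exists>S\<in>?A. mat_bound p UNIV (\<lambda>s t. entry T s t - entry S s t) \<epsilon>"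
      have "?am T \<in> F_lambda p"
      proof (rule closed_subalgebra_closed[OF F ampliation_in_lp_ops[OF T]])
        fix \<epsilon> :: real assume "\<epsilon> > 0"
        from ap[OF this] obtain S where S: "S \<in> lp_ops p UNIV" "?am S \<in> F_lambda p"
          "mat_bound p UNIV (\<lambda>s t. entry T s t - entry S s t) \<epsilon>" by auto
        have "mat_bound p UNIV (\<lambda>x y. entry (?am T) x y - entry (?am S) x y) \<epsilon>"
          by (rule mat_bound_cong[THEN iffD1, OF _ mat_bound_ampliation[OF S(3)]])
             (simp add: entry_ampliation T S(1))
        then show "\<exists>U\<in>F_lambda p. mat_bound p UNIV (\<lambda>x y. entry (?am T) x y - entry U x y) \<epsilon>"
          using S(2) by blast
      qed
      then show "T \<in> ?A" using T by simp
    qed auto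
  qed
  then show ?thesis using R by blast
qed

lemma
  fixes \<xi> \<eta> :: "nat \<Rightarrow> 'g::group_add \<Rightarrow> complex" and T :: "('g \<times> 'h \<Rightarrow> complex) \<Rightarrow> 'g \<times> 'h \<Rightarrow> complex"
  assumes nd: "nuclear_data p \<xi> \<eta>" and T: "T \<in> lp_ops p UNIV"
  shows mat_bound_fst_mult: "mat_bound p UNIV (\<lambda>x y. coefficient p \<xi> \<eta> (fst x - fst y) * entry T x y)
      (op_norm p UNIV T * nuclear_bound p \<xi> \<eta>)"
    and fst_mult_in_lp_ops: "fst_mult p (coefficient p \<xi> \<eta>) T \<in> lp_ops p UNIV"
proof -
  show 1: "mat_bound p UNIV (\<lambda>x y. coefficient p \<xi> \<eta> (fst x - fst y) * entry T x y)
      (op_norm p UNIV T * nuclear_bound p \<xi> \<eta>)"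
    by (rule mat_bound_coefficient[OF nd mat_bound_entry[OF bounded_op_if_lp_ops[OF T]]])
  show "fst_mult p (coefficient p \<xi> \<eta>) T \<in> lp_ops p UNIV"
    unfolding fst_mult_def by (rule mat_op_in_lp_ops[OF 1])
qed

lemma entry_fst_mult: "entry (fst_mult p u T) x y = u (fst x - fst y) * entry T x y"
  by (simp add: fst_mult_def entry_mat_op)

lemma Ap_fst_mult_in_lp_ops:
  fixes T :: "('g::group_add \<times> 'h \<Rightarrow> complex) \<Rightarrow> 'g \<times> 'h \<Rightarrow> complex"
  assumes "u \<in> Ap p" "T \<in> lp_ops p UNIV"
  shows "fst_mult p u T \<in> lp_ops p UNIV"
  using assms by (auto elim!: ApE intro: fst_mult_in_lp_ops)

lemma delta_in_Ap: "delta g \<in> Ap p"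
  using delta_diff_in_Ap[of g 0] by simp

text \<open>By invariance, the part of \<open>T\<close> over \<open>g\<close> is \<open>\<lambda>(g, 0)\<close> composed with the ampliation of a
  translation invariant operator on the second factor.\<close>

lemma fst_mult_delta_F_lambda:
  fixes dG :: "'g::group_add \<Rightarrow> 'g \<Rightarrow> real" and dH :: "'h::group_add \<Rightarrow> 'h \<Rightarrow> real"
  assumes itap: "p_ITAP p dH" and T: "T \<in> uniform_Roe_fixed p (max_metric dG dH)"
  shows "fst_mult p (delta g) T \<in> F_lambda p"
proof -
  have TL: "T \<in> lp_ops p UNIV" and inv: "\<And>g s t. entry T (s + g) (t + g) = entry T s t"
    using T by (auto simp: uniform_Roe_fixed_iff uniform_Roe_iff)
  have slice: "mat_bound p UNIV (\<lambda>a b. M (g, a) (0, b)) C"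
    if "mat_bound p UNIV M C" for M C and g :: 'g
    by (rule mat_bound_reindex[OF that]) (auto simp: inj_on_def)
  \<comment> \<open>The block with rows over \<open>g\<close> and columns over 0. Right translation
    by \<open>(fst y, 0)\<close> carries it to every other block of \<open>T\<close> with the same
    difference of first coordinates, so it determines all of
    \<open>fst_mult p (delta g) T\<close>.\<close>
  define R where "R = mat_op p UNIV (\<lambda>a b. entry T (g, a) (0, b))"
  have RL: "R \<in> lp_ops p UNIV"
    unfolding R_def by (rule mat_op_in_lp_ops[OF slice[OF mat_bound_entry[OF bounded_op_if_lp_ops[OF TL]]]])
  have Re: "entry R a b = entry T (g, a) (0, b)" for a b by (simp add: R_def entry_mat_op)
  have "R \<in> uniform_Roe_fixed p dH"
    unfolding uniform_Roe_fixed_iff uniform_Roe_iff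
  proof (intro conjI allI impI RL)
    show "entry R (a + h) (b + h) = entry R a b" for h a b
      using inv[of "(g, a)" "(0, h)" "(0, b)"] by (simp add: Re)
    fix \<epsilon> :: real assume "\<epsilon> > 0"
    then obtain S where S: "S \<in> lp_ops p UNIV" "finite_propagation (max_metric dG dH) S"
      "mat_bound p UNIV (\<lambda>s t. entry T s t - entry S s t) \<epsilon>"
      using T unfolding uniform_Roe_fixed_iff uniform_Roe_iff by blast
    \<comment> \<open>The same block of an approximant: its propagation is controlled because
      \<open>dH\<close> on second coordinates is at most the maximum metric.\<close>
    define S' where "S' = mat_op p UNIV (\<lambda>a b. entry S (g, a) (0, b))"
    have SL: "S' \<in> lp_ops p UNIV"
      unfolding S'_def by (rule mat_op_in_lp_ops[OF slice[OF mat_bound_entry[OF bounded_op_if_lp_ops[OF S(1)]]]])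
    have Se: "entry S' a b = entry S (g, a) (0, b)" for a b by (simp add: S'_def entry_mat_op)
    obtain r where r: "\<And>x y. entry S x y \<noteq> 0 \<Longrightarrow> max_metric dG dH x y \<le> r"
      using S(2) unfolding finite_propagation_iff by blast
    have "finite_propagation dH S'"
      unfolding finite_propagation_iff
    proof (intro exI[of _ r] allI impI)
      fix a b assume "entry S' a b \<noteq> 0"
      then show "dH a b \<le> r" using r[of "(g, a)" "(0, b)"] by (simp add: Se max_metric_def)
    qed
    then show "\<exists>S\<in>lp_ops p UNIV. finite_propagation dH S \<and> mat_bound p UNIV (\<lambda>s t. entry R s t - entry S s t) \<epsilon>"
      using SL slice[OF S(3)] by (intro bexI[of _ S']) (simp_all add: Re Se)
  qed
  then have RF: "R \<in> F_lambda p" using itap by (simp add: p_ITAP_def)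
  let ?am = "ampliation p R :: ('g \<times> 'h \<Rightarrow> complex) \<Rightarrow> _"
  let ?l = "left_reg p (g, 0) :: ('g \<times> 'h \<Rightarrow> complex) \<Rightarrow> _"
  have aL: "?am \<in> lp_ops p UNIV" by (rule ampliation_in_lp_ops[OF RL])
  have "fst_mult p (delta g) T = compose (lp p UNIV) ?l ?am"
  proof (rule lp_ops_eqI[OF Ap_fst_mult_in_lp_ops[OF delta_in_Ap TL] lp_ops_compose[OF left_reg_in_lp_ops aL]])
    fix x y :: "'g \<times> 'h"
    have d: "delta y \<in> lp p UNIV" by (rule delta_in_lp[OF p_gt_1 UNIV_I])
    have "entry (compose (lp p UNIV) ?l ?am) x y = entry ?am (- (g, 0) + x) y"
      using d left_reg_apply[OF bounded_op_lp[OF bounded_op_if_lp_ops[OF aL] d]] by (simp add: entry_def compose_def)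
    also have "\<dots> = (if fst x - fst y = g then entry T (g, snd x) (0, snd y) else 0)"
    proof -
      have "- g + fst x = fst y \<longleftrightarrow> fst x - fst y = g"
        by (metis add.assoc add_diff_cancel diff_add_cancel minus_add_cancel add_minus_cancel)
      then show ?thesis by (simp add: entry_ampliation[OF RL] Re)
    qed
    also have "\<dots> = entry (fst_mult p (delta g) T) x y"
    proof (cases "fst x - fst y = g")
      case True
      then have "(g, snd x) + (fst y, 0) = x" "(0, snd y) + (fst y, 0) = y" by (auto simp: prod_eq_iff)
      then show ?thesis using inv[of "(g, snd x)" "(fst y, 0)" "(0, snd y)"] True by (simp add: entry_fst_mult delta_def)
    next
      case False
      then show ?thesis by (simp add: entry_fst_mult delta_def)
    qed
    finally show "entry (fst_mult p (delta g) T) x y = entry (compose (lp p UNIV) ?l ?am) x y" by simp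
  qed
  then show ?thesis
    using closed_subalgebra_compose[OF closed_subalgebra_F_lambda left_reg_in_F_lambda ampliation_F_lambda[OF RF]] by simp
qed

text \<open>Stated on entries, so that the nested restrictions in the operations of
  \<open>closed_subalgebra\<close> stay hidden where it is used.\<close>

lemma F_lambda_mat_sum:
  assumes "finite K" "\<And>k. k \<in> K \<Longrightarrow> S k \<in> F_lambda p"
  obtains U where "U \<in> F_lambda p" "\<And>x y. entry U x y = (\<Sum>k\<in>K. c k * entry (S k) x y)"
proof -
  note F = closed_subalgebra_F_lambda
  have "\<exists>U\<in>F_lambda p. \<forall>x y. entry U x y = (\<Sum>k\<in>K. c k * entry (S k) x y)"
    using assms
  proof (induction K rule: finite_induct)
    case empty
    let ?Z = "\<lambda>f\<in>lp p UNIV. \<lambda>i. 0 * left_reg p 0 f i"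
    have "?Z \<in> F_lambda p" by (rule closed_subalgebra_scale[OF F left_reg_in_F_lambda])
    then show ?case by (intro bexI[of _ ?Z]) (simp_all only: entry_scale[OF left_reg_in_lp_ops], simp)
  next
    case (insert k K)
    then obtain U where U: "U \<in> F_lambda p" "\<And>x y. entry U x y = (\<Sum>k\<in>K. c k * entry (S k) x y)" by auto
    have Sk: "S k \<in> F_lambda p" using insert by simp
    let ?V = "\<lambda>f\<in>lp p UNIV. \<lambda>i. c k * S k f i"
    let ?W = "\<lambda>f\<in>lp p UNIV. \<lambda>i. ?V f i + U f i"
    have V: "?V \<in> F_lambda p" by (rule closed_subalgebra_scale[OF F Sk])
    have W: "?W \<in> F_lambda p" by (rule closed_subalgebra_add[OF F V U(1)])
    have "entry ?W x y = (\<Sum>k\<in>insert k K. c k * entry (S k) x y)" for x y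
      unfolding entry_add[OF closed_subalgebra_lp_ops[OF F V] closed_subalgebra_lp_ops[OF F U(1)]]
        entry_scale[OF closed_subalgebra_lp_ops[OF F Sk]] using insert(1,2) by (simp add: U(2))
    with W show ?case by blast
  qed
  then show thesis using that by blast
qed

section \<open>Density of finitely supported functions in A_p\<close>

lemma nuclear_data_dominated:
  assumes nd: "nuclear_data p \<xi> \<eta>"
    and "\<And>n i. norm (\<xi>' n i) \<le> norm (\<xi> n i)" "\<And>n i. norm (\<eta>' n i) \<le> norm (\<eta> n i)"
  shows "nuclear_data p \<xi>' \<eta>'"
  unfolding nuclear_data_def
proof (intro conjI allI)
  show "\<xi>' n \<in> lp q UNIV" "\<eta>' n \<in> lp p UNIV" for n
    by (rule lp_dominated[OF q_gt_1 nuclear_dataD(1)[OF nd] assms(2)] lp_dominated[OF p_gt_1 nuclear_dataD(2)[OF nd] assms(3)])+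
  have "lp_norm q (\<xi>' n) * lp_norm p (\<eta>' n) \<le> lp_norm q (\<xi> n) * lp_norm p (\<eta> n)" for n
    by (intro mult_mono lp_norm_dominated[OF q_gt_1 nuclear_dataD(1)[OF nd] assms(2)]
        lp_norm_dominated[OF p_gt_1 nuclear_dataD(2)[OF nd] assms(3)]) auto
  then show "summable (\<lambda>n. lp_norm q (\<xi>' n) * lp_norm p (\<eta>' n))"
    by (intro summable_comparison_test'[OF nuclear_dataD(3)[OF nd], of 0]) auto
qed

lemma coefficient_split_left:
  assumes nd: "nuclear_data p \<xi> \<eta>" and nd': "nuclear_data p \<xi>' \<eta>"
  shows "coefficient p (\<lambda>n i. \<xi> n i + \<xi>' n i) \<eta> s = coefficient p \<xi> \<eta> s + coefficient p \<xi>' \<eta> s"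
proof -
  note L = bounded_op_if_lp_ops[OF left_reg_in_lp_ops[of s]]
  have "pairing (\<lambda>i. \<xi> n i + \<xi>' n i) (left_reg p s (\<eta> n)) = pairing (\<xi> n) (left_reg p s (\<eta> n)) + pairing (\<xi>' n) (left_reg p s (\<eta> n))" for n
    by (rule pairing_add_left[OF nuclear_dataD(1)[OF nd] nuclear_dataD(1)[OF nd'] bounded_op_lp[OF L nuclear_dataD(2)[OF nd]]])
  then show ?thesis
    unfolding coefficient_def nuclear_functional_def
    using suminf_add[OF summable_norm_cancel[OF nuclear_functional_infsum(2)[OF nd L]]
        summable_norm_cancel[OF nuclear_functional_infsum(2)[OF nd' L]]] by simp
qed

lemma coefficient_split_right:
  assumes nd: "nuclear_data p \<xi> \<eta>" and nd': "nuclear_data p \<xi> \<eta>'"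
  shows "coefficient p \<xi> (\<lambda>n i. \<eta> n i + \<eta>' n i) s = coefficient p \<xi> \<eta> s + coefficient p \<xi> \<eta>' s"
proof -
  note L = bounded_op_if_lp_ops[OF left_reg_in_lp_ops[of s]]
  have "pairing (\<xi> n) (left_reg p s (\<lambda>i. \<eta> n i + \<eta>' n i)) = pairing (\<xi> n) (left_reg p s (\<eta> n)) + pairing (\<xi> n) (left_reg p s (\<eta>' n))" for n
    unfolding bounded_op_add[OF L nuclear_dataD(2)[OF nd] nuclear_dataD(2)[OF nd']]
    by (rule pairing_add_right[OF nuclear_dataD(1)[OF nd] bounded_op_lp[OF L nuclear_dataD(2)[OF nd]] bounded_op_lp[OF L nuclear_dataD(2)[OF nd']]])
  then show ?thesis
    unfolding coefficient_def nuclear_functional_def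
    using suminf_add[OF summable_norm_cancel[OF nuclear_functional_infsum(2)[OF nd L]]
        summable_norm_cancel[OF nuclear_functional_infsum(2)[OF nd' L]]] by simp
qed

text \<open>The splitting is \<open>\<xi> \<otimes> \<eta> = b \<xi> \<otimes> \<eta> + a \<xi>
  \<otimes> b \<eta> + a \<xi> \<otimes> a \<eta>\<close>, where \<open>a\<close> keeps finitely
  many terms on a finite set and \<open>b\<close> is the remainder. The last summand gives
  \<open>u\<close>; the two errors stay separate data, each with its own nuclear bound.\<close>

lemma coefficient_finite_support_approx:
  fixes \<xi> \<eta> :: "nat \<Rightarrow> 'g::group_add \<Rightarrow> complex"
  assumes nd: "nuclear_data p \<xi> \<eta>" and e: "e > 0"
  obtains u y1 z1 y2 z2 where "finite {s. u s \<noteq> 0}" "nuclear_data p y1 z1" "nuclear_data p y2 z2"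
    "nuclear_bound p y1 z1 \<le> e" "nuclear_bound p y2 z2 \<le> e"
    "\<And>s. coefficient p \<xi> \<eta> s - u s = coefficient p y1 z1 s + coefficient p y2 z2 s"
proof -
  define w where "w n = lp_norm q (\<xi> n) * lp_norm p (\<eta> n)" for n
  have ws: "summable w" unfolding w_def by (rule nuclear_dataD(3)[OF nd])
  obtain N where N: "norm (\<Sum>i. w (i + N)) < e / 2"
    using suminf_exist_split[of "e / 2", OF _ ws] e by auto
  \<comment> \<open>The terms below \<open>N\<close> may cost at most \<open>e / 2\<close> together:
    with remainders of norm at most \<open>\<delta> = (e / 2) / D\<close> their sum is at most
    \<open>\<delta> * (D - 1)\<close>. The summand 1 keeps \<open>D\<close> positive.\<close>
  define D where "D = 1 + (\<Sum>n<N. lp_norm q (\<xi> n) + lp_norm p (\<eta> n))"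
  have D: "D > 0" unfolding D_def by (intro add_pos_nonneg sum_nonneg) auto
  define \<delta> where "\<delta> = (e / 2) / D"
  have \<delta>: "\<delta> > 0" using e D by (simp add: \<delta>_def)
  have "\<exists>J. finite J \<and> lp_norm q (\<lambda>i. if i \<in> J then 0 else \<xi> n i) < \<delta>" for n
    using lp_norm_restrict_complement[OF q_gt_1 nuclear_dataD(1)[OF nd] \<delta>] by metis
  then obtain J1 where J1: "\<And>n. finite (J1 n)" "\<And>n. lp_norm q (\<lambda>i. if i \<in> J1 n then 0 else \<xi> n i) < \<delta>" by metis
  have "\<exists>J. finite J \<and> lp_norm p (\<lambda>i. if i \<in> J then 0 else \<eta> n i) < \<delta>" for n
    using lp_norm_restrict_complement[OF p_gt_1 nuclear_dataD(2)[OF nd] \<delta>] by metis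
  then obtain J2 where J2: "\<And>n. finite (J2 n)" "\<And>n. lp_norm p (\<lambda>i. if i \<in> J2 n then 0 else \<eta> n i) < \<delta>" by metis
  define J where "J = (\<Union>n<N. J1 n \<union> J2 n)"
  have J: "finite J" unfolding J_def using J1 J2 by auto
  define a where "a f n i = (if n < N \<and> i \<in> J then f n i else 0)" for f :: "nat \<Rightarrow> 'g \<Rightarrow> complex" and n i
  define b where "b f n i = (if n < N \<and> i \<in> J then 0 else f n i)" for f :: "nat \<Rightarrow> 'g \<Rightarrow> complex" and n i
  have ab: "f = (\<lambda>n i. b f n i + a f n i)" for f by (auto simp: a_def b_def fun_eq_iff)
  have le: "norm (a f n i) \<le> norm (f n i)" "norm (b f n i) \<le> norm (f n i)" for f n i by (auto simp: a_def b_def)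
  have nd1: "nuclear_data p (b \<xi>) \<eta>" and nd2: "nuclear_data p (a \<xi>) (b \<eta>)"
    and nd3: "nuclear_data p (a \<xi>) \<eta>" and nd4: "nuclear_data p (a \<xi>) (a \<eta>)"
    by (rule nuclear_data_dominated[OF nd]; simp add: le)+
  have bound: "(\<Sum>n. v n) \<le> e"
    if v: "\<And>n. v n \<le> w n" "\<And>n. n < N \<Longrightarrow> v n \<le> \<delta> * (lp_norm q (\<xi> n) + lp_norm p (\<eta> n))" "\<And>n. 0 \<le> v n" for v
  proof -
    have vs: "summable v" by (rule summable_comparison_test'[OF ws, of 0]) (simp add: v)
    have "(\<Sum>n. v n) = (\<Sum>n. v (n + N)) + (\<Sum>n<N. v n)" by (rule suminf_split_initial_segment[OF vs])
    also have "(\<Sum>n. v (n + N)) \<le> (\<Sum>n. w (n + N))"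
      by (rule suminf_le) (simp_all add: v summable_ignore_initial_segment vs ws)
    also have "(\<Sum>n. w (n + N)) \<le> e / 2" using N by simp
    also have "(\<Sum>n<N. v n) \<le> (\<Sum>n<N. \<delta> * (lp_norm q (\<xi> n) + lp_norm p (\<eta> n)))"
      by (intro sum_mono v) simp
    also have "\<dots> = \<delta> * (D - 1)" by (simp add: D_def sum_distrib_left)
    also have "\<dots> \<le> \<delta> * D" using \<delta> by simp
    also have "\<dots> = e / 2" using D by (simp add: \<delta>_def)
    finally show ?thesis by simp
  qed
  have b1: "lp_norm q (b \<xi> n) \<le> \<delta>" if "n < N" for n
  proof -
    have "lp_norm q (b \<xi> n) \<le> lp_norm q (\<lambda>i. if i \<in> J1 n then 0 else \<xi> n i)"
    proof (rule lp_norm_dominated[OF q_gt_1])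
      show "(\<lambda>i. if i \<in> J1 n then 0 else \<xi> n i) \<in> lp q UNIV"
        by (rule lp_dominated[OF q_gt_1 nuclear_dataD(1)[OF nd, of n]]) simp
      show "norm (b \<xi> n i) \<le> norm (if i \<in> J1 n then 0 else \<xi> n i)" for i
        using that by (auto simp: b_def J_def)
    qed
    then show ?thesis using J1(2)[of n] by simp
  qed
  have b2: "lp_norm p (b \<eta> n) \<le> \<delta>" if "n < N" for n
  proof -
    have "lp_norm p (b \<eta> n) \<le> lp_norm p (\<lambda>i. if i \<in> J2 n then 0 else \<eta> n i)"
    proof (rule lp_norm_dominated[OF p_gt_1])
      show "(\<lambda>i. if i \<in> J2 n then 0 else \<eta> n i) \<in> lp p UNIV"
        by (rule lp_dominated[OF p_gt_1 nuclear_dataD(2)[OF nd, of n]]) simp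
      show "norm (b \<eta> n i) \<le> norm (if i \<in> J2 n then 0 else \<eta> n i)" for i
        using that by (auto simp: b_def J_def)
    qed
    then show ?thesis using J2(2)[of n] by simp
  qed
  have n\<xi>: "lp_norm q (b \<xi> n) \<le> lp_norm q (\<xi> n)" "lp_norm q (a \<xi> n) \<le> lp_norm q (\<xi> n)" for n
    by (rule lp_norm_dominated[OF q_gt_1 nuclear_dataD(1)[OF nd, of n]]; simp add: le)+
  have n\<eta>: "lp_norm p (b \<eta> n) \<le> lp_norm p (\<eta> n)" for n
    by (rule lp_norm_dominated[OF p_gt_1 nuclear_dataD(2)[OF nd, of n]]) (simp add: le)
  have B1: "nuclear_bound p (b \<xi>) \<eta> \<le> e"
    unfolding nuclear_bound_def
  proof (rule bound)
    show "lp_norm q (b \<xi> n) * lp_norm p (\<eta> n) \<le> w n" for n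
      unfolding w_def by (intro mult_right_mono n\<xi>) simp
    fix n assume "n < N"
    from mult_mono[OF b1[OF this], of "lp_norm p (\<eta> n)" "lp_norm q (\<xi> n) + lp_norm p (\<eta> n)"] \<delta>
    show "lp_norm q (b \<xi> n) * lp_norm p (\<eta> n) \<le> \<delta> * (lp_norm q (\<xi> n) + lp_norm p (\<eta> n))" by simp
  qed simp
  have B2: "nuclear_bound p (a \<xi>) (b \<eta>) \<le> e"
    unfolding nuclear_bound_def
  proof (rule bound)
    show "lp_norm q (a \<xi> n) * lp_norm p (b \<eta> n) \<le> w n" for n
      unfolding w_def by (intro mult_mono n\<xi> n\<eta>) simp_all
    fix n assume n: "n < N"
    have "lp_norm q (a \<xi> n) * lp_norm p (b \<eta> n) \<le> (lp_norm q (\<xi> n) + lp_norm p (\<eta> n)) * \<delta>"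
      using n\<xi>(2)[of n] by (intro mult_mono b2 n) (auto intro: order_trans[OF n\<xi>(2)])
    then show "lp_norm q (a \<xi> n) * lp_norm p (b \<eta> n) \<le> \<delta> * (lp_norm q (\<xi> n) + lp_norm p (\<eta> n))"
      by (simp add: mult.commute)
  qed simp
  have fin: "finite {s. coefficient p (a \<xi>) (a \<eta>) s \<noteq> 0}"
  proof (rule finite_subset)
    \<comment> \<open>Two vectors supported on \<open>J\<close> overlap after translation by
      \<open>s\<close> only if \<open>s\<close> is a difference of elements of
      \<open>J\<close>.\<close>
    show "finite ((\<lambda>(x, y). x - y) ` (J \<times> J))" using J by simp
    show "{s. coefficient p (a \<xi>) (a \<eta>) s \<noteq> 0} \<subseteq> (\<lambda>(x, y). x - y) ` (J \<times> J)"
    proof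
      fix s assume "s \<in> {s. coefficient p (a \<xi>) (a \<eta>) s \<noteq> 0}"
      then have ne: "(\<Sum>n. pairing (a \<xi> n) (left_reg p s (a \<eta> n))) \<noteq> 0"
        by (simp add: coefficient_def nuclear_functional_def)
      have "\<exists>n t. a \<xi> n t * a \<eta> n (- s + t) \<noteq> 0"
      proof (rule ccontr)
        assume "\<nexists>n t. a \<xi> n t * a \<eta> n (- s + t) \<noteq> 0"
        then have "pairing (a \<xi> n) (left_reg p s (a \<eta> n)) = 0" for n
          unfolding pairing_def left_reg_apply[OF nuclear_dataD(2)[OF nd4]] by (intro infsum_0) blast
        then show False using ne by simp
      qed
      then obtain n t where "a \<xi> n t \<noteq> 0" "a \<eta> n (- s + t) \<noteq> 0" by auto
      then have "t \<in> J" "- s + t \<in> J" by (auto simp: a_def split: if_splits)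
      moreover have "s = t - (- s + t)" by (simp add: diff_conv_add_uminus minus_add add.assoc[symmetric] del: add_uminus_conv_diff)
      ultimately show "s \<in> (\<lambda>(x, y). x - y) ` (J \<times> J)" by (metis (no_types, lifting) SigmaI case_prod_conv image_eqI)
    qed
  qed
  have "coefficient p \<xi> \<eta> s - coefficient p (a \<xi>) (a \<eta>) s = coefficient p (b \<xi>) \<eta> s + coefficient p (a \<xi>) (b \<eta>) s" for s
    using coefficient_split_left[OF nd1 nd3, of s] coefficient_split_right[OF nd2 nd4, of s] ab[of \<xi>, symmetric] ab[of \<eta>, symmetric]
    by simp
  with fin nd1 nd2 B1 B2 show thesis by (rule that)
qed

lemma fst_mult_Ap_F_lambda:
  fixes dG :: "'g::group_add \<Rightarrow> 'g \<Rightarrow> real" and dH :: "'h::group_add \<Rightarrow> 'h \<Rightarrow> real"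
  assumes itap: "p_ITAP p dH" and T: "T \<in> uniform_Roe_fixed p (max_metric dG dH)" and u: "u \<in> Ap p"
  shows "fst_mult p u T \<in> F_lambda p"
proof -
  have TL: "T \<in> lp_ops p UNIV" using T by (auto simp: uniform_Roe_fixed_iff uniform_Roe_iff)
  obtain \<xi> \<eta> where nd: "nuclear_data p \<xi> \<eta>" and ue: "u = coefficient p \<xi> \<eta>" using u by (rule ApE)
  show ?thesis
  proof (rule closed_subalgebra_closed[OF closed_subalgebra_F_lambda Ap_fst_mult_in_lp_ops[OF u TL]])
    fix \<epsilon> :: real assume e: "\<epsilon> > 0"
    define N where "N = op_norm p UNIV T + 1"
    have N: "N > 0" using op_norm_nonneg[OF bounded_op_if_lp_ops[OF TL]] by (simp add: N_def)
    \<comment> \<open>With this tolerance each of the two error functions changes the operator by at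
      most \<open>\<epsilon> / 2\<close>, by \<open>mat_bound_fst_mult\<close>.\<close>
    have e': "\<epsilon> / (2 * N) > 0" using e N by simp
    obtain v y1 z1 y2 z2 where v: "finite {s. v s \<noteq> 0}" and nds: "nuclear_data p y1 z1" "nuclear_data p y2 z2"
      and b: "nuclear_bound p y1 z1 \<le> \<epsilon> / (2 * N)" "nuclear_bound p y2 z2 \<le> \<epsilon> / (2 * N)"
      and eq: "\<And>s. coefficient p \<xi> \<eta> s - v s = coefficient p y1 z1 s + coefficient p y2 z2 s"
      by (rule coefficient_finite_support_approx[OF nd e']) blast
    obtain U where U: "U \<in> F_lambda p"
      "\<And>x y. entry U x y = (\<Sum>g\<in>{s. v s \<noteq> 0}. v g * entry (fst_mult p (delta g) T) x y)"
      by (rule F_lambda_mat_sum[OF v, of "\<lambda>g. fst_mult p (delta g) T" v])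
         (auto intro: fst_mult_delta_F_lambda[OF itap T])
    have Ue: "entry U x y = v (fst x - fst y) * entry T x y" for x y
    proof -
      have "entry U x y = (\<Sum>g\<in>{s. v s \<noteq> 0}. if g = fst x - fst y then v g * entry T x y else 0)"
        unfolding U(2) by (intro sum.cong refl) (simp add: entry_fst_mult delta_def)
      then show ?thesis using v by (simp add: sum.delta)
    qed
    have le: "op_norm p UNIV T * nuclear_bound p y z \<le> \<epsilon> / 2" if "nuclear_data p y z" "nuclear_bound p y z \<le> \<epsilon> / (2 * N)"
      for y z :: "nat \<Rightarrow> 'g \<Rightarrow> complex"
    proof -
      have "op_norm p UNIV T * nuclear_bound p y z \<le> N * (\<epsilon> / (2 * N))"
        using N that nuclear_bound_nonneg[OF that(1)] by (intro mult_mono) (auto simp: N_def)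
      then show ?thesis using N by simp
    qed
    have "mat_bound p UNIV (\<lambda>x y. coefficient p y1 z1 (fst x - fst y) * entry T x y + coefficient p y2 z2 (fst x - fst y) * entry T x y) (\<epsilon> / 2 + \<epsilon> / 2)"
      by (intro mat_bound_add mat_bound_mono[OF mat_bound_fst_mult[OF nds(1) TL] le[OF nds(1) b(1)]]
          mat_bound_mono[OF mat_bound_fst_mult[OF nds(2) TL] le[OF nds(2) b(2)]])
    then have "mat_bound p UNIV (\<lambda>x y. entry (fst_mult p u T) x y - entry U x y) \<epsilon>"
      by (simp add: entry_fst_mult Ue ue left_diff_distrib[symmetric] distrib_right[symmetric] eq)
    then show "\<exists>S\<in>F_lambda p. mat_bound p UNIV (\<lambda>x y. entry (fst_mult p u T) x y - entry S x y) \<epsilon>"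
      using U(1) by blast
  qed
qed

end

section \<open>Separation by the Hahn-Banach theorem\<close>

text \<open>Real sublinearity on a complex space. Only one inequality of positive homogeneity is
  demanded; the other follows by rescaling, in \<open>sublinear_scale\<close>.\<close>

definition sublinear_on :: "('x \<Rightarrow> complex) set \<Rightarrow> (('x \<Rightarrow> complex) \<Rightarrow> real) \<Rightarrow> bool" where
  "sublinear_on V f \<longleftrightarrow>
     (\<forall>x\<in>V. \<forall>y\<in>V. f (\<lambda>i. x i + y i) \<le> f x + f y) \<and>
     (\<forall>x\<in>V. \<forall>c\<ge>0. f (\<lambda>i. complex_of_real c * x i) \<le> c * f x)"

text \<open>The bounded matrices to which this is applied are a subset of a function type, so
  linearity is formulated relative to a set \<open>V\<close>.\<close>

locale complex_function_space =
  fixes V :: "('x \<Rightarrow> complex) set"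
  assumes add_mem: "x \<in> V \<Longrightarrow> y \<in> V \<Longrightarrow> (\<lambda>i. x i + y i) \<in> V"
    and scale_mem: "x \<in> V \<Longrightarrow> (\<lambda>i. c * x i) \<in> V"
begin

lemma uminus_mem: "x \<in> V \<Longrightarrow> (\<lambda>i. - x i) \<in> V"
  using scale_mem[of x "-1"] by simp

lemma
  assumes f: "sublinear_on V f"
  shows sublinear_add: "x \<in> V \<Longrightarrow> y \<in> V \<Longrightarrow> f (\<lambda>i. x i + y i) \<le> f x + f y"
    and sublinear_scale: "x \<in> V \<Longrightarrow> 0 \<le> c \<Longrightarrow> f (\<lambda>i. complex_of_real c * x i) = c * f x"
    and sublinear_neg: "x \<in> V \<Longrightarrow> - f (\<lambda>i. - x i) \<le> f x"
proof -
  show add: "x \<in> V \<Longrightarrow> y \<in> V \<Longrightarrow> f (\<lambda>i. x i + y i) \<le> f x + f y" for x y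
    using f by (simp add: sublinear_on_def)
  have le: "x \<in> V \<Longrightarrow> 0 \<le> c \<Longrightarrow> f (\<lambda>i. complex_of_real c * x i) \<le> c * f x" for x c
    using f by (simp add: sublinear_on_def)
  have zero: "f (\<lambda>_. 0) = 0" if "x \<in> V" for x
  proof -
    have 0: "(\<lambda>_. 0) \<in> V" using scale_mem[OF that, of 0] by simp
    show ?thesis using le[OF 0, of 0] add[OF 0 0] by simp
  qed
  show "f (\<lambda>i. complex_of_real c * x i) = c * f x" if x: "x \<in> V" and c: "0 \<le> c" for x c
  proof (cases "c = 0")
    case True
    then show ?thesis using zero[OF x] by simp
  next
    case False
    have "f (\<lambda>i. complex_of_real (1 / c) * (complex_of_real c * x i)) \<le> 1 / c * f (\<lambda>i. complex_of_real c * x i)"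
      by (rule le[OF scale_mem[OF x]]) (use c in simp)
    then have "f x \<le> 1 / c * f (\<lambda>i. complex_of_real c * x i)" using False by simp
    then have "c * f x \<le> f (\<lambda>i. complex_of_real c * x i)" using False c by (simp add: field_simps)
    then show ?thesis using le[OF x c] by simp
  qed
  show "- f (\<lambda>i. - x i) \<le> f x" if x: "x \<in> V" for x
    using add[OF x uminus_mem[OF x]] zero[OF x] by simp
qed

text \<open>\<open>g x\<close> is the infimum of \<open>f (x + t w) - t f w\<close> over
  \<open>t \<ge> 0\<close>. It has two uses: it forces a minimal sublinear functional to be odd, and
  it makes the functional obtained by Hahn-Banach nonzero at a prescribed vector.\<close>

lemma sublinear_shift:
  assumes f: "sublinear_on V f" and w: "w \<in> V"
  obtains g where "sublinear_on V g" "\<And>x. x \<in> V \<Longrightarrow> g x \<le> f x" "\<And>x. x \<notin> V \<Longrightarrow> g x = 0"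
    "g (\<lambda>i. - w i) \<le> - f w"
proof -
  define h where "h x t = f (\<lambda>i. x i + complex_of_real t * w i) - t * f w" for x t
  define g where "g x = (if x \<in> V then INF t\<in>{0..}. h x t else 0)" for x
  \<comment> \<open>This lower bound does not depend on \<open>t\<close>, so the infimum is
    finite.\<close>
  have low: "- f (\<lambda>i. - x i) \<le> h x t" if x: "x \<in> V" and t: "t \<ge> 0" for x t
  proof -
    have "f (\<lambda>i. (x i + complex_of_real t * w i) + - x i) \<le> f (\<lambda>i. x i + complex_of_real t * w i) + f (\<lambda>i. - x i)"
      by (intro sublinear_add[OF f] add_mem uminus_mem x scale_mem w)
    then show ?thesis using sublinear_scale[OF f w t] by (simp add: h_def)
  qed
  then have bdd: "bdd_below (h x ` {0..})" if "x \<in> V" for x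
    using that by (auto simp: bdd_below_def)
  have gle: "g x \<le> h x t" if "x \<in> V" "t \<ge> 0" for x t
    unfolding g_def using that bdd[OF that(1)] by (auto intro!: cINF_lower)
  have gI: "c \<le> g x" if "x \<in> V" "\<And>t. t \<ge> 0 \<Longrightarrow> c \<le> h x t" for c x
    unfolding g_def using that by (auto intro!: cINF_greatest)
  have "sublinear_on V g"
    unfolding sublinear_on_def
  proof (intro conjI ballI allI impI)
    fix x y assume x: "x \<in> V" and y: "y \<in> V"
    have *: "g (\<lambda>i. x i + y i) \<le> h x s + h y t" if st: "s \<ge> 0" "t \<ge> 0" for s t
    proof -
      have "g (\<lambda>i. x i + y i) \<le> h (\<lambda>i. x i + y i) (s + t)" using st by (intro gle add_mem x y) simp
      also have "\<dots> = f (\<lambda>i. (x i + complex_of_real s * w i) + (y i + complex_of_real t * w i)) - (s + t) * f w"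
        by (simp add: h_def algebra_simps)
      also have "\<dots> \<le> h x s + h y t"
        using sublinear_add[OF f add_mem[OF x scale_mem[OF w, of "complex_of_real s"]] add_mem[OF y scale_mem[OF w, of "complex_of_real t"]]]
        by (simp add: h_def algebra_simps)
      finally show ?thesis .
    qed
    have "g (\<lambda>i. x i + y i) - h x s \<le> g y" if "s \<ge> 0" for s
      using *[OF that] by (intro gI y) (simp add: algebra_simps)
    then have "g (\<lambda>i. x i + y i) - g y \<le> g x" by (intro gI x) (simp add: algebra_simps)
    then show "g (\<lambda>i. x i + y i) \<le> g x + g y" by simp
  next
    fix x and c :: real assume x: "x \<in> V" and c: "c \<ge> 0"
    have *: "g (\<lambda>i. complex_of_real c * x i) \<le> c * h x t" if t: "t \<ge> 0" for t
    proof -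
      have "g (\<lambda>i. complex_of_real c * x i) \<le> h (\<lambda>i. complex_of_real c * x i) (c * t)"
        using t c by (intro gle scale_mem x) simp
      also have "\<dots> = f (\<lambda>i. complex_of_real c * (x i + complex_of_real t * w i)) - c * t * f w"
        by (simp add: h_def algebra_simps)
      also have "\<dots> = c * h x t"
        unfolding sublinear_scale[OF f add_mem[OF x scale_mem[OF w]] c] by (simp add: h_def algebra_simps)
      finally show ?thesis .
    qed
    show "g (\<lambda>i. complex_of_real c * x i) \<le> c * g x"
    proof (cases "c = 0")
      case True
      then show ?thesis using *[of 0] by simp
    next
      case False
      then have "g (\<lambda>i. complex_of_real c * x i) / c \<le> g x"
        using * c by (intro gI x) (simp add: field_simps)
      then show ?thesis using False c by (simp add: field_simps)
    qed
  qed
  moreover have "g x \<le> f x" if "x \<in> V" for x using gle[OF that, of 0] by (simp add: h_def)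
  moreover have "g x = 0" if "x \<notin> V" for x using that by (simp add: g_def)
  moreover have "g (\<lambda>i. - w i) \<le> - f w"
    using gle[OF uminus_mem[OF w], of 1] sublinear_scale[OF f w, of 0] by (simp add: h_def)
  ultimately show thesis by (rule that)
qed

text \<open>A minimal sublinear functional is linear, by minimality against its shifts.\<close>

lemma exists_linear_below_sublinear:
  assumes f: "sublinear_on V f" and f0: "\<And>x. x \<notin> V \<Longrightarrow> f x = 0"
  obtains m where "sublinear_on V m" "\<And>x. x \<in> V \<Longrightarrow> m x \<le> f x" "\<And>x. x \<in> V \<Longrightarrow> m (\<lambda>i. - x i) = - m x"
    "\<And>x y. x \<in> V \<Longrightarrow> y \<in> V \<Longrightarrow> m (\<lambda>i. x i + y i) = m x + m y"
proof -
  \<comment> \<open>Vanishing outside \<open>V\<close> is imposed so that members agreeing on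
    \<open>V\<close> are equal, since the order compares functions on the whole type.\<close>
  define A where "A = {g. sublinear_on V g \<and> (\<forall>x\<in>V. g x \<le> f x) \<and> (\<forall>x. x \<notin> V \<longrightarrow> g x = 0)}"
  \<comment> \<open>The order is reversed, so the maximal element from Zorn's lemma is a minimal
    functional.\<close>
  define P where "P = (\<lambda>a b :: ('x \<Rightarrow> complex) \<Rightarrow> real. b \<le> a)"
  have fA: "f \<in> A" using f f0 by (simp add: A_def)
  have "\<exists>m\<in>A. \<forall>a\<in>A. P m a \<longrightarrow> a = m"
  proof (rule predicate_Zorn)
    show "partial_order_on A (relation_of P A)"
      by (rule partial_order_on_relation_ofI) (auto simp: P_def)
  next
    fix C assume C: "C \<in> Chains (relation_of P A)"
    then have CA: "C \<subseteq> A" and tot: "\<And>a b. a \<in> C \<Longrightarrow> b \<in> C \<Longrightarrow> a \<le> b \<or> b \<le> a"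
      by (auto simp: Chains_def relation_of_def P_def)
    show "\<exists>u\<in>A. \<forall>a\<in>C. P a u"
    proof (cases "C = {}")
      case True
      then show ?thesis using fA by blast
    next
      case False
      \<comment> \<open>The pointwise infimum of the chain; for subadditivity, two members of the
        chain are replaced by the smaller one.\<close>
      define u where "u x = (if x \<in> V then INF g\<in>C. g x else 0)" for x
      have CL: "sublinear_on V g" "\<And>x. x \<in> V \<Longrightarrow> g x \<le> f x" "\<And>x. x \<notin> V \<Longrightarrow> g x = 0" if "g \<in> C" for g
        using CA that by (auto simp: A_def)
      have "- f (\<lambda>i. - x i) \<le> g x" if "g \<in> C" "x \<in> V" for g x
        using sublinear_neg[OF CL(1)[OF that(1)] that(2)] CL(2)[OF that(1) uminus_mem[OF that(2)]] by simp
      then have bdd: "bdd_below ((\<lambda>g. g x) ` C)" if "x \<in> V" for x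
        using that by (auto simp: bdd_below_def)
      have ule: "u x \<le> g x" if "g \<in> C" for g x
        unfolding u_def using that bdd CL(3)[OF that] by (auto intro!: cINF_lower)
      have uI: "c \<le> u x" if "x \<in> V" "\<And>g. g \<in> C \<Longrightarrow> c \<le> g x" for c x
        unfolding u_def using that False by (auto intro!: cINF_greatest)
      have "sublinear_on V u"
        unfolding sublinear_on_def
      proof (intro conjI ballI allI impI)
        fix x y assume x: "x \<in> V" and y: "y \<in> V"
        have *: "u (\<lambda>i. x i + y i) \<le> g x + h y" if gh: "g \<in> C" "h \<in> C" for g h
        proof -
          have "\<exists>k\<in>C. k \<le> g \<and> k \<le> h" using tot[OF gh] gh by auto
          then obtain k where k: "k \<in> C" "k \<le> g" "k \<le> h" by blast
          have "u (\<lambda>i. x i + y i) \<le> k x + k y"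
            by (rule order_trans[OF ule[OF k(1)] sublinear_add[OF CL(1)[OF k(1)] x y]])
          also have "\<dots> \<le> g x + h y" using k by (intro add_mono) (auto simp: le_fun_def)
          finally show ?thesis .
        qed
        have "u (\<lambda>i. x i + y i) - g x \<le> u y" if "g \<in> C" for g
          using *[OF that] by (intro uI y) (simp add: algebra_simps)
        then have "u (\<lambda>i. x i + y i) - u y \<le> u x" by (intro uI x) (simp add: algebra_simps)
        then show "u (\<lambda>i. x i + y i) \<le> u x + u y" by simp
      next
        fix x and c :: real assume x: "x \<in> V" and c: "c \<ge> 0"
        have *: "u (\<lambda>i. complex_of_real c * x i) \<le> c * g x" if "g \<in> C" for g
          using ule[OF that, of "\<lambda>i. complex_of_real c * x i"] sublinear_scale[OF CL(1)[OF that] x c] by simp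
        show "u (\<lambda>i. complex_of_real c * x i) \<le> c * u x"
        proof (cases "c = 0")
          case True
          then show ?thesis using * False by auto
        next
          case False
          then have "u (\<lambda>i. complex_of_real c * x i) / c \<le> u x"
            using * c by (intro uI x) (simp add: field_simps)
          then show ?thesis using False c by (simp add: field_simps)
        qed
      qed
      moreover have "u x \<le> f x" if "x \<in> V" for x
      proof -
        obtain g where g: "g \<in> C" using False by blast
        show ?thesis using ule[OF g, of x] CL(2)[OF g that] by simp
      qed
      ultimately have "u \<in> A" by (simp add: A_def u_def)
      then show ?thesis using ule by (auto simp: P_def le_fun_def intro!: bexI[of _ u])
    qed
  qed
  then obtain m where mA: "m \<in> A" and min: "\<And>a. a \<in> A \<Longrightarrow> a \<le> m \<Longrightarrow> a = m" by (auto simp: P_def)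
  have m: "sublinear_on V m" "\<And>x. x \<in> V \<Longrightarrow> m x \<le> f x" "\<And>x. x \<notin> V \<Longrightarrow> m x = 0"
    using mA by (auto simp: A_def)
  have neg: "m (\<lambda>i. - x i) = - m x" if x: "x \<in> V" for x
  proof -
    obtain g where g: "sublinear_on V g" "\<And>x. x \<in> V \<Longrightarrow> g x \<le> m x" "\<And>x. x \<notin> V \<Longrightarrow> g x = 0"
      "g (\<lambda>i. - x i) \<le> - m x"
      by (rule sublinear_shift[OF m(1) x]) blast
    have "g \<in> A" using g m(2) by (fastforce simp: A_def)
    moreover have "g \<le> m"
    proof (rule le_funI)
      fix z show "g z \<le> m z" using g(2)[of z] g(3)[of z] m(3)[of z] by (cases "z \<in> V") auto
    qed
    ultimately have "g = m" by (rule min)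
    then show ?thesis using g(4) sublinear_neg[OF m(1) x] by simp
  qed
  have "m (\<lambda>i. x i + y i) = m x + m y" if xy: "x \<in> V" "y \<in> V" for x y
  proof -
    have "- m (\<lambda>i. x i + y i) \<le> - m x + - m y"
      using sublinear_add[OF m(1) uminus_mem[OF xy(1)] uminus_mem[OF xy(2)]] neg[OF add_mem[OF xy]] neg[OF xy(1)] neg[OF xy(2)]
      by (simp add: algebra_simps)
    then show ?thesis using sublinear_add[OF m(1) xy] by simp
  qed
  with m(1,2) neg show thesis by (rule that)
qed

text \<open>Shifting \<open>N\<close> by \<open>w\<close> before linearizing gives
  \<open>m (- w) \<le> - N w\<close>, hence \<open>m w \<ge> N w > 0\<close>. The complex functional
  is the usual \<open>m x - i m (i x)\<close>; estimating its two parts separately costs the factor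
  2, which is harmless here.\<close>

theorem hahn_banach_seminorm:
  fixes N :: "('x \<Rightarrow> complex) \<Rightarrow> real"
  assumes N_add: "\<And>x y. x \<in> V \<Longrightarrow> y \<in> V \<Longrightarrow> N (\<lambda>i. x i + y i) \<le> N x + N y"
    and N_scale: "\<And>c x. x \<in> V \<Longrightarrow> N (\<lambda>i. c * x i) \<le> norm c * N x"
    and w: "w \<in> V" "0 < N w"
  obtains \<psi> :: "('x \<Rightarrow> complex) \<Rightarrow> complex" where
    "\<And>x y. x \<in> V \<Longrightarrow> y \<in> V \<Longrightarrow> \<psi> (\<lambda>i. x i + y i) = \<psi> x + \<psi> y"
    "\<And>c x. x \<in> V \<Longrightarrow> \<psi> (\<lambda>i. c * x i) = c * \<psi> x"
    "\<And>x. x \<in> V \<Longrightarrow> norm (\<psi> x) \<le> 2 * N x"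
    "\<psi> w \<noteq> 0"
proof -
  have "sublinear_on V N" unfolding sublinear_on_def
  proof (intro conjI ballI allI impI N_add)
    fix x and c :: real assume "x \<in> V" "0 \<le> c"
    then show "N (\<lambda>i. complex_of_real c * x i) \<le> c * N x" using N_scale[of x "complex_of_real c"] by simp
  qed
  then obtain f where f: "sublinear_on V f" "\<And>x. x \<in> V \<Longrightarrow> f x \<le> N x" "\<And>x. x \<notin> V \<Longrightarrow> f x = 0"
    "f (\<lambda>i. - w i) \<le> - N w"
    by (rule sublinear_shift[OF _ w(1)]) blast
  obtain m where m: "sublinear_on V m" "\<And>x. x \<in> V \<Longrightarrow> m x \<le> f x" "\<And>x. x \<in> V \<Longrightarrow> m (\<lambda>i. - x i) = - m x"
    "\<And>x y. x \<in> V \<Longrightarrow> y \<in> V \<Longrightarrow> m (\<lambda>i. x i + y i) = m x + m y"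
    by (rule exists_linear_below_sublinear[OF f(1)]) (erule f(3), rule that)
  have mr: "m (\<lambda>i. complex_of_real c * x i) = c * m x" if x: "x \<in> V" for c x
  proof (cases "c \<ge> 0")
    case True
    then show ?thesis by (rule sublinear_scale[OF m(1) x])
  next
    case False
    have "m (\<lambda>i. - (complex_of_real c * x i)) = - c * m x"
      using sublinear_scale[OF m(1) x, of "- c"] False by simp
    then show ?thesis using m(3)[OF scale_mem[OF x, of "complex_of_real c"]] by simp
  qed
  have mN: "\<bar>m x\<bar> \<le> N x" if x: "x \<in> V" for x
  proof -
    have "- m x \<le> N (\<lambda>i. - x i)"
      using m(2)[OF uminus_mem[OF x]] m(3)[OF x] f(2)[OF uminus_mem[OF x]] by simp
    also have "\<dots> \<le> N x" using N_scale[OF x, of "-1"] by simp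
    finally show ?thesis using m(2)[OF x] f(2)[OF x] by simp
  qed
  define \<psi> where "\<psi> x = complex_of_real (m x) - \<i> * complex_of_real (m (\<lambda>i. \<i> * x i))" for x
  have add: "\<psi> (\<lambda>i. x i + y i) = \<psi> x + \<psi> y" if xy: "x \<in> V" "y \<in> V" for x y
    using m(4)[OF xy] m(4)[OF scale_mem[OF xy(1), of \<i>] scale_mem[OF xy(2), of \<i>]]
    by (simp add: \<psi>_def algebra_simps)
  have real: "\<psi> (\<lambda>i. complex_of_real c * x i) = complex_of_real c * \<psi> x" if x: "x \<in> V" for c x
    using mr[OF x, of c] mr[OF scale_mem[OF x, of \<i>], of c]
    by (simp add: \<psi>_def algebra_simps)
  have imag: "\<psi> (\<lambda>i. \<i> * x i) = \<i> * \<psi> x" if x: "x \<in> V" for x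
  proof -
    have "m (\<lambda>i. \<i> * (\<i> * x i)) = - m x" using m(3)[OF x] by (simp add: mult.assoc[symmetric])
    then show ?thesis by (simp add: \<psi>_def algebra_simps)
  qed
  have scale: "\<psi> (\<lambda>i. c * x i) = c * \<psi> x" if x: "x \<in> V" for c x
  proof -
    have "\<psi> (\<lambda>i. c * x i) = \<psi> (\<lambda>i. complex_of_real (Re c) * x i + complex_of_real (Im c) * (\<i> * x i))"
      by (subst complex_eq[of c]) (simp add: algebra_simps)
    also have "\<dots> = complex_of_real (Re c) * \<psi> x + complex_of_real (Im c) * (\<i> * \<psi> x)"
      by (simp add: add scale_mem x real imag)
    also have "\<dots> = (complex_of_real (Re c) + \<i> * complex_of_real (Im c)) * \<psi> x"
      by (simp add: algebra_simps)
    finally show ?thesis by (simp add: complex_eq[symmetric])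
  qed
  have bound: "norm (\<psi> x) \<le> 2 * N x" if x: "x \<in> V" for x
  proof -
    have "norm (\<psi> x) \<le> \<bar>m x\<bar> + \<bar>m (\<lambda>i. \<i> * x i)\<bar>"
      unfolding \<psi>_def by (rule order_trans[OF norm_triangle_ineq4]) (simp add: norm_mult)
    also have "\<dots> \<le> N x + N (\<lambda>i. \<i> * x i)" by (intro add_mono mN x scale_mem)
    also have "\<dots> \<le> 2 * N x" using N_scale[OF x, of \<i>] by simp
    finally show ?thesis .
  qed
  have "m w \<noteq> 0"
    using m(2)[OF uminus_mem[OF w(1)]] m(3)[OF w(1)] f(4) w(2) by simp
  then have "\<psi> w \<noteq> 0" by (auto simp: \<psi>_def complex_eq_iff)
  with add scale bound show thesis by (rule that)
qed

end

section \<open>The separating functional and its restriction to multipliers\<close>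

context lp_exponent
begin

text \<open>Hahn-Banach is applied to the distance to \<open>F_lambda\<close>: it vanishes on
  \<open>F_lambda\<close>, is positive at \<open>T\<close> because \<open>F_lambda\<close> is
  closed, and is at most \<open>C\<close> on a matrix with bound \<open>C\<close> because
  \<open>F_lambda\<close> contains 0. The functional lives on matrices, as functions of pairs, since
  the Schur multiples fed to it are given by entries.\<close>

lemma F_lambda_separation:
  fixes T :: "('i::group_add \<Rightarrow> complex) \<Rightarrow> 'i \<Rightarrow> complex"
  assumes T: "T \<in> lp_ops p UNIV" "T \<notin> F_lambda p"
  obtains \<psi> :: "('i \<times> 'i \<Rightarrow> complex) \<Rightarrow> complex" where
    "\<And>a b C D. mat_bound p UNIV (curry a) C \<Longrightarrow> mat_bound p UNIV (curry b) D \<Longrightarrow> \<psi> (\<lambda>i. a i + b i) = \<psi> a + \<psi> b"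
    "\<And>c a C. mat_bound p UNIV (curry a) C \<Longrightarrow> \<psi> (\<lambda>i. c * a i) = c * \<psi> a"
    "\<And>a C. mat_bound p UNIV (curry a) C \<Longrightarrow> norm (\<psi> a) \<le> 2 * C"
    "\<And>S. S \<in> F_lambda p \<Longrightarrow> \<psi> (case_prod (entry S)) = 0"
    "\<psi> (case_prod (entry T)) \<noteq> 0"
proof -
  note F = closed_subalgebra_F_lambda
  define V where "V = {a :: 'i \<times> 'i \<Rightarrow> complex. \<exists>C. mat_bound p UNIV (curry a) C}"
  define \<D> where "\<D> a = {C. \<exists>R\<in>F_lambda p. mat_bound p UNIV (\<lambda>s t. a (s, t) - entry R s t) C}" for a :: "'i \<times> 'i \<Rightarrow> complex"
  define N where "N a = Inf (\<D> a)" for a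
  obtain Z :: "('i \<Rightarrow> complex) \<Rightarrow> 'i \<Rightarrow> complex" where Z: "Z \<in> F_lambda p" "\<And>x y. entry Z x y = 0"
    by (rule F_lambda_mat_sum[of "{}" "\<lambda>_. left_reg p 0" "\<lambda>_. 0"]) auto
  have bdd: "bdd_below (\<D> a)" for a
    unfolding bdd_below_def \<D>_def using mat_bound_nonneg by blast
  have NI: "N a \<le> C" if "R \<in> F_lambda p" "mat_bound p UNIV (\<lambda>s t. a (s, t) - entry R s t) C" for a R C
    unfolding N_def using that by (intro cInf_lower bdd) (auto simp: \<D>_def)
  have NC: "N a \<le> C" if "mat_bound p UNIV (curry a) C" for a C
    using NI[OF Z(1), of a C] that by (simp add: Z(2) curry_def)
  have ne: "\<D> a \<noteq> {}" if aV: "a \<in> V" for a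
  proof -
    obtain C where "mat_bound p UNIV (curry a) C" using aV by (auto simp: V_def)
    then have "C \<in> \<D> a" unfolding \<D>_def using Z by (auto intro!: bexI[of _ Z] simp: curry_def)
    then show ?thesis by blast
  qed
  have NE: "\<exists>R\<in>F_lambda p. \<exists>C<N a + e. mat_bound p UNIV (\<lambda>s t. a (s, t) - entry R s t) C"
    if "a \<in> V" "e > 0" for a e
    using cInf_lessD[OF ne[OF that(1)], of "N a + e"] that(2) by (auto simp: N_def \<D>_def)
  interpret V: complex_function_space V
  proof
    fix a b assume "a \<in> V" "b \<in> V"
    then obtain C D where "mat_bound p UNIV (curry a) C" "mat_bound p UNIV (curry b) D" by (auto simp: V_def)
    from mat_bound_add[OF this] show "(\<lambda>i. a i + b i) \<in> V" by (auto simp: V_def curry_def)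
  next
    fix a c assume "a \<in> V"
    then obtain C where "mat_bound p UNIV (curry a) C" by (auto simp: V_def)
    from mat_bound_scale[OF this, of c] show "(\<lambda>i. c * a i) \<in> V" by (auto simp: V_def curry_def)
  qed
  have N_add: "N (\<lambda>i. a i + b i) \<le> N a + N b" if a: "a \<in> V" and b: "b \<in> V" for a b
  proof (rule field_le_epsilon)
    fix e :: real assume "e > 0"
    then have e: "e / 2 > 0" by simp
    obtain R C where R: "R \<in> F_lambda p" "C < N a + e / 2" "mat_bound p UNIV (\<lambda>s t. a (s, t) - entry R s t) C"
      using NE[OF a e] by blast
    obtain S D where S: "S \<in> F_lambda p" "D < N b + e / 2" "mat_bound p UNIV (\<lambda>s t. b (s, t) - entry S s t) D"
      using NE[OF b e] by blast
    have "N (\<lambda>i. a i + b i) \<le> C + D"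
      by (rule NI[OF closed_subalgebra_add[OF F R(1) S(1)]])
         (use mat_bound_add[OF R(3) S(3)] in
           \<open>simp add: entry_add[OF closed_subalgebra_lp_ops[OF F R(1)] closed_subalgebra_lp_ops[OF F S(1)]] algebra_simps\<close>)
    then show "N (\<lambda>i. a i + b i) \<le> N a + N b + e" using R(2) S(2) by simp
  qed
  have N_scale: "N (\<lambda>i. c * a i) \<le> norm c * N a" if a: "a \<in> V" for a c
  proof -
    have *: "N (\<lambda>i. c * a i) \<le> norm c * C" if C: "C \<in> \<D> a" for C
    proof -
      obtain R where R: "R \<in> F_lambda p" "mat_bound p UNIV (\<lambda>s t. a (s, t) - entry R s t) C"
        using C by (auto simp: \<D>_def)
      show ?thesis
        by (rule NI[OF closed_subalgebra_scale[OF F R(1)]])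
           (use mat_bound_scale[OF R(2), of c] in
             \<open>simp add: entry_scale[OF closed_subalgebra_lp_ops[OF F R(1)]] right_diff_distrib\<close>)
    qed
    show ?thesis
    proof (cases "c = 0")
      case True
      then show ?thesis using * ne[OF a] by auto
    next
      case False
      then have "N (\<lambda>i. c * a i) / norm c \<le> N a"
        unfolding N_def[of a] using * ne[OF a] by (intro cInf_greatest) (auto simp: field_simps)
      then show ?thesis using False by (simp add: field_simps)
    qed
  qed
  let ?T = "case_prod (entry T)"
  have TV: "?T \<in> V"
    using mat_bound_entry[OF bounded_op_if_lp_ops[OF T(1)]] by (auto simp: V_def)
  have "0 < N ?T"
  proof (rule ccontr)
    assume neg: "\<not> 0 < N ?T"
    have "T \<in> F_lambda p"
    proof (rule closed_subalgebra_closed[OF F T(1)])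
      fix \<epsilon> :: real assume e: "\<epsilon> > 0"
      obtain R C where R: "R \<in> F_lambda p" "C < N ?T + \<epsilon>" "mat_bound p UNIV (\<lambda>s t. ?T (s, t) - entry R s t) C"
        using NE[OF TV e] by blast
      have "mat_bound p UNIV (\<lambda>s t. entry T s t - entry R s t) \<epsilon>"
        using mat_bound_mono[OF R(3), of \<epsilon>] R(2) neg by simp
      then show "\<exists>S\<in>F_lambda p. mat_bound p UNIV (\<lambda>s t. entry T s t - entry S s t) \<epsilon>" using R(1) by blast
    qed
    then show False using T(2) by simp
  qed
  then obtain \<psi> where \<psi>: "\<And>x y. x \<in> V \<Longrightarrow> y \<in> V \<Longrightarrow> \<psi> (\<lambda>i. x i + y i) = \<psi> x + \<psi> y"
    "\<And>c x. x \<in> V \<Longrightarrow> \<psi> (\<lambda>i. c * x i) = c * \<psi> x"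
    "\<And>x. x \<in> V \<Longrightarrow> norm (\<psi> x) \<le> 2 * N x" "\<psi> ?T \<noteq> 0"
    using V.hahn_banach_seminorm[of N, OF N_add N_scale TV] by blast
  show thesis
  proof (rule that[of \<psi>])
    show "\<psi> (\<lambda>i. a i + b i) = \<psi> a + \<psi> b" if "mat_bound p UNIV (curry a) C" "mat_bound p UNIV (curry b) D" for a b C D
      using that by (intro \<psi>) (auto simp: V_def)
    show "\<psi> (\<lambda>i. c * a i) = c * \<psi> a" if "mat_bound p UNIV (curry a) C" for c a C
      using that by (intro \<psi>) (auto simp: V_def)
    show "norm (\<psi> a) \<le> 2 * C" if "mat_bound p UNIV (curry a) C" for a C
    proof -
      have "a \<in> V" unfolding V_def using that by blast
      then show ?thesis using \<psi>(3)[of a] NC[OF that] by simp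
    qed
    show "\<psi> (case_prod (entry S)) = 0" if S: "S \<in> F_lambda p" for S
    proof -
      have "case_prod (entry S) \<in> V"
        using mat_bound_entry[OF bounded_op_if_lp_ops[OF closed_subalgebra_lp_ops[OF F S]]] by (auto simp: V_def)
      moreover have "N (case_prod (entry S)) \<le> 0"
        by (rule NI[OF S]) (simp add: mat_bound_zero)
      ultimately have "norm (\<psi> (case_prod (entry S))) \<le> 0"
        using \<psi>(3)[of "case_prod (entry S)"] by linarith
      then show ?thesis by simp
    qed
    show "\<psi> ?T \<noteq> 0" by (rule \<psi>(4))
  qed
qed

lemma uniform_Roe_fixed_subset_F_lambda:
  fixes dG :: "'g::group_add \<Rightarrow> 'g \<Rightarrow> real" and dH :: "'h::group_add \<Rightarrow> 'h \<Rightarrow> real"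
  assumes dG: "proper_right_invariant_metric dG" and ap: "p_AP p TYPE('g)" and itap: "p_ITAP p dH"
  shows "uniform_Roe_fixed p (max_metric dG dH) \<subseteq> F_lambda p"
proof (rule subsetI, rule ccontr)
  fix T assume T: "T \<in> uniform_Roe_fixed p (max_metric dG dH)" and TF: "T \<notin> F_lambda p"
  have TL: "T \<in> lp_ops p UNIV" using T by (auto simp: uniform_Roe_fixed_iff uniform_Roe_iff)
  have ct: "countable (UNIV :: 'g set)" by (rule countable_if_proper_metric[OF dG])
  obtain \<psi> :: "(('g \<times> 'h) \<times> ('g \<times> 'h) \<Rightarrow> complex) \<Rightarrow> complex" where
    add: "\<And>a b C D. mat_bound p UNIV (curry a) C \<Longrightarrow> mat_bound p UNIV (curry b) D \<Longrightarrow> \<psi> (\<lambda>i. a i + b i) = \<psi> a + \<psi> b"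
    and scale: "\<And>c a C. mat_bound p UNIV (curry a) C \<Longrightarrow> \<psi> (\<lambda>i. c * a i) = c * \<psi> a"
    and bound: "\<And>a C. mat_bound p UNIV (curry a) C \<Longrightarrow> norm (\<psi> a) \<le> 2 * C"
    and vanish: "\<And>S. S \<in> F_lambda p \<Longrightarrow> \<psi> (case_prod (entry S)) = 0"
    and ne: "\<psi> (case_prod (entry T)) \<noteq> 0"
    by (rule F_lambda_separation[OF TL TF]) blast
  define M where "M a u = (\<lambda>(x, y). u (fst x - fst y) * a x y)" for a :: "'g \<times> 'h \<Rightarrow> 'g \<times> 'h \<Rightarrow> complex" and u :: "'g \<Rightarrow> complex"
  have M: "mat_bound p UNIV (curry (M a u)) (C * Mcb_norm p u)" if "u \<in> Mcb p" "mat_bound p UNIV a C" for a u C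
    using mat_bound_Mcb[OF that, of fst] by (simp add: M_def curry_def)
  let ?t = "entry T"
  have t: "mat_bound p UNIV ?t (op_norm p UNIV T)" by (rule mat_bound_entry[OF bounded_op_if_lp_ops[OF TL]])
  \<comment> \<open>Restricted to \<open>Mcb p\<close> because the members of
    \<open>Mcb_dual\<close> are extensional.\<close>
  define \<phi> where "\<phi> = (\<lambda>u\<in>Mcb p. \<psi> (M ?t u))"
  have \<phi>_dual: "\<phi> \<in> Mcb_dual p"
    unfolding Mcb_dual_def
  proof (intro CollectI conjI ballI allI)
    show "\<phi> \<in> extensional (Mcb p)" by (simp add: \<phi>_def)
    fix u :: "'g \<Rightarrow> complex" assume u: "u \<in> Mcb p"
    show "\<phi> (\<lambda>s. u s + v s) = \<phi> u + \<phi> v" if v: "v \<in> Mcb p" for v :: "'g \<Rightarrow> complex"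
    proof -
      have "M ?t (\<lambda>s. u s + v s) = (\<lambda>i. M ?t u i + M ?t v i)" by (auto simp: M_def distrib_right)
      then show ?thesis using add[OF M[OF u t] M[OF v t]] Mcb_add[OF u v] u v by (simp add: \<phi>_def)
    qed
    show "\<phi> (\<lambda>s. c * u s) = c * \<phi> u" for c
    proof -
      have "M ?t (\<lambda>s. c * u s) = (\<lambda>i. c * M ?t u i)" by (auto simp: M_def)
      then show ?thesis using scale[OF M[OF u t], of c] Mcb_scale[OF u] u by (simp add: \<phi>_def)
    qed
  next
    show "\<exists>C. \<forall>u\<in>Mcb p. norm (\<phi> u) \<le> C * Mcb_norm p u"
    proof (intro exI[of _ "2 * op_norm p UNIV T"] ballI)
      fix u :: "'g \<Rightarrow> complex" assume u: "u \<in> Mcb p"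
      show "norm (\<phi> u) \<le> 2 * op_norm p UNIV T * Mcb_norm p u"
        using bound[OF M[OF u t]] u by (simp add: \<phi>_def)
    qed
  qed
  have "\<phi> \<in> Q_pcb p"
    unfolding Q_pcb_def
  proof (intro CollectI conjI \<phi>_dual allI impI)
    fix \<epsilon> :: real assume "\<epsilon> > 0"
    \<comment> \<open>The bound for \<open>\<psi>\<close> carries the factor 2, so an approximant
      within \<open>\<epsilon> / 2\<close> leaves an error of at most
      \<open>\<epsilon> * Mcb_norm p u\<close>.\<close>
    then have e: "\<epsilon> / 2 > 0" by simp
    obtain S where S: "S \<in> lp_ops p UNIV" "finite_propagation (max_metric dG dH) S"
      "mat_bound p UNIV (\<lambda>x y. ?t x y - entry S x y) (\<epsilon> / 2)"
      using T e unfolding uniform_Roe_fixed_iff uniform_Roe_iff by blast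
    let ?s = "entry S"
    have s: "mat_bound p UNIV ?s (op_norm p UNIV S)" by (rule mat_bound_entry[OF bounded_op_if_lp_ops[OF S(1)]])
    obtain r where r: "\<And>x y. ?s x y \<noteq> 0 \<Longrightarrow> max_metric dG dH x y \<le> r"
      using S(2) unfolding finite_propagation_iff by blast
    \<comment> \<open>By right invariance, a nonzero entry of \<open>S\<close> has its difference of
      first coordinates in this ball, which is finite because \<open>dG\<close> is proper.\<close>
    define K where "K = {g. dG 0 g \<le> r}"
    have K: "finite K" using dG by (simp add: K_def proper_right_invariant_metric_def)
    have supp: "fst x - fst y \<in> K" if "?s x y \<noteq> 0" for x y
    proof -
      interpret G: Metric_space UNIV dG using dG by (simp add: proper_right_invariant_metric_def)
      have "dG (fst x - fst y + fst y) (0 + fst y) = dG (fst x - fst y) 0"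
        using dG unfolding proper_right_invariant_metric_def by blast
      moreover have "dG (fst x) (fst y) \<le> r" using r[OF that] by (simp add: max_metric_def)
      ultimately show ?thesis by (simp add: K_def G.commute)
    qed
    \<comment> \<open>Since the entries of \<open>S\<close> lie over \<open>K\<close>, the number
      \<open>\<psi> (M ?s u)\<close> is the finite sum of
      \<open>u g * \<psi> (M ?s (delta g))\<close>; these coefficients form the l^1 function
      approximating \<open>\<phi>\<close>.\<close>
    define f where "f g = (if g \<in> K then \<psi> (M ?s (delta g)) else 0)" for g
    have fL: "f \<in> lp 1 UNIV"
    proof -
      have "(\<lambda>i. norm (f i) powr 1) summable_on UNIV"
        by (rule finite_nonzero_values_imp_summable_on) (rule finite_subset[OF _ K], auto simp: f_def)
      then show ?thesis by (simp add: lp_def)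
    qed
    show "\<exists>f\<in>lp 1 UNIV. \<forall>u\<in>Mcb p. norm (\<phi> u - (\<Sum>\<^sub>\<infinity>s. f s * u s)) \<le> \<epsilon> * Mcb_norm p u"
    proof (intro bexI[OF _ fL] ballI)
      fix u :: "'g \<Rightarrow> complex" assume u: "u \<in> Mcb p"
      have dM: "mat_bound p UNIV (curry (M ?s (delta g))) (op_norm p UNIV S * Mcb_norm p (delta g))" for g
        by (rule M[OF Ap_subset_Mcb[OF ct delta_in_Ap] s])
      \<comment> \<open>The existence of a bound is carried through the induction because
        \<open>\<psi>\<close> is known to be additive only on bounded matrices.\<close>
      have sum: "\<psi> (\<lambda>i. \<Sum>g\<in>L. u g * M ?s (delta g) i) = (\<Sum>g\<in>L. u g * \<psi> (M ?s (delta g))) \<and>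
          (\<exists>C. mat_bound p UNIV (curry (\<lambda>i. \<Sum>g\<in>L. u g * M ?s (delta g) i)) C)" if "finite L" for L
        using that
      proof (induction L rule: finite_induct)
        case empty
        have 0: "mat_bound p UNIV (curry (\<lambda>_. 0 :: complex)) 0" by (simp add: curry_def mat_bound_zero)
        show ?case using bound[OF 0] by (auto simp: curry_def intro!: exI[of _ 0] mat_bound_zero)
      next
        case (insert g L)
        then obtain C where C: "mat_bound p UNIV (curry (\<lambda>i. \<Sum>g\<in>L. u g * M ?s (delta g) i)) C" by blast
        have g: "mat_bound p UNIV (curry (\<lambda>i. u g * M ?s (delta g) i)) (norm (u g) * (op_norm p UNIV S * Mcb_norm p (delta g)))"
          using mat_bound_scale[OF dM[of g], of "u g"] by (simp add: curry_def)
        have mb: "mat_bound p UNIV (curry (\<lambda>i. \<Sum>g\<in>insert g L. u g * M ?s (delta g) i)) (norm (u g) * (op_norm p UNIV S * Mcb_norm p (delta g)) + C)"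
          using mat_bound_add[OF g C] insert(1,2) by (simp add: curry_def)
        show ?case
        proof
          show "\<psi> (\<lambda>i. \<Sum>g\<in>insert g L. u g * M ?s (delta g) i) = (\<Sum>g\<in>insert g L. u g * \<psi> (M ?s (delta g)))"
            using add[OF g C] scale[OF dM[of g], of "u g"] insert by simp
          show "\<exists>C. mat_bound p UNIV (curry (\<lambda>i. \<Sum>g\<in>insert g L. u g * M ?s (delta g) i)) C"
            using mb by blast
        qed
      qed
      have "M ?s u = (\<lambda>i. \<Sum>g\<in>K. u g * M ?s (delta g) i)"
      proof
        fix i :: "('g \<times> 'h) \<times> ('g \<times> 'h)"
        obtain x y where i: "i = (x, y)" by (cases i)
        have "(\<Sum>g\<in>K. u g * M ?s (delta g) i) = (\<Sum>g\<in>K. if g = fst x - fst y then u g * ?s x y else 0)"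
          by (intro sum.cong refl) (auto simp: M_def i delta_def)
        also have "\<dots> = u (fst x - fst y) * ?s x y" using K supp[of x y] by (auto simp: sum.delta)
        finally show "M ?s u i = (\<Sum>g\<in>K. u g * M ?s (delta g) i)" by (simp add: M_def i)
      qed
      then have \<psi>s: "\<psi> (M ?s u) = (\<Sum>g\<in>K. u g * \<psi> (M ?s (delta g)))" using sum[OF K] by simp
      have "(\<Sum>\<^sub>\<infinity>g. f g * u g) = (\<Sum>\<^sub>\<infinity>g\<in>K. f g * u g)"
        by (rule infsum_cong_neutral) (auto simp: f_def)
      also have "\<dots> = \<psi> (M ?s u)" using K by (simp add: \<psi>s f_def mult.commute)
      finally have fs: "(\<Sum>\<^sub>\<infinity>g. f g * u g) = \<psi> (M ?s u)" .
      \<comment> \<open>The error comes from the multiplier acting on the matrix of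
        \<open>T - S\<close>; by \<open>mat_bound_Mcb\<close> it is controlled by
        \<open>Mcb_norm p u\<close> alone, which gives the uniformity in \<open>u\<close> that
        \<open>Q_pcb\<close> demands.\<close>
      have "M ?t u = (\<lambda>i. M (\<lambda>x y. ?t x y - ?s x y) u i + M ?s u i)" by (auto simp: M_def algebra_simps)
      then have "\<psi> (M ?t u) = \<psi> (M (\<lambda>x y. ?t x y - ?s x y) u) + \<psi> (M ?s u)"
        using add[OF M[OF u S(3)] M[OF u s]] by simp
      then have "\<phi> u - (\<Sum>\<^sub>\<infinity>g. f g * u g) = \<psi> (M (\<lambda>x y. ?t x y - ?s x y) u)"
        using u by (simp add: \<phi>_def fs)
      then show "norm (\<phi> u - (\<Sum>\<^sub>\<infinity>g. f g * u g)) \<le> \<epsilon> * Mcb_norm p u"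
        using bound[OF M[OF u S(3)]] by simp
    qed
  qed
  moreover obtain F :: "('g \<Rightarrow> complex) filter" where F: "F \<noteq> bot" "\<forall>\<^sub>F u in F. u \<in> Ap p"
    "\<And>\<phi>. \<phi> \<in> Q_pcb p \<Longrightarrow> (\<phi> \<longlongrightarrow> \<phi> (\<lambda>_. 1)) F"
    using ap unfolding p_AP_def by blast
  ultimately have lim: "(\<phi> \<longlongrightarrow> \<phi> (\<lambda>_. 1)) F" by blast
  have "\<phi> u = 0" if u: "u \<in> Ap p" for u
  proof -
    have "M ?t u = case_prod (entry (fst_mult p u T))"
      by (auto simp: M_def entry_fst_mult)
    then show ?thesis
      using vanish[OF fst_mult_Ap_F_lambda[OF itap T u]] Ap_subset_Mcb[OF ct u] by (simp add: \<phi>_def)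
  qed
  then have "\<forall>\<^sub>F u in F. \<phi> u = 0" using F(2) by (auto elim: eventually_mono)
  then have "(\<phi> \<longlongrightarrow> 0) F" by (rule tendsto_eventually)
  then have "\<phi> (\<lambda>_. 1) = 0" using tendsto_unique[OF F(1) lim] by simp
  moreover have "\<phi> (\<lambda>_. 1) = \<psi> (case_prod ?t)"
  proof -
    have "(\<lambda>_ :: 'g. 1) \<in> Mcb p" by (rule one_in_Mcb)
    then show ?thesis by (simp add: \<phi>_def M_def)
  qed
  ultimately show False using ne by simp
qed

end

theorem theorem7p4:
  fixes p :: real
    and dG :: "'g::group_add \<Rightarrow> 'g \<Rightarrow> real"
    and dH :: "'h::group_add \<Rightarrow> 'h \<Rightarrow> real"
  assumes "1 < p"
    and "proper_right_invariant_metric dG"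
    and "proper_right_invariant_metric dH"
    and "p_AP p TYPE('g)"
    and "p_ITAP p dH"
  shows "p_ITAP p (max_metric dG dH)"
proof -
  interpret lp_exponent p by unfold_locales (rule assms(1))
  show ?thesis
    unfolding p_ITAP_def
  proof
    show "F_lambda p \<subseteq> uniform_Roe_fixed p (max_metric dG dH)"
      by (rule F_lambda_subset_uniform_Roe_fixed[OF max_metric_proper[OF assms(2,3)]])
    show "uniform_Roe_fixed p (max_metric dG dH) \<subseteq> F_lambda p"
      by (rule uniform_Roe_fixed_subset_F_lambda[OF assms(2,4,5)])
  qed
qed

end
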